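(* Let $D\subset\mathbb{R}^s$ be a convex polyhedral set, let $g:\mathbb{R}^l\times\mathbb{R}^n\times\mathbb{R}^n\to\mathbb{R}^s$ be twice continuously differentiable, and let $\Gamma(p,x):=\{z\in\mathbb{R}^n: g(p,x,z)\in D\}$. Let $(\bar p,\bar x)$ satisfy $g(\bar p,\bar x,\bar x)\in D$ and assume that there is $\kappa>0$ such that for all $(p,x,z)$ in a neighbourhood of $(\bar p,\bar x,\bar x)$ \[\mathrm{dist}(z,\Gamma(p,x))\le\kappa\,\mathrm{dist}(g(p,x,z),D).\] For $y=(p,x)\in\mathbb{R}^l\times\mathbb{R}^n$ put $\tilde g(y)=g(p,x,x)$, $\beta(y)=\nabla_3g(p,x,x)$, $\mathcal{N}^\Gamma(y):=N_{\Gamma(p,x)}(x)$, and \[\Lambda(y,x^* ):=\{\lambda\in N_D(\tilde g(y)):\beta(y)^T\lambda=x^*\}.\] Let $y=(p,x)$ be sufficiently close to $(\bar p,\bar x)$ and let $x^*\in\mathcal{N}^\Gamma(y)$. For every $v\in\mathbb{R}^l\times\mathbb{R}^n$, \[D\mathcal{N}^\Gamma(y,x^* )(v)\subset\bigcup_{\lambda\in\Lambda(y,x^* )}\nabla\langle\lambda,\beta\rangle(y)v+\beta(y)^TN_{\mathcal{K}_D(\tilde g(y),\lambda)}(\nabla\tilde g(y)v).\] On the other hand, given $v\in\mathbb{R}^l\times\mathbb{R}^n$, $\lambda\in\Lambda(y,x^* )$ and $\eta\in N_{\mathcal{K}_D(\tilde g(y),\lambda)}(\nabla\tilde g(y)v)$,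 we have \[\nabla\langle\lambda,\beta\rangle(y)v+\beta(y)^T\eta\in D\mathcal{N}^\Gamma(y,x^* )(v),\] provided the mapping $(y',\lambda')\rightrightarrows(\tilde g(y'),\lambda')-\mathrm{gph}\,N_D$ is metrically subregular at $((y,\lambda),(0,0))$ in direction $(v,\eta)$; in particular, if \[\nabla\tilde g(y)^T\mu=0,\ \ \mu\in\mathrm{sp}\,N_{T_D(\tilde g(y))}(\nabla\tilde g(y)v)\ \Longrightarrow\ \mu=0.\tag{A}\] Moreover, if in addition to (A) also \[\beta(y)^T\mu=0,\ \ \mu\in\mathrm{sp}\,N_{T_D(\tilde g(y))}(\nabla\tilde g(y)v)\ \Longrightarrow\ \mu=0\] holds, then for $u^*\in D\mathcal{N}^\Gamma(y,x^* )(v)$ and arbitrary $w^*\in\mathbb{R}^n$, \[D^*\mathcal{N}^\Gamma((y,x^* );(v,u^* ))(w^* )\subset\bigcup_{\lambda\in\Lambda(y,x^* )}\ \bigcup_{\eta\in D\Lambda((y,x^* ),\lambda)(v,u^* )}\nabla\langle\lambda,\beta\rangle(y)^Tw^*+\nabla\tilde g(y)^TD^*N_D((\tilde g(y),\lambda);(\nabla\tilde g(y)v,\eta))(\beta(y)w^* ).\]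
   Context: $\nabla_3g$ is the partial Jacobian with respect to the third variable; $\langle\lambda,\beta\rangle(y)=\beta(y)^T\lambda$ and $\nabla\langle\lambda,\beta\rangle(y)$ is its Jacobian. $\mathrm{dist}(\cdot,\emptyset)=\infty$. A convex polyhedral set is a finite intersection of halfspaces. For a closed set $\Omega$ and $\bar z\in\Omega$: $T_\Omega(\bar z)=\{w:\exists t_k\downarrow0,\,w_k\to w,\ \bar z+t_kw_k\in\Omega\ \forall k\}$; $\widehat N_\Omega(\bar z)=T_\Omega(\bar z)^\circ$ (negative polar); limiting normal cone $N_\Omega(\bar z)=\{z^*:\exists z_k\to\bar z,\ z_k^*\to z^*,\ z_k^*\in\widehat N_\Omega(z_k)\}$ (the usual normal cone if $\Omega$ is convex); directional limiting normal cone $N_\Omega(\bar z;w)=\{z^*:\exists t_k\downarrow0,\ w_k\to w,\ z_k^*\to z^*,\ z_k^*\in\widehat N_\Omega(\bar z+t_kw_k)\}$. All are empty at points outside $\Omega$. $\mathrm{sp}\,A$ is the linear hull of $A$, with $\mathrm{sp}\,\emptyset=\{0\}$. Critical cone: $\mathcal{K}_D(z,z^* ):=T_D(z)\cap\{w:\langle z^*,w\rangle=0\}$. For a set-valued $M$ and $(\bar x,\bar y)\in\mathrm{gph}\,M$: graphical derivative $DM(\bar x,\bar y)(u)=\{v:(u,v)\in T_{\mathrm{gph}\,M}(\bar x,\bar y)\}$; directional limiting coderivative $D^*M((\bar x,\bar y);(u,v))(v^* )=\{u^*:(u^*,-v^* )\in N_{\mathrm{gph}\,M}((\bar x,\bar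 y);(u,v))\}$. $M$ is metrically subregular at $(\bar x,\bar y)\in\mathrm{gph}\,M$ in direction $u$ if there is $\kappa>0$ such that for every sequence $x_k=\bar x+t_ku_k$ with $t_k\downarrow0$, $u_k\to u$ one has $\mathrm{dist}(x_k,M^{-1}(\bar y))\le\kappa\,\mathrm{dist}(\bar y,M(x_k))$ for all sufficiently large $k$. *)

theory Defs
  imports "HOL-Analysis.Analysis"
begin

text \<open>
  Set-valued maps are functions into sets. Jacobians are represented by the linear maps they
  induce (Frechet derivatives) and transposed Jacobians by the adjoints of these linear maps.
  In sequences, \<open>t\<close> decreasing to zero means \<open>t k > 0\<close> and \<open>t \<longlonglongrightarrow> 0\<close>.
\<close>

abbreviation jac :: "('a::real_normed_vector \<Rightarrow> 'b::real_normed_vector) \<Rightarrow> 'a \<Rightarrow> 'a \<Rightarrow> 'b"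
  where "jac f a \<equiv> frechet_derivative f (at a)"

definition twice_continuously_differentiable ::
    "('a::real_normed_vector \<Rightarrow> 'b::real_normed_vector) \<Rightarrow> bool" where
  "twice_continuously_differentiable f \<longleftrightarrow>
     (\<exists>(f' :: 'a \<Rightarrow> 'a \<Rightarrow>\<^sub>L 'b) (f'' :: 'a \<Rightarrow> 'a \<Rightarrow>\<^sub>L ('a \<Rightarrow>\<^sub>L 'b)).
        (\<forall>a. (f has_derivative blinfun_apply (f' a)) (at a)) \<and>
        (\<forall>a. (f' has_derivative blinfun_apply (f'' a)) (at a)) \<and>
        continuous_on UNIV f'')"

text \<open>
  The library functions \<open>infdist\<close> and \<open>setdist\<close> return 0 on the empty set; here the distance
  to the empty set is infinite.
\<close>

definition dist_set :: "'a::metric_space \<Rightarrow> 'a set \<Rightarrow> ennreal" where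
  "dist_set a A = (INF b\<in>A. ennreal (dist a b))"

definition gph :: "('a \<Rightarrow> 'b set) \<Rightarrow> ('a \<times> 'b) set" where
  "gph M = {(a, b). b \<in> M a}"

text \<open>
  The conjuncts \<open>z \<in> \<Omega>\<close> make all cones empty at points outside \<open>\<Omega>\<close>. No closedness of \<open>\<Omega>\<close> is
  required, so that the definitions apply to graphs that are only locally closed.
\<close>

definition tangent_cone :: "'a::real_normed_vector set \<Rightarrow> 'a \<Rightarrow> 'a set" where
  "tangent_cone \<Omega> z = {w. z \<in> \<Omega> \<and>
     (\<exists>t ws. (\<forall>k::nat. 0 < t k) \<and> t \<longlonglongrightarrow> 0 \<and> ws \<longlonglongrightarrow> w \<and> (\<forall>k. z + t k *\<^sub>R ws k \<in> \<Omega>))}"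

definition regular_normal_cone :: "'a::real_inner set \<Rightarrow> 'a \<Rightarrow> 'a set" where
  "regular_normal_cone \<Omega> z = {zs. z \<in> \<Omega> \<and> (\<forall>w\<in>tangent_cone \<Omega> z. zs \<bullet> w \<le> 0)}"

definition normal_cone :: "'a::real_inner set \<Rightarrow> 'a \<Rightarrow> 'a set" where
  "normal_cone \<Omega> z = {zs. z \<in> \<Omega> \<and>
     (\<exists>a b. a \<longlonglongrightarrow> z \<and> b \<longlonglongrightarrow> zs \<and> (\<forall>k::nat. b k \<in> regular_normal_cone \<Omega> (a k)))}"

definition directional_normal_cone :: "'a::real_inner set \<Rightarrow> 'a \<Rightarrow> 'a \<Rightarrow> 'a set" where
  "directional_normal_cone \<Omega> z w = {zs. z \<in> \<Omega> \<and>
     (\<exists>t ws b. (\<forall>k::nat. 0 < t k) \<and> t \<longlonglongrightarrow> 0 \<and> ws \<longlonglongrightarrow> w \<and> b \<longlonglongrightarrow> zs \<and>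
        (\<forall>k. b k \<in> regular_normal_cone \<Omega> (z + t k *\<^sub>R ws k)))}"

definition critical_cone :: "'a::real_inner set \<Rightarrow> 'a \<Rightarrow> 'a \<Rightarrow> 'a set" where
  "critical_cone D z zs = tangent_cone D z \<inter> {w. zs \<bullet> w = 0}"

definition graphical_derivative ::
    "('a::real_normed_vector \<Rightarrow> 'b::real_normed_vector set) \<Rightarrow> 'a \<times> 'b \<Rightarrow> 'a \<Rightarrow> 'b set" where
  "graphical_derivative M q u = {v. (u, v) \<in> tangent_cone (gph M) q}"

definition directional_coderivative ::
    "('a::real_inner \<Rightarrow> 'b::real_inner set) \<Rightarrow> 'a \<times> 'b \<Rightarrow> 'a \<times> 'b \<Rightarrow> 'b \<Rightarrow> 'a set" where
  "directional_coderivative M q d vs = {us. (us, - vs) \<in> directional_normal_cone (gph M) q d}"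

definition metrically_subregular_in_direction ::
    "('a::real_normed_vector \<Rightarrow> 'b::real_normed_vector set) \<Rightarrow> 'a \<times> 'b \<Rightarrow> 'a \<Rightarrow> bool" where
  "metrically_subregular_in_direction M q u \<longleftrightarrow> q \<in> gph M \<and>
     (\<exists>\<kappa>>0. \<forall>t us. (\<forall>k::nat. 0 < t k) \<and> t \<longlonglongrightarrow> 0 \<and> us \<longlonglongrightarrow> u \<longrightarrow>
        (\<forall>\<^sub>F k in sequentially.
           dist_set (fst q + t k *\<^sub>R us k) {a. snd q \<in> M a}
             \<le> ennreal \<kappa> * dist_set (snd q) (M (fst q + t k *\<^sub>R us k))))"

definition Gam :: "('l \<times> 'n \<times> 'n \<Rightarrow> 's) \<Rightarrow> 's set \<Rightarrow> 'l \<times> 'n \<Rightarrow> 'n set" where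
  "Gam g D = (\<lambda>(p, x). {z. g (p, x, z) \<in> D})"

definition gtilde :: "('l \<times> 'n \<times> 'n \<Rightarrow> 's) \<Rightarrow> 'l \<times> 'n \<Rightarrow> 's" where
  "gtilde g = (\<lambda>(p, x). g (p, x, x))"

definition beta ::
    "('l \<times> 'n \<times> 'n \<Rightarrow> 's) \<Rightarrow> 'l \<times> 'n \<Rightarrow> 'n::real_normed_vector \<Rightarrow> 's::real_normed_vector" where
  "beta g = (\<lambda>(p, x). jac (\<lambda>z. g (p, x, z)) x)"

definition pair_beta ::
    "('l \<times> 'n \<times> 'n \<Rightarrow> 's::euclidean_space) \<Rightarrow> 's \<Rightarrow> 'l \<times> 'n \<Rightarrow> 'n::euclidean_space" where
  "pair_beta g lam y = adjoint (beta g y) lam"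

definition NGam :: "('l \<times> 'n \<times> 'n \<Rightarrow> 's) \<Rightarrow> 's set \<Rightarrow> 'l \<times> 'n \<Rightarrow> 'n::euclidean_space set" where
  "NGam g D = (\<lambda>(p, x). normal_cone (Gam g D (p, x)) x)"

definition Lam ::
    "('l \<times> 'n \<times> 'n \<Rightarrow> 's::euclidean_space) \<Rightarrow> 's set \<Rightarrow> ('l \<times> 'n::euclidean_space) \<times> 'n \<Rightarrow> 's set" where
  "Lam g D = (\<lambda>(y, xs). {lam \<in> normal_cone D (gtilde g y). adjoint (beta g y) lam = xs})"

definition subreg_map ::
    "('l \<times> 'n \<times> 'n \<Rightarrow> 's::euclidean_space) \<Rightarrow> 's set \<Rightarrow> ('l \<times> 'n) \<times> 's \<Rightarrow> ('s \<times> 's) set" where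
  "subreg_map g D = (\<lambda>(y, lam). {(gtilde g y, lam) - q | q. q \<in> gph (normal_cone D)})"

end

theory Submission
  imports Defs
begin

text \<open>
  Write \<open>w\<close> for the image of \<open>v\<close> under the Jacobian of \<open>gtilde g\<close>
  at \<open>y\<close>, \<open>T\<close> for the tangent cone of \<open>D\<close> at \<open>gtilde g y\<close>, and \<open>\<beta>\<close> for \<open>beta g\<close>.

  By the error bound, a regular normal \<open>b\<close> to \<open>Gam g D (p, x)\<close> at \<open>z\<close> satisfies
  \<open>b \<bullet> u \<le> \<kappa> |b| dist (h' u, T')\<close> for all \<open>u\<close>, where \<open>h'\<close> is the partial derivative of \<open>g\<close> in the third
  variable and \<open>T'\<close> the tangent cone of \<open>D\<close> at \<open>g (p, x, z)\<close>. Separating \<open>b\<close> from the compact convex set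
  of vectors generated by multipliers of norm at most \<open>\<kappa> |b|\<close> shows that such a multiplier exists.
  Because of the norm bound multipliers survive limits, so for all \<open>y\<close> near the reference point the normals are exactly the vectors
  \<open>\<beta>(y)\<^sup>T \<mu>\<close> with \<open>\<mu>\<close> normal to \<open>D\<close> at \<open>gtilde g y\<close> (\<open>normal_cone_preimage\<close>). From
  there on only this description of the normal cone mapping is used; it is the content of the locale
  \<open>multiplier_system\<close>.

  Polyhedrality of \<open>D\<close> enters through three facts. Seen from \<open>gtilde g y\<close> along \<open>w\<close>, nearby normals
  are normals to \<open>T\<close> at \<open>w\<close>, and they stay normals under small shifts orthogonal to all
  normals to \<open>T\<close> at \<open>w\<close> (\<open>directional_stability\<close>). The pair \<open>(w, \<eta>)\<close>, with \<open>\<eta>\<close> normal to the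
  critical cone at \<open>w\<close>, is realised by a straight segment in the graph of the normal cone mapping of
  \<open>D\<close> (\<open>critical_normal_ray\<close>). Linear images of polyhedral cones are closed
  (\<open>closed_linear_image_polyhedral_cone\<close>).

  \<^emph>\<open>Upper estimate of the graphical derivative.\<close> Multipliers \<open>\<mu>\<^sub>k\<close> along a tangent sequence have a
  cluster point \<open>\<mu>\<close>. The quotients \<open>(\<mu>\<^sub>k - \<mu>) / t\<^sub>k\<close> may be unbounded, but they lie in the normal cone
  of the critical cone, and their images under \<open>\<beta>(y)\<^sup>T\<close> converge; closedness of the image
  supplies \<open>\<eta>\<close>.

  \<^emph>\<open>Lower estimate.\<close> Metric subregularity moves the points of the segment belonging to \<open>(w, \<eta>)\<close> onto
  the curved graph at a cost \<open>o(t)\<close>. Condition (A) says that the derivative of \<open>gtilde g\<close> is onto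
  modulo the orthogonal complement of the normals to \<open>T\<close> at \<open>w\<close>. Graves' theorem then solves
  equations modulo this complement (\<open>graves_modulo_subspace\<close>), and shifts inside it do not
  disturb normals; together this gives subregularity (\<open>subregular\<close>).

  \<^emph>\<open>Coderivative.\<close> Under the second condition \<open>\<beta>(y)\<^sup>T\<close> is injective on the span of those
  normals, so now the quotients are bounded and have a cluster point \<open>\<eta>\<close>. By (A), tangents to the graph of the
  normal cone mapping of \<open>D\<close> lift to tangents of the graph under study (\<open>tangent_preimage\<close>); dually,
  regular normals of the latter come from regular normals of the former, with a component \<open>\<zeta>\<close> in the
  span of the normals, where (A) bounds it. Passing to the limit gives the inclusion.
\<close>

section \<open>Convex normal cones and tangent directions\<close>

text \<open>
  The normal cone of convex analysis. For closed convex sets it is the limiting normal cone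
  (\<open>normal_cone_convex\<close>), and it is free of sequences.
\<close>

definition cnormal :: "'a::real_inner set \<Rightarrow> 'a \<Rightarrow> 'a set" where
  "cnormal S z = {n. z \<in> S \<and> (\<forall>q\<in>S. n \<bullet> (q - z) \<le> 0)}"

lemma cnormalD: "n \<in> cnormal S z \<Longrightarrow> z \<in> S"
  "n \<in> cnormal S z \<Longrightarrow> q \<in> S \<Longrightarrow> n \<bullet> (q - z) \<le> 0"
  by (auto simp: cnormal_def)

text \<open>
  Tangent sequences arise below from points that are known to lie in the set only for large indices,
  and by their difference quotients rather than by directions.
\<close>

lemma tangent_coneI:
  fixes \<omega> :: "nat \<Rightarrow> 'a::real_normed_vector"
  assumes "z \<in> \<Omega>" and t: "\<And>k. 0 < t k" "t \<longlonglongrightarrow> 0"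
    and mem: "\<forall>\<^sub>F k in sequentially. \<omega> k \<in> \<Omega>"
    and lim: "(\<lambda>k. (\<omega> k - z) /\<^sub>R t k) \<longlonglongrightarrow> w"
  shows "w \<in> tangent_cone \<Omega> z"
proof -
  obtain m where m: "\<And>k. k \<ge> m \<Longrightarrow> \<omega> k \<in> \<Omega>"
    using mem by (auto simp: eventually_sequentially)
  define t' ws where "t' = (\<lambda>k. t (k + m))" and "ws = (\<lambda>k. (\<omega> (k + m) - z) /\<^sub>R t (k + m))"
  have "z + t' k *\<^sub>R ws k \<in> \<Omega>" for k
    using m[of "k + m"] t(1)[of "k + m"] by (simp add: t'_def ws_def)
  moreover have "t' \<longlonglongrightarrow> 0" "ws \<longlonglongrightarrow> w" "0 < t' k" for k
    using LIMSEQ_ignore_initial_segment[OF t(2)] LIMSEQ_ignore_initial_segment[OF lim] t(1)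
    by (auto simp: t'_def ws_def)
  ultimately show ?thesis
    using assms(1) unfolding tangent_cone_def by blast
qed

lemma tangent_coneE:
  assumes "w \<in> tangent_cone \<Omega> z"
  obtains t ws where "z \<in> \<Omega>" "\<And>k::nat. 0 < t k" "t \<longlonglongrightarrow> 0" "ws \<longlonglongrightarrow> w"
    "\<And>k. z + t k *\<^sub>R ws k \<in> \<Omega>"
  using assms unfolding tangent_cone_def by auto

lemma inverse_Suc_scale:
  assumes "0 < (e::real)"
  shows "\<And>k. 0 < e * inverse (real (Suc k))" "(\<lambda>k. e * inverse (real (Suc k))) \<longlonglongrightarrow> 0"
    "\<And>k. e * inverse (real (Suc k)) \<le> e"
proof -
  show "(\<lambda>k. e * inverse (real (Suc k))) \<longlonglongrightarrow> 0"
    using tendsto_mult_right_zero[OF LIMSEQ_inverse_real_of_nat] by simp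
  show "e * inverse (real (Suc k)) \<le> e" for k
    using assms by (simp add: field_simps)
qed (use assms in auto)

lemma tangent_cone_ray:
  fixes z :: "'a::real_normed_vector"
  assumes "0 < e" and "\<And>t. 0 < t \<Longrightarrow> t \<le> e \<Longrightarrow> z + t *\<^sub>R d \<in> \<Omega>" "z \<in> \<Omega>"
  shows "d \<in> tangent_cone \<Omega> z"
  using inverse_Suc_scale[OF assms(1)] assms unfolding tangent_cone_def
  by (intro CollectI conjI exI[of _ "\<lambda>k. e * inverse (real (Suc k))"] exI[of _ "\<lambda>_. d"]) auto

lemma convex_line_in:
  assumes "convex S" "z \<in> S" "q \<in> S" "0 \<le> t" "t \<le> (1::real)"
  shows "z + t *\<^sub>R (q - z) \<in> S"
proof -
  have "(1 - t) *\<^sub>R z + t *\<^sub>R q \<in> S"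
    using assms by (intro convexD) auto
  then show ?thesis by (simp add: algebra_simps)
qed

text \<open>
  Normality is a family of inequalities, one for each fixed \<open>q\<close> in the set, so it survives limits.
\<close>

lemma cnormal_limit:
  assumes "closed S" "a \<longlonglongrightarrow> z" "b \<longlonglongrightarrow> n" "\<forall>\<^sub>F k in sequentially. b k \<in> cnormal S (a k)"
  shows "n \<in> cnormal S z"
proof -
  have "z \<in> S"
    using assms(4) by (intro Lim_in_closed_set[OF assms(1) _ _ assms(2)])
      (auto elim: eventually_mono dest: cnormalD)
  moreover have "n \<bullet> (q - z) \<le> 0" if "q \<in> S" for q
  proof (rule tendsto_upperbound)
    show "(\<lambda>k. b k \<bullet> (q - a k)) \<longlonglongrightarrow> n \<bullet> (q - z)"
      by (intro tendsto_intros assms)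
    show "\<forall>\<^sub>F k in sequentially. b k \<bullet> (q - a k) \<le> 0"
      using assms(4) that by (auto elim!: eventually_mono dest: cnormalD)
  qed auto
  ultimately show ?thesis by (auto simp: cnormal_def)
qed

lemma normal_cone_convex:
  fixes S :: "'a::euclidean_space set"
  assumes "closed S" "convex S"
  shows "normal_cone S z = cnormal S z"
proof -
  have reg: "regular_normal_cone S a = cnormal S a" for a
  proof (intro equalityI subsetI)
    fix n assume n: "n \<in> regular_normal_cone S a"
    have "n \<bullet> (q - a) \<le> 0" if "q \<in> S" for q
    proof -
      have "q - a \<in> tangent_cone S a"
        using n that convex_line_in[OF assms(2)]
        by (intro tangent_cone_ray[of 1]) (auto simp: regular_normal_cone_def)
      then show ?thesis using n by (auto simp: regular_normal_cone_def)
    qed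
    then show "n \<in> cnormal S a"
      using n by (auto simp: cnormal_def regular_normal_cone_def)
  next
    fix n assume n: "n \<in> cnormal S a"
    have "n \<bullet> w \<le> 0" if w: "w \<in> tangent_cone S a" for w
    proof -
      obtain t ws where t: "\<And>k::nat. 0 < t k" "ws \<longlonglongrightarrow> w" "\<And>k. a + t k *\<^sub>R ws k \<in> S"
        by (rule tangent_coneE[OF w]) (use that in blast)
      have "n \<bullet> ws k \<le> 0" for k
        using cnormalD(2)[OF n t(3)[of k]] t(1)[of k] by (simp add: mult_le_0_iff not_less)
      then show ?thesis
        by (intro tendsto_upperbound[of "\<lambda>k. n \<bullet> ws k" "n \<bullet> w" sequentially])
          (auto intro!: tendsto_intros t)
    qed
    then show "n \<in> regular_normal_cone S a"
      using n by (auto simp: regular_normal_cone_def cnormal_def)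
  qed
  show ?thesis
  proof (intro equalityI subsetI)
    fix n assume "n \<in> normal_cone S z"
    then obtain a b where ab: "a \<longlonglongrightarrow> z" "b \<longlonglongrightarrow> n" "\<And>k::nat. b k \<in> cnormal S (a k)"
      by (auto simp: normal_cone_def reg)
    show "n \<in> cnormal S z"
      by (rule cnormal_limit[OF assms(1) ab(1,2)]) (use ab(3) in auto)
  next
    fix n assume "n \<in> cnormal S z"
    then show "n \<in> normal_cone S z"
      unfolding normal_cone_def reg
      by (intro CollectI conjI exI[of _ "\<lambda>_. z"] exI[of _ "\<lambda>_. n"]) (auto dest: cnormalD)
  qed
qed

section \<open>Local geometry of polyhedra\<close>

lemma polyhedron_inequalities:
  fixes S :: "'a::euclidean_space set"
  assumes "polyhedron S"
  obtains F :: "('a \<times> real) set" where "finite F" "S = {x. \<forall>(a, b)\<in>F. a \<bullet> x \<le> b}"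
proof -
  obtain H where H: "finite H" "S = \<Inter>H" "\<forall>h\<in>H. \<exists>a b. a \<noteq> 0 \<and> h = {x. a \<bullet> x \<le> b}"
    using assms unfolding polyhedron_def by blast
  then obtain a b where ab: "\<And>h. h \<in> H \<Longrightarrow> h = {x. a h \<bullet> x \<le> b h}" by metis
  have "S = {x. \<forall>(a, b)\<in>(\<lambda>h. (a h, b h)) ` H. a \<bullet> x \<le> b}"
    using ab H(2) by auto
  then show ?thesis using that H(1) by blast
qed

text \<open>
  Inequalities that are inactive at \<open>z\<close> stay inactive nearby. So only the normals \<open>A\<close> of the active
  ones matter, and near \<open>z\<close> the polyhedron coincides with the shifted tangent cone.
\<close>

lemma polyhedron_tangent_cone:
  fixes S :: "'a::euclidean_space set"
  assumes "polyhedron S" "z \<in> S"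
  obtains A e where "finite A" "0 < e" "A \<subseteq> cnormal S z"
    "tangent_cone S z = {d. \<forall>a\<in>A. a \<bullet> d \<le> 0}"
    "\<And>d. norm d < e \<Longrightarrow> z + d \<in> S \<longleftrightarrow> d \<in> tangent_cone S z"
proof -
  obtain F :: "('a \<times> real) set" where F: "finite F" "S = {x. \<forall>(a, b)\<in>F. a \<bullet> x \<le> b}"
    by (rule polyhedron_inequalities[OF assms(1)])
  define A where "A = fst ` {(a, b) \<in> F. a \<bullet> z = b}"
  have "finite A" unfolding A_def by (intro finite_imageI finite_subset[OF _ F(1)]) auto
  have nrm: "A \<subseteq> cnormal S z"
    using assms(2) F(2) by (fastforce simp: A_def cnormal_def inner_diff_right)
  have "\<forall>\<^sub>F d in nhds 0. \<forall>(a, b)\<in>F. a \<bullet> z < b \<longrightarrow> a \<bullet> (z + d) < b"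
  proof (intro eventually_ball_finite[OF F(1)] ballI)
    fix p assume "p \<in> F"
    obtain a b where p: "p = (a, b)" by fastforce
    show "\<forall>\<^sub>F d in nhds 0. case p of (a, b) \<Rightarrow> a \<bullet> z < b \<longrightarrow> a \<bullet> (z + d) < b"
    proof (cases "a \<bullet> z < b")
      case True
      have "((\<lambda>d. a \<bullet> (z + d)) \<longlongrightarrow> a \<bullet> (z + 0)) (nhds 0)" by (intro tendsto_intros filterlim_ident)
      then show ?thesis using True p order_tendstoD(2) by fastforce
    qed (simp add: p)
  qed
  then obtain e where e: "0 < e" "\<And>d a b. norm d < e \<Longrightarrow> (a, b) \<in> F \<Longrightarrow> a \<bullet> z < b \<Longrightarrow> a \<bullet> (z + d) < b"
    by (force simp: eventually_nhds_metric)
  have loc: "z + d \<in> S \<longleftrightarrow> (\<forall>a\<in>A. a \<bullet> d \<le> 0)" if "norm d < e" for d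
  proof
    assume "z + d \<in> S" then show "\<forall>a\<in>A. a \<bullet> d \<le> 0"
      using nrm cnormalD(2)[of _ S z "z + d"] by auto
  next
    assume *: "\<forall>a\<in>A. a \<bullet> d \<le> 0"
    have "a \<bullet> (z + d) \<le> b" if ab: "(a, b) \<in> F" for a b
    proof (cases "a \<bullet> z < b")
      case True then show ?thesis using e(2)[OF \<open>norm d < e\<close> ab] by simp
    next
      case False
      then have "a \<bullet> z = b" using ab assms(2) F(2) by force
      moreover from this have "a \<in> A" using ab by (force simp: A_def)
      ultimately show ?thesis using * by (auto simp: inner_add_right)
    qed
    then show "z + d \<in> S" by (auto simp: F(2))
  qed
  have tan: "tangent_cone S z = {d. \<forall>a\<in>A. a \<bullet> d \<le> 0}"
  proof (intro equalityI subsetI CollectI ballI)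
    fix d a assume d: "d \<in> tangent_cone S z" and a: "a \<in> A"
    obtain t ws where t: "\<And>k::nat. 0 < t k" "ws \<longlonglongrightarrow> d" "\<And>k. z + t k *\<^sub>R ws k \<in> S"
      by (rule tangent_coneE[OF d]) (use that in blast)
    have "a \<bullet> ws k \<le> 0" for k
      using cnormalD(2)[OF subsetD[OF nrm a] t(3)[of k]] t(1)[of k] by (simp add: mult_le_0_iff not_less)
    then show "a \<bullet> d \<le> 0"
      by (intro tendsto_upperbound[of "\<lambda>k. a \<bullet> ws k" "a \<bullet> d" sequentially])
        (auto intro!: tendsto_intros t)
  next
    fix d assume d: "d \<in> {d. \<forall>a\<in>A. a \<bullet> d \<le> 0}"
    show "d \<in> tangent_cone S z"
    proof (rule tangent_cone_ray[of "e / (norm d + 1)"])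
      show "0 < e / (norm d + 1)" using e(1) by (simp add: add_nonneg_pos)
      fix t assume t: "0 < t" "t \<le> e / (norm d + 1)"
      have "t * (norm d + 1) \<le> e"
        using t by (simp add: pos_le_divide_eq add_nonneg_pos)
      then have "norm (t *\<^sub>R d) < e" using t(1) by (simp add: algebra_simps)
      then show "z + t *\<^sub>R d \<in> S" using d t(1) by (auto simp: loc mult_le_0_iff)
    qed (rule assms)
  qed
  show ?thesis using that[OF \<open>finite A\<close> e(1) nrm tan] loc tan by auto
qed

lemma polyhedron_tangent_cone_polyhedron:
  fixes S :: "'a::euclidean_space set"
  assumes "polyhedron S" "z \<in> S"
  shows "polyhedron (tangent_cone S z)" "conic (tangent_cone S z)"
proof -
  obtain A where A: "finite A" "tangent_cone S z = {d. \<forall>a\<in>A. a \<bullet> d \<le> 0}"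
    by (rule polyhedron_tangent_cone[OF assms]) (use that in blast)
  have "{d. \<forall>a\<in>A. a \<bullet> d \<le> 0} = \<Inter>((\<lambda>a. {d. a \<bullet> d \<le> 0}) ` A)" by auto
  then show "polyhedron (tangent_cone S z)"
    using A by (auto intro!: polyhedron_Inter simp: polyhedron_halfspace_le)
  show "conic (tangent_cone S z)"
    using A by (auto simp: conic_def mult_nonneg_nonpos)
qed

lemma diff_in_tangent_cone:
  assumes "polyhedron (S :: 'a::euclidean_space set)" "z \<in> S" "q \<in> S"
  shows "q - z \<in> tangent_cone S z"
  using assms convex_line_in[OF polyhedron_imp_convex[OF assms(1)] assms(2,3)]
  by (intro tangent_cone_ray[of 1]) auto

lemma cnormal_cone_iff:
  assumes "conic K" "w \<in> K"
  shows "n \<in> cnormal K w \<longleftrightarrow> n \<bullet> w = 0 \<and> (\<forall>q\<in>K. n \<bullet> q \<le> 0)"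
proof
  assume n: "n \<in> cnormal K w"
  have "2 *\<^sub>R w \<in> K" "0 \<in> K"
    using conicD[OF assms, of 2] conicD[OF assms, of 0] by auto
  from this[THEN cnormalD(2)[OF n]] have "n \<bullet> w = 0"
    by (simp add: algebra_simps inner_diff_right inner_add_right)
  then show "n \<bullet> w = 0 \<and> (\<forall>q\<in>K. n \<bullet> q \<le> 0)"
    using cnormalD(2)[OF n] by (auto simp: inner_diff_right)
next
  assume "n \<bullet> w = 0 \<and> (\<forall>q\<in>K. n \<bullet> q \<le> 0)"
  then show "n \<in> cnormal K w" using assms(2) by (auto simp: cnormal_def inner_diff_right)
qed

lemma cnormal_iff_tangent:
  assumes "polyhedron (S :: 'a::euclidean_space set)" "z \<in> S"
  shows "n \<in> cnormal S z \<longleftrightarrow> (\<forall>d\<in>tangent_cone S z. n \<bullet> d \<le> 0)"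
proof -
  obtain A e where A: "0 < e" "\<And>d. norm d < e \<Longrightarrow> z + d \<in> S \<longleftrightarrow> d \<in> tangent_cone S z"
    by (rule polyhedron_tangent_cone[OF assms]) (use that in blast)
  show ?thesis
  proof
    assume n: "n \<in> cnormal S z"
    show "\<forall>d\<in>tangent_cone S z. n \<bullet> d \<le> 0"
    proof
      fix d assume d: "d \<in> tangent_cone S z"
      define t where "t = e / (norm d + 1)"
      have t: "0 < t" using A(1) by (simp add: t_def add_nonneg_pos)
      have "t * (norm d + 1) = e" by (simp add: t_def add_nonneg_eq_0_iff)
      then have "norm (t *\<^sub>R d) < e" using t by (simp add: algebra_simps)
      then have "z + t *\<^sub>R d \<in> S"
        using A(2) conicD[OF polyhedron_tangent_cone_polyhedron(2)[OF assms] d] t by auto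
      from cnormalD(2)[OF n this] show "n \<bullet> d \<le> 0" using t by (simp add: mult_le_0_iff not_less)
    qed
  next
    assume "\<forall>d\<in>tangent_cone S z. n \<bullet> d \<le> 0"
    then show "n \<in> cnormal S z"
      using diff_in_tangent_cone[OF assms] assms(2) by (auto simp: cnormal_def)
  qed
qed

text \<open>
  If \<open>z + d\<close> is in the polyhedron and \<open>d\<close> is small then so is \<open>z + 2 d\<close>. Hence a normal at \<open>z + d\<close>
  vanishes on \<open>d\<close> and is a normal at \<open>z\<close>. A displacement \<open>l\<close> orthogonal to all normals at \<open>z\<close>
  leaves the values of the inequalities active at \<open>z\<close> unchanged, and so keeps points feasible and
  normals normal.
\<close>

lemma cnormal_near:
  fixes S :: "'a::euclidean_space set"
  assumes "polyhedron S" "z \<in> S"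
  obtains e where "0 < e"
    "\<And>d n. norm d < e \<Longrightarrow> n \<in> cnormal S (z + d) \<Longrightarrow> n \<in> cnormal S z"
    "\<And>d n l. norm d < e \<Longrightarrow> norm l < e \<Longrightarrow> n \<in> cnormal S (z + d) \<Longrightarrow>
       (\<forall>m\<in>cnormal S z. m \<bullet> l = 0) \<Longrightarrow> n \<in> cnormal S (z + d + l)"
proof -
  obtain A e where A: "finite A" "0 < e" "A \<subseteq> cnormal S z"
    "tangent_cone S z = {d. \<forall>a\<in>A. a \<bullet> d \<le> 0}"
    "\<And>d. norm d < e \<Longrightarrow> z + d \<in> S \<longleftrightarrow> d \<in> tangent_cone S z"
    by (rule polyhedron_tangent_cone[OF assms]) (use that in blast)
  note T = polyhedron_tangent_cone_polyhedron[OF assms]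
  have 1: "n \<in> cnormal S z \<and> n \<bullet> d = 0" if d: "norm d < e / 2" and n: "n \<in> cnormal S (z + d)" for d n
  proof -
    have "d \<in> tangent_cone S z" using cnormalD(1)[OF n] A(5)[of d] d norm_ge_zero[of d] by linarith
    then have "2 *\<^sub>R d \<in> tangent_cone S z" using conicD[OF T(2)] by auto
    moreover have "norm (2 *\<^sub>R d) < e" using d by simp
    ultimately have "z + 2 *\<^sub>R d \<in> S" using A(5) by blast
    from cnormalD(2)[OF n this] have "n \<bullet> d \<le> 0" by (simp add: algebra_simps scaleR_2 inner_add_right)
    moreover have "n \<bullet> d \<ge> 0" using cnormalD(2)[OF n assms(2)] by simp
    ultimately have "n \<bullet> d = 0" by simp
    then show ?thesis using n assms(2) by (auto simp: cnormal_def algebra_simps inner_diff_right)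
  qed
  show ?thesis
  proof (rule that[of "e / 2"])
    fix d n l assume d: "norm d < e / 2" and l: "norm l < e / 2" and n: "n \<in> cnormal S (z + d)"
      and orth: "\<forall>m\<in>cnormal S z. m \<bullet> l = 0"
    have "d \<in> tangent_cone S z" using cnormalD(1)[OF n] A(5)[of d] d norm_ge_zero[of d] by linarith
    then have "d + l \<in> tangent_cone S z"
      using orth A(3) by (auto simp: A(4) inner_add_right)
    moreover have "norm (d + l) < e" using d l norm_triangle_ineq[of d l] by linarith
    ultimately have mem: "z + d + l \<in> S" using A(5)[of "d + l"] by (simp add: add.assoc)
    have "n \<bullet> l = 0" using 1[OF d n] orth by blast
    then show "n \<in> cnormal S (z + d + l)"
      using mem n by (auto simp: cnormal_def algebra_simps inner_diff_right)
  qed (use 1 A(2) in auto)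
qed

text \<open>
  Rescaling by \<open>t\<close> carries \<open>D\<close> near \<open>z\<close>, seen along \<open>w\<close>, to its tangent cone near \<open>w\<close>, where
  \<open>cnormal_near\<close> applies. Since the cone is scale invariant, one radius serves all small \<open>t\<close>, and
  shifts of size proportional to \<open>t\<close> are admitted.
\<close>

lemma directional_stability:
  fixes D :: "'a::euclidean_space set"
  assumes D: "polyhedron D" "z \<in> D" and w: "w \<in> tangent_cone D z"
  obtains e where "0 < e"
    "\<And>t w' n. 0 < t \<Longrightarrow> t < e \<Longrightarrow> norm (w' - w) < e \<Longrightarrow> n \<in> cnormal D (z + t *\<^sub>R w') \<Longrightarrow>
       n \<in> cnormal (tangent_cone D z) w"
    "\<And>t w' n l. 0 < t \<Longrightarrow> t < e \<Longrightarrow> norm (w' - w) < e \<Longrightarrow> n \<in> cnormal D (z + t *\<^sub>R w') \<Longrightarrow>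
       norm l < e \<Longrightarrow> (\<forall>m\<in>cnormal (tangent_cone D z) w. m \<bullet> l = 0) \<Longrightarrow>
       n \<in> cnormal D (z + t *\<^sub>R (w' + l))"
proof -
  let ?T = "tangent_cone D z"
  obtain r where r: "0 < r" "\<And>d. norm d < r \<Longrightarrow> z + d \<in> D \<longleftrightarrow> d \<in> ?T"
    by (rule polyhedron_tangent_cone[OF D]) (use that in blast)
  note T = polyhedron_tangent_cone_polyhedron[OF D]
  obtain s where s: "0 < s"
    "\<And>d n. norm d < s \<Longrightarrow> n \<in> cnormal ?T (w + d) \<Longrightarrow> n \<in> cnormal ?T w"
    "\<And>d n l. norm d < s \<Longrightarrow> norm l < s \<Longrightarrow> n \<in> cnormal ?T (w + d) \<Longrightarrow>
       (\<forall>m\<in>cnormal ?T w. m \<bullet> l = 0) \<Longrightarrow> n \<in> cnormal ?T (w + d + l)"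
    by (rule cnormal_near[OF T(1) w]) (use that in blast)
  \<comment> \<open>room for \<open>w' + l\<close> with \<open>w'\<close> and \<open>l\<close> closer than 1 to \<open>w\<close> and 0\<close>
  define R where "R = norm w + 2"
  define e where "e = min 1 (min s (r / R))"
  have R: "0 < R" by (simp add: R_def add_nonneg_pos)
  have e: "0 < e" "e \<le> 1" "e \<le> s" "e \<le> r / R" using r s R by (auto simp: e_def)
  have small: "norm (t *\<^sub>R u) < r" if "0 < t" "t < e" "norm u \<le> R" for t u
  proof -
    have "t * norm u \<le> t * R" using that by (intro mult_left_mono) auto
    also have "\<dots> < e * R" using that R by (intro mult_strict_right_mono) auto
    also have "\<dots> \<le> r" using e R by (simp add: field_simps)
    finally show ?thesis using that by simp
  qed
  have conv: "n \<in> cnormal ?T u" if t: "0 < t" "t < e" "norm u \<le> R" and n: "n \<in> cnormal D (z + t *\<^sub>R u)" for t u n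
  proof -
    have tu: "t *\<^sub>R u \<in> ?T" using cnormalD(1)[OF n] r(2)[OF small[OF t]] by simp
    then have u: "u \<in> ?T" using conicD[OF T(2) tu, of "inverse t"] t by simp
    have "n \<bullet> (q - u) \<le> 0" if q: "q \<in> ?T" for q
    proof -
      \<comment> \<open>the segment from \<open>u\<close> to \<open>q\<close> starts inside the region where \<open>D\<close> and the cone agree\<close>
      have "\<exists>c>0. c \<le> 1 \<and> norm (t *\<^sub>R (u + c *\<^sub>R (q - u))) < r"
      proof -
        have "((\<lambda>c. norm (t *\<^sub>R (u + c *\<^sub>R (q - u)))) \<longlongrightarrow> norm (t *\<^sub>R (u + 0 *\<^sub>R (q - u)))) (at_right 0)"
          by (intro tendsto_intros)
        then have "\<forall>\<^sub>F c in at_right (0::real). norm (t *\<^sub>R (u + c *\<^sub>R (q - u))) < r"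
          using small[OF t] by (intro order_tendstoD(2)) auto
        moreover have "\<forall>\<^sub>F c in at_right (0::real). 0 < c \<and> c \<le> 1"
          unfolding eventually_at_right_field by (rule exI[of _ 1]) auto
        ultimately have "\<forall>\<^sub>F c in at_right (0::real). 0 < c \<and> c \<le> 1 \<and> norm (t *\<^sub>R (u + c *\<^sub>R (q - u))) < r"
          by eventually_elim auto
        from eventually_happens'[OF _ this] show ?thesis by auto
      qed
      then obtain c where c: "0 < c" "c \<le> 1" "norm (t *\<^sub>R (u + c *\<^sub>R (q - u))) < r" by auto
      have "u + c *\<^sub>R (q - u) \<in> ?T"
        using convex_line_in[OF polyhedron_imp_convex[OF T(1)] u q] c by simp
      then have "z + t *\<^sub>R (u + c *\<^sub>R (q - u)) \<in> D"
        using r(2)[OF c(3)] conicD[OF T(2), of "u + c *\<^sub>R (q - u)" t] t by simp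
      from cnormalD(2)[OF n this] have "t * (c * (n \<bullet> (q - u))) \<le> 0"
        by (simp add: algebra_simps inner_add_right)
      then show ?thesis using t(1) c(1) by (simp add: mult_le_0_iff not_less zero_less_mult_iff)
    qed
    then show ?thesis using u by (auto simp: cnormal_def)
  qed
  have lift: "n \<in> cnormal D (z + t *\<^sub>R u)" if t: "0 < t" "t < e" "norm u \<le> R" and n: "n \<in> cnormal ?T u" for t u n
  proof -
    have u: "u \<in> ?T" and nu: "n \<bullet> u = 0" "\<And>q. q \<in> ?T \<Longrightarrow> n \<bullet> q \<le> 0"
      using n cnormalD(1)[OF n] cnormal_cone_iff[OF T(2)] by auto
    have "z + t *\<^sub>R u \<in> D"
      using r(2)[OF small[OF t]] conicD[OF T(2) u] t by auto
    moreover have "n \<bullet> (q - (z + t *\<^sub>R u)) \<le> 0" if "q \<in> D" for q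
      using nu(2)[OF diff_in_tangent_cone[OF D that]] nu(1)
      by (simp add: inner_diff_right inner_add_right)
    ultimately show ?thesis by (auto simp: cnormal_def)
  qed
  show ?thesis
  proof (rule that[OF e(1)])
    fix t w' n assume *: "0 < t" "t < e" "norm (w' - w) < e" "n \<in> cnormal D (z + t *\<^sub>R w')"
    have nw: "norm w' \<le> norm w + norm (w' - w)" using norm_triangle_ineq[of w "w' - w"] by simp
    have n': "n \<in> cnormal ?T (w + (w' - w))"
      using conv[OF *(1,2) _ *(4)] nw * e by (simp add: R_def)
    then show "n \<in> cnormal ?T w" using s(2)[of "w' - w"] * e by force
    fix l assume l: "norm l < e" "\<forall>m\<in>cnormal ?T w. m \<bullet> l = 0"
    have "n \<in> cnormal ?T (w' + l)" using s(3)[of "w' - w" l n] n' l * e by force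
    moreover have "norm (w' + l) \<le> R"
      using nw norm_triangle_ineq[of w' l] * l e by (simp add: R_def)
    ultimately show "n \<in> cnormal D (z + t *\<^sub>R (w' + l))" using lift * by blast
  qed
qed

text \<open>
  Cutting the cone with a box produces a polytope, and its finitely many vertices generate the cone.
\<close>

lemma polyhedral_cone_dual:
  fixes K :: "'a::euclidean_space set"
  assumes "polyhedron K" "conic K"
  obtains V where "finite V" "V \<subseteq> K" "\<And>n. (\<forall>q\<in>K. n \<bullet> q \<le> 0) \<longleftrightarrow> (\<forall>v\<in>V. n \<bullet> v \<le> 0)"
proof -
  let ?B = "cbox (- One) (One :: 'a)"
  have "polytope (?B \<inter> K)"
    using polytope_Int_polyhedron[OF polytope_interval assms(1)] .
  then obtain V where V: "finite V" "?B \<inter> K = convex hull V" by (auto simp: polytope_def)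
  show ?thesis
  proof (rule that[OF V(1)])
    show "V \<subseteq> K" using V(2) hull_subset[of V convex] by blast
    fix n :: 'a
    show "(\<forall>q\<in>K. n \<bullet> q \<le> 0) \<longleftrightarrow> (\<forall>v\<in>V. n \<bullet> v \<le> 0)"
    proof
      assume "\<forall>q\<in>K. n \<bullet> q \<le> 0" then show "\<forall>v\<in>V. n \<bullet> v \<le> 0" using \<open>V \<subseteq> K\<close> by blast
    next
      assume "\<forall>v\<in>V. n \<bullet> v \<le> 0"
      then have hull: "convex hull V \<subseteq> {x. n \<bullet> x \<le> 0}"
        by (intro hull_minimal convex_halfspace_le) auto
      show "\<forall>q\<in>K. n \<bullet> q \<le> 0"
      proof
        fix q assume q: "q \<in> K"
        define c where "c = inverse (norm q + 1)"
        have c: "0 < c" by (simp add: c_def add_nonneg_pos)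
        have "c * (norm q + 1) = 1" by (simp add: c_def add_nonneg_eq_0_iff)
        then have "norm (c *\<^sub>R q) \<le> 1" using c by (simp add: algebra_simps)
        then have "\<bar>c *\<^sub>R q \<bullet> i\<bar> \<le> 1" if "i \<in> Basis" for i
          using Basis_le_norm[OF that, of "c *\<^sub>R q"] by linarith
        then have "c *\<^sub>R q \<in> ?B" by (force simp: mem_box abs_le_iff)
        moreover have "c *\<^sub>R q \<in> K" using conicD[OF assms(2) q] c by simp
        ultimately have "n \<bullet> (c *\<^sub>R q) \<le> 0" using V(2) hull by blast
        then show "n \<bullet> q \<le> 0" using c by (simp add: mult_le_0_iff not_less)
      qed
    qed
  qed
qed

text \<open>
  Take preimages \<open>\<nu> k\<close> of least norm. If they had no bounded subsequence, their normalised limit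
  \<open>v\<close> would lie in the cone and in the kernel of \<open>f\<close>. Since there are only finitely many
  inequalities, \<open>\<nu> k - v\<close> would remain in the cone for large \<open>k\<close>; it has the same image and a
  smaller norm.
\<close>

lemma closed_linear_image_polyhedral_cone:
  fixes f :: "'a::euclidean_space \<Rightarrow> 'b::euclidean_space"
  assumes "finite A" and f: "linear f"
  shows "closed (f ` {n. \<forall>a\<in>A. a \<bullet> n \<le> 0})"
  unfolding closed_sequential_limits
proof (intro allI impI, elim conjE)
  fix d :: "nat \<Rightarrow> 'b" and y
  let ?C = "{n. \<forall>a\<in>A. a \<bullet> n \<le> 0}"
  have cl: "closed ?C"
    using closed_INT[of A "\<lambda>a. {n. a \<bullet> n \<le> 0}"] by (simp add: closed_halfspace_le Collect_ball_eq)
  have cf: "continuous_on S f" for S using linear_continuous_on f linear_conv_bounded_linear by blast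
  assume d: "\<forall>k. d k \<in> f ` ?C" and lim: "d \<longlonglongrightarrow> y"
  have "\<exists>\<nu>. \<nu> \<in> ?C \<and> f \<nu> = d k \<and> (\<forall>x\<in>?C. f x = d k \<longrightarrow> norm \<nu> \<le> norm x)" for k
  proof -
    have "closed (?C \<inter> f -` {d k})"
      using continuous_closed_preimage[OF cf cl, of "{d k}"] by simp
    moreover have "?C \<inter> f -` {d k} \<noteq> {}" using d[rule_format, of k] by auto
    ultimately obtain \<nu> where "\<nu> \<in> ?C \<inter> f -` {d k}" "\<And>x. x \<in> ?C \<inter> f -` {d k} \<Longrightarrow> dist 0 \<nu> \<le> dist 0 x"
      by (rule distance_attains_inf[of _ 0]) (use that in blast)
    then show ?thesis by (intro exI[of _ \<nu>]) auto
  qed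
  then have "\<exists>\<nu>. \<forall>k. \<nu> k \<in> ?C \<and> f (\<nu> k) = d k \<and> (\<forall>x\<in>?C. f x = d k \<longrightarrow> norm (\<nu> k) \<le> norm x)"
    by (intro choice) auto
  then obtain \<nu> where \<nu>: "\<And>k. \<nu> k \<in> ?C" "\<And>k. f (\<nu> k) = d k"
    "\<And>k x. x \<in> ?C \<Longrightarrow> f x = d k \<Longrightarrow> norm (\<nu> k) \<le> norm x" by blast
  show "y \<in> f ` ?C"
  proof (cases "\<exists>r::nat \<Rightarrow> nat. strict_mono r \<and> bounded (range (\<nu> \<circ> r))")
    case True
    then obtain r where r: "strict_mono (r :: nat \<Rightarrow> nat)" "bounded (range (\<nu> \<circ> r))" by blast
    obtain l s where s: "strict_mono (s::nat\<Rightarrow>nat)" "((\<nu> \<circ> r) \<circ> s) \<longlonglongrightarrow> l"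
      using bounded_imp_convergent_subsequence[OF r(2)] by auto
    have "l \<in> ?C" using closed_sequentially[OF cl _ s(2)] \<nu>(1) by auto
    moreover have "(\<lambda>k. f ((\<nu> \<circ> r \<circ> s) k)) \<longlonglongrightarrow> f l"
      using s(2) bounded_linear.tendsto f linear_conv_bounded_linear by blast
    moreover have "(\<lambda>k. f ((\<nu> \<circ> r \<circ> s) k)) \<longlonglongrightarrow> y"
      using LIMSEQ_subseq_LIMSEQ[OF lim strict_mono_o[OF r(1) s(1)]] by (simp add: \<nu>(2) o_def)
    ultimately show ?thesis using LIMSEQ_unique by blast
  next
    case unb: False
    have "filterlim (\<lambda>k. norm (\<nu> k)) at_top sequentially"
    proof (rule ccontr)
      assume "\<not> ?thesis"
      then obtain M where "\<exists>\<^sub>F k in sequentially. norm (\<nu> k) < M"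
        unfolding filterlim_at_top by (auto simp: not_eventually not_le)
      then have "infinite {k. norm (\<nu> k) < M}" by (simp add: frequently_cofinite flip: cofinite_eq_sequentially)
      then obtain r :: "nat \<Rightarrow> nat" where "strict_mono r" "\<And>k. r k \<in> {k. norm (\<nu> k) < M}"
        using infinite_enumerate by blast
      then have "bounded (range (\<nu> \<circ> r))" by (intro boundedI[of _ M]) (auto intro: less_imp_le)
      then show False using unb \<open>strict_mono r\<close> by blast
    qed
    then have large: "\<forall>\<^sub>F k in sequentially. M \<le> norm (\<nu> k)" for M by (simp add: filterlim_at_top)
    define u where "u = (\<lambda>k. \<nu> k /\<^sub>R norm (\<nu> k))"
    have \<nu>_u: "\<nu> k = norm (\<nu> k) *\<^sub>R u k" for k by (cases "\<nu> k = 0") (auto simp: u_def)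
    have norm_u: "norm (u k) = 1" if "1 \<le> norm (\<nu> k)" for k
      using that by (cases "\<nu> k = 0") (auto simp: u_def)
    have "norm (u k) \<le> 1" for k by (cases "\<nu> k = 0") (auto simp: u_def)
    then have "bounded (range u)" by (intro boundedI[of _ 1]) auto
    then obtain v s where s: "strict_mono (s::nat\<Rightarrow>nat)" "(u \<circ> s) \<longlonglongrightarrow> v"
      using bounded_imp_convergent_subsequence by metis
    have large': "\<forall>\<^sub>F k in sequentially. M \<le> norm (\<nu> (s k))" for M
      using eventually_subseq[OF s(1) large] .
    have "(\<lambda>k. norm ((u \<circ> s) k)) \<longlonglongrightarrow> norm v" using s(2) by (intro tendsto_intros)
    moreover have "(\<lambda>k. norm ((u \<circ> s) k)) \<longlonglongrightarrow> 1"
      by (rule tendsto_eventually, rule eventually_mono[OF large'[of 1]]) (auto simp: norm_u)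
    ultimately have nv: "norm v = 1" using LIMSEQ_unique by blast
    \<comment> \<open>the limit direction is a recession direction in the kernel\<close>
    have "f v = 0"
    proof -
      have "(\<lambda>k. f ((u \<circ> s) k)) \<longlonglongrightarrow> f v"
        using s(2) bounded_linear.tendsto f linear_conv_bounded_linear by blast
      moreover have "(\<lambda>k. f ((u \<circ> s) k)) \<longlonglongrightarrow> 0"
      proof -
        have "filterlim (\<lambda>k. norm (\<nu> (s k))) at_top sequentially"
          using large' by (simp add: filterlim_at_top)
        then have "(\<lambda>k. inverse (norm (\<nu> (s k)))) \<longlonglongrightarrow> 0" by (rule tendsto_inverse_0_at_top)
        then have "(\<lambda>k. inverse (norm (\<nu> (s k))) *\<^sub>R d (s k)) \<longlonglongrightarrow> 0 *\<^sub>R y"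
          using LIMSEQ_subseq_LIMSEQ[OF lim s(1)] by (intro tendsto_scaleR) (auto simp: o_def)
        then show ?thesis using f by (simp add: u_def linear_scale \<nu>(2))
      qed
      ultimately show ?thesis using LIMSEQ_unique by blast
    qed
    have "\<forall>\<^sub>F k in sequentially. \<forall>a\<in>A. a \<bullet> (\<nu> (s k) - v) \<le> 0"
    proof (intro eventually_ball_finite[OF assms(1)] ballI)
      fix a assume a: "a \<in> A"
      have le: "a \<bullet> u k \<le> 0" for k using \<nu>(1)[of k] a by (auto simp: u_def mult_nonneg_nonpos)
      have lim_a: "(\<lambda>k. a \<bullet> u (s k)) \<longlonglongrightarrow> a \<bullet> v" using s(2) by (intro tendsto_intros) (auto simp: o_def)
      show "\<forall>\<^sub>F k in sequentially. a \<bullet> (\<nu> (s k) - v) \<le> 0"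
      proof (cases "a \<bullet> v < 0")
        case False
        then show ?thesis using \<nu>(1) a
          by (auto intro!: always_eventually simp: inner_diff_right) (meson not_less order_trans)
      next
        case True
        then have "\<forall>\<^sub>F k in sequentially. a \<bullet> u (s k) < (a \<bullet> v) / 2"
          using lim_a by (intro order_tendstoD(2)) auto
        with large'[of 2] show ?thesis
        proof eventually_elim
          case (elim k)
          have "a \<bullet> \<nu> (s k) = norm (\<nu> (s k)) * (a \<bullet> u (s k))"
            by (subst \<nu>_u) simp
          also have "\<dots> \<le> 2 * (a \<bullet> u (s k))"
            using elim le by (intro mult_right_mono_neg) auto
          finally show ?case using elim(2) by (simp add: inner_diff_right)
        qed
      qed
    qed
    moreover have "\<forall>\<^sub>F k in sequentially. 1 / 2 < u (s k) \<bullet> v"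
    proof -
      have "(\<lambda>k. u (s k) \<bullet> v) \<longlonglongrightarrow> v \<bullet> v" using s(2) by (intro tendsto_intros) (auto simp: o_def)
      then show ?thesis using nv by (intro order_tendstoD(1)) (auto simp: dot_square_norm)
    qed
    ultimately have "\<forall>\<^sub>F k in sequentially. False"
      using large'[of 1]
    proof eventually_elim
      case (elim k)
      have "norm (\<nu> (s k)) \<le> norm (\<nu> (s k) - v)"
        using elim \<open>f v = 0\<close> f by (intro \<nu>(3)) (auto simp: linear_diff \<nu>(2))
      then have "(norm (\<nu> (s k)))\<^sup>2 \<le> (norm (\<nu> (s k) - v))\<^sup>2" by (intro power_mono) auto
      then have "2 * (\<nu> (s k) \<bullet> v) \<le> 1"
        using nv by (simp add: power2_norm_eq_inner inner_diff_left inner_diff_right inner_commute norm_eq_1)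
      moreover have "\<nu> (s k) \<bullet> v = norm (\<nu> (s k)) * (u (s k) \<bullet> v)" by (subst \<nu>_u) simp
      moreover have "1 * (u (s k) \<bullet> v) \<le> norm (\<nu> (s k)) * (u (s k) \<bullet> v)"
        using elim by (intro mult_right_mono) auto
      ultimately show ?case using elim(2) by linarith
    qed
    then show ?thesis by simp
  qed
qed

section \<open>Solvability modulo a subspace\<close>

text \<open>
  Graves' theorem relative to a subspace \<open>L\<close>. A bounded linear choice \<open>s \<mapsto> (M1 s, M2 s)\<close> of solutions
  of \<open>f' a (M1 s) + M2 s = s\<close> turns the equation \<open>f (x + M1 s) + M2 s = q\<close> into a fixed point problem
  for a contraction with factor \<open>1/2\<close>, uniformly for \<open>x\<close> near \<open>a\<close>. The solution is within a multiple of the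
  initial residual.
\<close>

lemma graves_modulo_subspace:
  fixes f :: "'a::euclidean_space \<Rightarrow> 'b::euclidean_space" and f' :: "'a \<Rightarrow> 'a \<Rightarrow>\<^sub>L 'b"
  assumes deriv: "\<And>x. (f has_derivative blinfun_apply (f' x)) (at x)" and cont: "isCont f' a"
    and L: "subspace L" and surj: "\<And>q. \<exists>v l. l \<in> L \<and> f' a v + l = q"
  obtains c e where "0 < c" "0 < e"
    "\<And>x q. norm (x - a) < e \<Longrightarrow> norm (f x - q) < e \<Longrightarrow>
       \<exists>x' l. l \<in> L \<and> f x' = q + l \<and> norm (x' - x) \<le> c * norm (f x - q) \<and> norm l \<le> c * norm (f x - q)"
proof -
  obtain m n where mn: "\<And>q. n q \<in> L" "\<And>q. f' a (m q) + n q = q" using surj by metis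
  define M1 where "M1 = (\<lambda>q. \<Sum>i\<in>Basis. (q \<bullet> i) *\<^sub>R m i)"
  define M2 where "M2 = (\<lambda>q. \<Sum>i\<in>Basis. (q \<bullet> i) *\<^sub>R n i)"
  have lin: "linear M1" "linear M2"
    unfolding M1_def M2_def by (auto intro!: linearI simp: inner_add_left scaleR_add_left sum.distrib scaleR_sum_right)
  have M: "f' a (M1 q) + M2 q = q" for q
  proof -
    have "f' a (M1 q) + M2 q = (\<Sum>i\<in>Basis. (q \<bullet> i) *\<^sub>R (f' a (m i) + n i))"
      by (simp add: M1_def M2_def blinfun.sum_right blinfun.scaleR_right scaleR_add_right sum.distrib)
    also have "\<dots> = q" by (simp add: mn euclidean_representation)
    finally show ?thesis .
  qed
  have M2L: "M2 q \<in> L" for q unfolding M2_def by (intro subspace_sum[OF L] subspace_scale[OF L] mn)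
  obtain K1 where K1: "0 < K1" "\<And>q. norm (M1 q) \<le> K1 * norm q" using linear_bounded_pos[OF lin(1)] by blast
  obtain K2 where K2: "0 < K2" "\<And>q. norm (M2 q) \<le> K2 * norm q" using linear_bounded_pos[OF lin(2)] by blast
  define K where "K = K1 + K2"
  have K: "0 < K" "norm (M1 q) \<le> K * norm q" "norm (M2 q) \<le> K * norm q" for q
  proof -
    show "0 < K" using K1 K2 by (simp add: K_def)
    have "0 \<le> K1 * norm q" "0 \<le> K2 * norm q" using K1 K2 by auto
    then show "norm (M1 q) \<le> K * norm q" "norm (M2 q) \<le> K * norm q"
      using K1(2)[of q] K2(2)[of q] by (auto simp: K_def algebra_simps)
  qed
  have Kinv: "0 < 1 / (2 * K)" using K(1) by simp
  have "\<forall>\<^sub>F x in at a. dist (f' x) (f' a) < 1 / (2 * K)"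
    using tendstoD[OF isContD[OF cont] Kinv] .
  then obtain r where r: "0 < r" "\<And>x. dist x a < r \<Longrightarrow> dist (f' x) (f' a) < 1 / (2 * K)"
    unfolding eventually_at using Kinv by (metis UNIV_I dist_self)
  have lip: "norm (f x - f x' - f' a (x - x')) \<le> 1 / (2 * K) * norm (x - x')"
    if "x \<in> ball a r" "x' \<in> ball a r" for x x'
  proof -
    have "norm ((f x - f' a x) - (f x' - f' a x')) \<le> 1 / (2 * K) * norm (x - x')"
    proof (rule differentiable_bound[OF convex_ball _ _ that(1) that(2)])
      fix u assume u: "u \<in> ball a r"
      show "((\<lambda>x. f x - f' a x) has_derivative (\<lambda>h. f' u h - f' a h)) (at u within ball a r)"
        by (auto intro!: derivative_eq_intros has_derivative_at_withinI[OF deriv])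
      have "onorm (\<lambda>h. (f' u - f' a) h) \<le> 1 / (2 * K)"
        using r(2)[of u] u by (simp add: dist_norm norm_blinfun.rep_eq[symmetric] norm_minus_commute less_imp_le)
      then show "onorm (\<lambda>h. f' u h - f' a h) \<le> 1 / (2 * K)" by (simp add: blinfun.diff_left)
    qed
    then show ?thesis by (simp add: blinfun.diff_right algebra_simps)
  qed
  \<comment> \<open>the iterates move \<open>x\<close> by at most \<open>2 * K * e\<close>, so they stay in the ball of radius \<open>r\<close>\<close>
  define e where "e = r / (1 + 2 * K)"
  have "0 < 1 + 2 * K" using K(1) by simp
  then have "0 < e" "e * (1 + 2 * K) = r" using r(1) by (simp_all add: e_def)
  then have e: "0 < e" "e + 2 * K * e = r" by (simp_all add: algebra_simps)
  show ?thesis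
  proof (rule that[of "2 * K" e])
    fix x q assume x: "norm (x - a) < e" and q: "norm (f x - q) < e"
    define \<delta> where "\<delta> = norm (f x - q)"
    define \<phi> where "\<phi> = (\<lambda>s. s - (f (x + M1 s) + M2 s - q))"
    have in_ball: "x + M1 s \<in> ball a r" if "norm s \<le> 2 * \<delta>" for s :: 'b
    proof -
      have "norm (M1 s) \<le> K * (2 * \<delta>)"
        using K(2)[of s] mult_left_mono[OF that, of K] K(1) by linarith
      also have "\<dots> \<le> 2 * K * e" using q K(1) by (simp add: \<delta>_def)
      finally have "norm (x - a) + norm (M1 s) < r" using x e(2) by linarith
      then have "norm (x + M1 s - a) < r"
        using norm_triangle_ineq[of "x - a" "M1 s"] by (simp add: algebra_simps)
      then show ?thesis by (simp add: dist_norm norm_minus_commute)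
    qed
    have contr: "norm (\<phi> s - \<phi> s') \<le> 1 / 2 * norm (s - s')"
      if "norm s \<le> 2 * \<delta>" "norm s' \<le> 2 * \<delta>" for s s' :: 'b
    proof -
      have "\<phi> s - \<phi> s' = - (f (x + M1 s) - f (x + M1 s') - f' a (M1 (s - s')))"
        using M[of "s - s'"] by (simp add: \<phi>_def linear_diff[OF lin(1)] linear_diff[OF lin(2)] algebra_simps)
      then have "norm (\<phi> s - \<phi> s') = norm (f (x + M1 s) - f (x + M1 s') - f' a ((x + M1 s) - (x + M1 s')))"
        by (simp only: norm_minus_cancel) (simp add: linear_diff[OF lin(1)])
      also have "\<dots> \<le> 1 / (2 * K) * norm ((x + M1 s) - (x + M1 s'))"
        using lip in_ball that by blast
      also have "\<dots> = 1 / (2 * K) * norm (M1 (s - s'))" by (simp add: linear_diff[OF lin(1)])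
      also have "\<dots> \<le> 1 / (2 * K) * (K * norm (s - s'))" using K by (intro mult_left_mono) auto
      also have "\<dots> = 1 / 2 * norm (s - s')" using K(1) by simp
      finally show ?thesis .
    qed
    have \<phi>0: "norm (\<phi> 0) = \<delta>"
      by (simp add: \<phi>_def \<delta>_def linear_0[OF lin(1)] linear_0[OF lin(2)] norm_minus_commute)
    have "\<exists>!s\<in>cball (0 :: 'b) (2 * \<delta>). \<phi> s = s"
    proof (rule Banach_fix[of _ "1 / 2"])
      show "\<phi> ` cball 0 (2 * \<delta>) \<subseteq> cball 0 (2 * \<delta>)"
      proof clarsimp
        fix s :: 'b assume s: "norm s \<le> 2 * \<delta>"
        have "norm (\<phi> s) \<le> norm (\<phi> 0) + norm (\<phi> s - \<phi> 0)"
          using norm_triangle_ineq[of "\<phi> 0" "\<phi> s - \<phi> 0"] by simp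
        also have "\<dots> \<le> 2 * \<delta>" using contr[OF s, of 0] s \<phi>0 by (simp add: \<delta>_def)
        finally show "norm (\<phi> s) \<le> 2 * \<delta>" .
      qed
      show "dist (\<phi> s) (\<phi> s') \<le> 1 / 2 * dist s s'" if "s \<in> cball 0 (2 * \<delta>)" "s' \<in> cball 0 (2 * \<delta>)" for s s' :: 'b
        using contr that by (simp add: dist_norm)
    qed (auto simp: complete_eq_closed \<delta>_def)
    then obtain s where s: "norm s \<le> 2 * \<delta>" "\<phi> s = s" by auto
    have "f (x + M1 s) = q + - M2 s" using s(2) by (simp add: \<phi>_def algebra_simps)
    moreover have "- M2 s \<in> L" using subspace_neg[OF L M2L] .
    moreover have "K * norm s \<le> 2 * K * \<delta>" using mult_left_mono[OF s(1), of K] K(1) by simp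
    then have "norm (M1 s) \<le> 2 * K * \<delta>" "norm (M2 s) \<le> 2 * K * \<delta>" using K(2,3)[of s] by linarith+
    ultimately show "\<exists>x' l. l \<in> L \<and> f x' = q + l \<and> norm (x' - x) \<le> 2 * K * norm (f x - q) \<and>
        norm l \<le> 2 * K * norm (f x - q)"
      by (intro exI[of _ "x + M1 s"] exI[of _ "- M2 s"]) (auto simp: \<delta>_def)
  qed (use K e in auto)
qed

section \<open>Adjoints and difference quotients\<close>

lemma inner_adjoint_blinfun:
  fixes A :: "'a::euclidean_space \<Rightarrow>\<^sub>L 'b::euclidean_space"
  shows "x \<bullet> adjoint (blinfun_apply A) y = A x \<bullet> y"
  by (simp add: adjoint_works bounded_linear.linear blinfun.bounded_linear_right)

text \<open>
  Gives continuity and the product rule for \<open>A\<^sup>T y\<close> jointly in the operator and the vector, as needed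
  when multipliers and base points move together.
\<close>

lemma bounded_bilinear_adjoint:
  "bounded_bilinear (\<lambda>(A :: 'a::euclidean_space \<Rightarrow>\<^sub>L 'b::euclidean_space) y. adjoint (blinfun_apply A) y)"
proof
  fix A A' :: "'a \<Rightarrow>\<^sub>L 'b" and y y' :: 'b and r :: real
  have eqI: "u = v" if "\<And>x. x \<bullet> u = x \<bullet> v" for u v :: 'a
    using that vector_eq_ldot[of u v] by blast
  note simps = inner_adjoint_blinfun inner_add_right inner_add_left blinfun.add_left blinfun.scaleR_left
  show "adjoint (A + A') y = adjoint A y + adjoint A' y" by (rule eqI) (simp add: simps)
  show "adjoint A (y + y') = adjoint A y + adjoint A y'" by (rule eqI) (simp add: simps)
  show "adjoint (r *\<^sub>R A) y = r *\<^sub>R adjoint A y" by (rule eqI) (simp add: simps)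
  show "adjoint A (r *\<^sub>R y) = r *\<^sub>R adjoint A y" by (rule eqI) (simp add: simps)
  show "\<exists>K. \<forall>(A :: 'a \<Rightarrow>\<^sub>L 'b) y. norm (adjoint (blinfun_apply A) y) \<le> norm A * norm y * K"
  proof (intro exI[of _ 1] allI)
    fix A :: "'a \<Rightarrow>\<^sub>L 'b" and y
    have "norm (adjoint A y) * norm (adjoint A y) = A (adjoint A y) \<bullet> y"
      by (simp flip: inner_adjoint_blinfun add: norm_eq_sqrt_inner)
    also have "\<dots> \<le> norm (A (adjoint A y)) * norm y" by (rule norm_cauchy_schwarz)
    also have "\<dots> \<le> norm A * norm (adjoint A y) * norm y"
      by (intro mult_right_mono norm_blinfun) auto
    finally have "norm (adjoint A y) * norm (adjoint A y) \<le> norm (adjoint A y) * (norm A * norm y)"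
      by (simp add: algebra_simps)
    then show "norm (adjoint A y) \<le> norm A * norm y * 1"
      by (cases "norm (adjoint A y) = 0") (auto simp: mult_le_cancel_left)
  qed
qed

interpretation adj: bounded_bilinear
  "\<lambda>(A :: 'a::euclidean_space \<Rightarrow>\<^sub>L 'b::euclidean_space) y. adjoint (blinfun_apply A) y"
  by (rule bounded_bilinear_adjoint)

lemma quotient_imp_tendsto:
  fixes x :: "nat \<Rightarrow> 'a::real_normed_vector"
  assumes "\<And>k. 0 < t k" "t \<longlonglongrightarrow> 0" "(\<lambda>k. (x k - y) /\<^sub>R t k) \<longlonglongrightarrow> v"
  shows "x \<longlonglongrightarrow> y"
proof -
  have "(\<lambda>k. y + t k *\<^sub>R ((x k - y) /\<^sub>R t k)) \<longlonglongrightarrow> y + 0 *\<^sub>R v"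
    by (intro tendsto_intros assms)
  moreover have "y + t k *\<^sub>R ((x k - y) /\<^sub>R t k) = x k" for k using assms(1)[of k] by simp
  ultimately show ?thesis by simp
qed

text \<open>
  The base direction is only approached in the limit, which is the form in which directions occur in
  tangent cones.
\<close>

lemma has_derivative_quotient:
  fixes f :: "'a::real_normed_vector \<Rightarrow> 'b::real_normed_vector"
  assumes f: "(f has_derivative f') (at y)"
    and t: "\<And>k. 0 < t k" "t \<longlonglongrightarrow> 0" and x: "(\<lambda>k. (x k - y) /\<^sub>R t k) \<longlonglongrightarrow> v"
  shows "(\<lambda>k. (f (x k) - f y) /\<^sub>R t k) \<longlonglongrightarrow> f' v"
proof -
  have f': "bounded_linear f'" using f by (rule has_derivative_bounded_linear)
  have xy: "x \<longlonglongrightarrow> y" by (rule quotient_imp_tendsto[OF t x])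
  have "(\<lambda>k. (f (x k) - f y) /\<^sub>R t k - f' ((x k - y) /\<^sub>R t k)) \<longlonglongrightarrow> 0"
  proof (rule tendstoI)
    fix e :: real assume e: "0 < e"
    define e' where "e' = e / (norm v + 1)"
    have e': "0 < e'" "e' * (norm v + 1) = e"
      using e by (auto simp: e'_def add_nonneg_pos add_nonneg_eq_0_iff)
    then obtain d where d: "0 < d" "\<And>u. norm (u - y) < d \<Longrightarrow> norm (f u - f y - f' (u - y)) \<le> e' * norm (u - y)"
      using f unfolding has_derivative_at_alt by blast
    have "\<forall>\<^sub>F k in sequentially. dist (x k) y < d" using tendstoD[OF xy d(1)] .
    moreover have "\<forall>\<^sub>F k in sequentially. norm ((x k - y) /\<^sub>R t k) < norm v + 1"
      using tendsto_norm[OF x] by (rule order_tendstoD) simp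
    ultimately show "\<forall>\<^sub>F k in sequentially. dist ((f (x k) - f y) /\<^sub>R t k - f' ((x k - y) /\<^sub>R t k)) 0 < e"
    proof eventually_elim
      case (elim k)
      have "norm ((f (x k) - f y) /\<^sub>R t k - f' ((x k - y) /\<^sub>R t k)) = norm (f (x k) - f y - f' (x k - y)) / t k"
        using t(1)[of k] by (simp add: linear_scale[OF bounded_linear.linear[OF f']] divide_inverse
            flip: scaleR_diff_right)
      also have "\<dots> \<le> (e' * norm (x k - y)) / t k"
        using d(2) elim(1) t(1)[of k] by (intro divide_right_mono) (auto simp: dist_norm)
      also have "\<dots> = e' * norm ((x k - y) /\<^sub>R t k)" using t(1)[of k] by (simp add: divide_inverse)
      also have "\<dots> < e" using elim(2) e' mult_strict_left_mono by fastforce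
      finally show ?case by simp
    qed
  qed
  from tendsto_add[OF this bounded_linear.tendsto[OF f' x]] show ?thesis by simp
qed

lemma eventually_bounded_subseq:
  fixes x :: "nat \<Rightarrow> 'a::{real_normed_vector, heine_borel}"
  assumes "\<forall>\<^sub>F k in sequentially. norm (x k) \<le> M"
  obtains l r where "strict_mono (r :: nat \<Rightarrow> nat)" "(x \<circ> r) \<longlonglongrightarrow> l"
proof -
  obtain m where m: "\<And>k. k \<ge> m \<Longrightarrow> norm (x k) \<le> M"
    using assms by (auto simp: eventually_sequentially)
  have "bounded (range (\<lambda>k. x (k + m)))" by (intro boundedI[of _ M]) (auto intro: m)
  then obtain l s where s: "strict_mono (s :: nat \<Rightarrow> nat)" "((\<lambda>k. x (k + m)) \<circ> s) \<longlonglongrightarrow> l"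
    using bounded_imp_convergent_subsequence by blast
  show ?thesis
  proof (rule that)
    show "strict_mono (\<lambda>k. s k + m)" using s(1) by (simp add: strict_mono_def)
    show "(x \<circ> (\<lambda>k. s k + m)) \<longlonglongrightarrow> l" using s(2) by (simp add: o_def)
  qed
qed

lemma dist_set_le: "b \<in> A \<Longrightarrow> dist_set a A \<le> ennreal (dist a b)"
  unfolding dist_set_def by (rule INF_lower)

text \<open>
  The infimum in \<open>dist_set\<close> need not be attained; the slack \<open>\<delta>\<close> makes up for that.
\<close>

lemma dist_set_error_bound:
  assumes "dist_set z \<Gamma> \<le> ennreal \<kappa> * dist_set x D" "q \<in> D" "dist x q \<le> \<rho>" "0 \<le> \<kappa>" "0 < \<delta>"
  obtains \<gamma> where "\<gamma> \<in> \<Gamma>" "dist z \<gamma> < \<kappa> * \<rho> + \<delta>"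
proof -
  have \<rho>: "0 \<le> \<rho>" using assms(3) zero_le_dist[of x q] by linarith
  have "dist_set x D \<le> ennreal \<rho>"
    using dist_set_le[OF assms(2), of x] assms(3) ennreal_leI order_trans by blast
  then have "dist_set z \<Gamma> \<le> ennreal \<kappa> * ennreal \<rho>"
    using assms(1) mult_left_mono order_trans by (metis zero_le)
  also have "\<dots> = ennreal (\<kappa> * \<rho>)" using assms(4) \<rho> by (simp add: ennreal_mult)
  also have "\<dots> < ennreal (\<kappa> * \<rho> + \<delta>)" using assms(4,5) \<rho> by (intro ennreal_lessI) (simp_all add: add_nonneg_pos)
  finally obtain \<gamma> where "\<gamma> \<in> \<Gamma>" "ennreal (dist z \<gamma>) < ennreal (\<kappa> * \<rho> + \<delta>)"
    unfolding dist_set_def by (auto simp: INF_less_iff)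
  then show ?thesis using that by (auto simp: ennreal_less_iff)
qed

lemma dist_set_differences:
  fixes p :: "'a::real_normed_vector"
  assumes "\<And>q. q \<in> Q \<Longrightarrow> \<delta> \<le> norm (p - q)"
  shows "ennreal \<delta> \<le> dist_set 0 {p - q | q. q \<in> Q}"
  unfolding dist_set_def using assms by (auto intro!: INF_greatest ennreal_leI)

section \<open>Multipliers for constraint systems\<close>

lemma cnormal_closed_convex: "z \<in> S \<Longrightarrow> closed (cnormal S z)" "convex (cnormal S z)"
proof -
  assume "z \<in> S"
  then have "cnormal S z = (\<Inter>q\<in>S. {n. (q - z) \<bullet> n \<le> 0})"
    by (auto simp: cnormal_def inner_commute)
  then show "closed (cnormal S z)" by (auto intro!: closed_INT closed_halfspace_le)
next
  show "convex (cnormal S z)"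
    by (auto simp: convex_def cnormal_def inner_add_left intro!: add_nonpos_nonpos mult_nonneg_nonpos)
qed

text \<open>
  Walk from \<open>a\<close> in direction \<open>w\<close>. The point \<open>h a + t u\<close> of \<open>D\<close> is within
  \<open>t (|h' w - u| + o(1))\<close> of \<open>h (a + t w)\<close>, so the error bound provides feasible points whose
  directions are within \<open>\<kappa> |h' w - u|\<close> of \<open>w\<close> up to \<open>o(1)\<close>. A limit of these directions is tangent, and the
  normal \<open>b\<close> is nonpositive on it.
\<close>

lemma regular_normal_direction_bound:
  fixes h :: "'n::euclidean_space \<Rightarrow> 's::euclidean_space"
  assumes D: "polyhedron D" and h: "(h has_derivative h') (at a)" and \<kappa>: "0 \<le> \<kappa>"
    and eb: "\<forall>\<^sub>F z in nhds a. dist_set z (h -` D) \<le> ennreal \<kappa> * dist_set (h z) D"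
    and b: "b \<in> regular_normal_cone (h -` D) a" and u: "u \<in> tangent_cone D (h a)"
  shows "b \<bullet> w \<le> norm b * (\<kappa> * norm (h' w - u))"
proof -
  have a: "h a \<in> D" using b by (simp add: regular_normal_cone_def)
  obtain e where e: "0 < e" "\<And>d. norm d < e \<Longrightarrow> h a + d \<in> D \<longleftrightarrow> d \<in> tangent_cone D (h a)"
    by (rule polyhedron_tangent_cone[OF D a]) (use that in blast)
  define t where "t = (\<lambda>k. inverse (real (Suc k)))"
  have t: "\<And>k. 0 < t k" "t \<longlonglongrightarrow> 0" unfolding t_def using LIMSEQ_inverse_real_of_nat by auto
  define z where "z = (\<lambda>k. a + t k *\<^sub>R w)"
  define \<rho> where "\<rho> = (\<lambda>k. norm (h (z k) - (h a + t k *\<^sub>R u)))"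
  have zq: "(\<lambda>k. (z k - a) /\<^sub>R t k) \<longlonglongrightarrow> w" using t(1) by (simp add: z_def less_imp_neq[symmetric])
  have "z \<longlonglongrightarrow> a" by (rule quotient_imp_tendsto[OF t zq])
  have "(\<lambda>k. (h (z k) - h a) /\<^sub>R t k - u) \<longlonglongrightarrow> h' w - u"
    by (intro tendsto_intros has_derivative_quotient[OF h t zq])
  then have "(\<lambda>k. norm ((h (z k) - h a) /\<^sub>R t k - u)) \<longlonglongrightarrow> norm (h' w - u)" by (rule tendsto_norm)
  moreover have "norm ((h (z k) - h a) /\<^sub>R t k - u) = \<rho> k / t k" for k
  proof -
    have "(h (z k) - h a) /\<^sub>R t k - u = (h (z k) - (h a + t k *\<^sub>R u)) /\<^sub>R t k"
      using t(1)[of k] by (simp add: algebra_simps)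
    then show ?thesis using t(1)[of k] by (simp add: \<rho>_def divide_inverse mult.commute)
  qed
  ultimately have \<rho>: "(\<lambda>k. \<rho> k / t k) \<longlonglongrightarrow> norm (h' w - u)" by simp
  have "\<forall>\<^sub>F k in sequentially. dist_set (z k) (h -` D) \<le> ennreal \<kappa> * dist_set (h (z k)) D"
    using eventually_compose_filterlim[OF eb \<open>z \<longlonglongrightarrow> a\<close>] .
  moreover have "\<forall>\<^sub>F k in sequentially. h a + t k *\<^sub>R u \<in> D"
  proof -
    have "(\<lambda>k. norm (t k *\<^sub>R u)) \<longlonglongrightarrow> norm (0 *\<^sub>R u)" by (intro tendsto_intros t)
    then have "\<forall>\<^sub>F k in sequentially. norm (t k *\<^sub>R u) < e" using e(1) by (intro order_tendstoD(2)) auto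
    then show ?thesis
      by eventually_elim
        (use e(2) conicD[OF polyhedron_tangent_cone_polyhedron(2)[OF D a] u] t(1) in \<open>auto simp: less_imp_le\<close>)
  qed
  ultimately have "\<forall>\<^sub>F k in sequentially. \<exists>\<gamma>\<in>h -` D. dist (z k) \<gamma> < \<kappa> * \<rho> k + (t k)\<^sup>2"
  proof eventually_elim
    case (elim k)
    have "dist (h (z k)) (h a + t k *\<^sub>R u) \<le> \<rho> k" "0 < (t k)\<^sup>2" using t(1)[of k] by (auto simp: \<rho>_def dist_norm)
    from dist_set_error_bound[OF elim this(1) \<kappa> this(2)] show ?case by blast
  qed
  then have "\<exists>\<gamma>. \<forall>\<^sub>F k in sequentially. \<gamma> k \<in> h -` D \<and> dist (z k) (\<gamma> k) < \<kappa> * \<rho> k + (t k)\<^sup>2"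
    by (intro exI[of _ "\<lambda>k. SOME \<gamma>. \<gamma> \<in> h -` D \<and> dist (z k) \<gamma> < \<kappa> * \<rho> k + (t k)\<^sup>2"])
      (erule eventually_mono, rule someI_ex, blast)
  then obtain \<gamma> where \<gamma>: "\<forall>\<^sub>F k in sequentially. \<gamma> k \<in> h -` D \<and> dist (z k) (\<gamma> k) < \<kappa> * \<rho> k + (t k)\<^sup>2" by blast
  define \<omega> where "\<omega> = (\<lambda>k. (\<gamma> k - a) /\<^sub>R t k)"
  have \<omega>_le: "\<forall>\<^sub>F k in sequentially. norm (\<omega> k - w) \<le> \<kappa> * (\<rho> k / t k) + t k"
    using \<gamma>
  proof eventually_elim
    case (elim k)
    have "\<omega> k - w = (\<gamma> k - z k) /\<^sub>R t k" using t(1)[of k] by (simp add: \<omega>_def z_def algebra_simps)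
    then have "norm (\<omega> k - w) = dist (z k) (\<gamma> k) / t k"
      using t(1)[of k] by (simp add: dist_norm norm_minus_commute divide_inverse mult.commute)
    also have "\<dots> \<le> (\<kappa> * \<rho> k + (t k)\<^sup>2) / t k" using elim t(1)[of k] by (intro divide_right_mono) auto
    also have "\<dots> = \<kappa> * (\<rho> k / t k) + t k" using t(1)[of k] by (simp add: field_simps power2_eq_square)
    finally show ?case .
  qed
  have lim: "(\<lambda>k. \<kappa> * (\<rho> k / t k) + t k) \<longlonglongrightarrow> \<kappa> * norm (h' w - u) + 0"
    by (intro tendsto_intros \<rho> t)
  then have "\<forall>\<^sub>F k in sequentially. \<kappa> * (\<rho> k / t k) + t k < \<kappa> * norm (h' w - u) + 1"
    by (rule order_tendstoD) simp
  with \<omega>_le have "\<forall>\<^sub>F k in sequentially. norm (\<omega> k) \<le> norm w + (\<kappa> * norm (h' w - u) + 1)"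
  proof eventually_elim
    case (elim k)
    then show ?case using norm_triangle_sub[of "\<omega> k" w] by linarith
  qed
  then obtain v r where r: "strict_mono (r :: nat \<Rightarrow> nat)" "(\<omega> \<circ> r) \<longlonglongrightarrow> v"
    by (rule eventually_bounded_subseq)
  have "v \<in> tangent_cone (h -` D) a"
  proof (rule tangent_coneI[of _ _ "t \<circ> r" "\<gamma> \<circ> r"])
    show "\<forall>\<^sub>F k in sequentially. (\<gamma> \<circ> r) k \<in> h -` D"
      using eventually_subseq[OF r(1) \<gamma>] by (auto elim: eventually_mono)
    show "(\<lambda>k. ((\<gamma> \<circ> r) k - a) /\<^sub>R (t \<circ> r) k) \<longlonglongrightarrow> v" using r(2) by (simp add: \<omega>_def o_def)
  qed (use a t LIMSEQ_subseq_LIMSEQ[OF t(2) r(1)] in auto)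
  then have bv: "b \<bullet> v \<le> 0" using b by (simp add: regular_normal_cone_def)
  have "norm (v - w) \<le> \<kappa> * norm (h' w - u)"
  proof (rule tendsto_le)
    show "(\<lambda>k. norm ((\<omega> \<circ> r) k - w)) \<longlonglongrightarrow> norm (v - w)" by (intro tendsto_intros r)
    show "(\<lambda>k. \<kappa> * (\<rho> (r k) / t (r k)) + t (r k)) \<longlonglongrightarrow> \<kappa> * norm (h' w - u)"
      using LIMSEQ_subseq_LIMSEQ[OF lim r(1)] by (simp add: o_def)
    show "\<forall>\<^sub>F k in sequentially. norm ((\<omega> \<circ> r) k - w) \<le> \<kappa> * (\<rho> (r k) / t (r k)) + t (r k)"
      using eventually_subseq[OF r(1) \<omega>_le] by simp
  qed simp
  have "b \<bullet> w = b \<bullet> v + b \<bullet> (w - v)" by (simp add: inner_diff_right)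
  also have "\<dots> \<le> norm b * norm (w - v)" using bv norm_cauchy_schwarz[of b "w - v"] by linarith
  also have "\<dots> \<le> norm b * (\<kappa> * norm (h' w - u))"
    using \<open>norm (v - w) \<le> _\<close> by (intro mult_left_mono) (auto simp: norm_minus_commute)
  finally show ?thesis .
qed

text \<open>
  Otherwise \<open>b\<close> could be separated from the compact convex set of all \<open>h'\<^sup>T \<mu>\<close> with admissible
  \<open>\<mu>\<close>. The projection residual \<open>n\<close> of the image of the separating direction onto the tangent cone
  is itself normal to \<open>D\<close>, and scaling it to length \<open>\<kappa> |b|\<close> gives a multiplier that contradicts
  \<open>regular_normal_direction_bound\<close>.
\<close>

lemma regular_normal_multiplier:
  fixes h :: "'n::euclidean_space \<Rightarrow> 's::euclidean_space" and h' :: "'n \<Rightarrow>\<^sub>L 's"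
  assumes D: "polyhedron D" and h: "(h has_derivative h') (at a)" and \<kappa>: "0 \<le> \<kappa>"
    and eb: "\<forall>\<^sub>F z in nhds a. dist_set z (h -` D) \<le> ennreal \<kappa> * dist_set (h z) D"
    and b: "b \<in> regular_normal_cone (h -` D) a"
  obtains \<mu> where "\<mu> \<in> cnormal D (h a)" "adjoint h' \<mu> = b" "norm \<mu> \<le> \<kappa> * norm b"
proof -
  have a: "h a \<in> D" using b by (simp add: regular_normal_cone_def)
  let ?T = "tangent_cone D (h a)"
  let ?M = "cnormal D (h a) \<inter> cball 0 (\<kappa> * norm b)"
  have "compact ?M" using cnormal_closed_convex(1)[OF a] by (intro closed_Int_compact) auto
  then have cl: "closed (adjoint h' ` ?M)"
    by (intro compact_imp_closed compact_continuous_image linear_continuous_on adj.bounded_linear_right)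
  have cv: "convex (adjoint h' ` ?M)"
    by (intro convex_linear_image convex_Int cnormal_closed_convex convex_cball
        bounded_linear.linear adj.bounded_linear_right)
  have "b \<in> adjoint h' ` ?M"
  proof (rule ccontr)
    assume "b \<notin> adjoint h' ` ?M"
    from separating_hyperplane_closed_point[OF cv cl this]
    obtain w c where w: "w \<bullet> b < c" "\<And>\<mu>. \<mu> \<in> ?M \<Longrightarrow> c < w \<bullet> adjoint h' \<mu>" by auto
    note T = polyhedron_tangent_cone_polyhedron[OF D a]
    define u where "u = closest_point ?T (h' (- w))"
    define n where "n = h' (- w) - u"
    have ne: "0 \<in> ?T" using diff_in_tangent_cone[OF D a a] by simp
    have u: "u \<in> ?T" unfolding u_def
      using closest_point_in_set[OF polyhedron_imp_closed[OF T(1)]] ne by blast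
    have "n \<in> cnormal ?T u"
      using u closest_point_dot[OF polyhedron_imp_convex[OF T(1)] polyhedron_imp_closed[OF T(1)]]
      by (auto simp: cnormal_def n_def u_def)
    then have n: "n \<bullet> u = 0" "\<And>q. q \<in> ?T \<Longrightarrow> n \<bullet> q \<le> 0" using cnormal_cone_iff[OF T(2) u] by auto
    define \<mu> where "\<mu> = (\<kappa> * norm b) *\<^sub>R sgn n"
    have "\<mu> \<in> cnormal D (h a)"
      using n(2) \<kappa> by (auto simp: cnormal_iff_tangent[OF D a] \<mu>_def sgn_div_norm intro!: mult_nonneg_nonpos)
    moreover have "norm \<mu> \<le> \<kappa> * norm b" using \<kappa> by (simp add: \<mu>_def norm_sgn)
    ultimately have "c < w \<bullet> adjoint h' \<mu>" using w(2) by auto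
    moreover have "h' (- w) = n + u" by (simp add: n_def)
    then have "- (w \<bullet> adjoint h' \<mu>) = \<mu> \<bullet> (n + u)"
      by (simp add: inner_adjoint_blinfun blinfun.minus_right inner_commute) (metis inner_commute inner_minus_left)
    moreover have "\<mu> \<bullet> (n + u) = norm b * (\<kappa> * norm n)"
      using n(1) by (cases "n = 0") (simp_all add: \<mu>_def sgn_div_norm inner_add_right dot_square_norm power2_eq_square)
    moreover have "b \<bullet> (- w) \<le> norm b * (\<kappa> * norm n)"
      using regular_normal_direction_bound[OF D h \<kappa> eb b u, of "- w"] by (simp add: n_def)
    ultimately show False using w(1) by (simp add: inner_commute)
  qed
  then show ?thesis using that by auto
qed

lemma multiplier_regular_normal:
  fixes h :: "'n::euclidean_space \<Rightarrow> 's::euclidean_space" and h' :: "'n \<Rightarrow>\<^sub>L 's"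
  assumes h: "(h has_derivative h') (at a)" and \<mu>: "\<mu> \<in> cnormal D (h a)"
  shows "adjoint h' \<mu> \<in> regular_normal_cone (h -` D) a"
proof -
  have "adjoint h' \<mu> \<bullet> w \<le> 0" if "w \<in> tangent_cone (h -` D) a" for w
  proof -
    from that obtain t ws where t: "\<And>k::nat. 0 < t k" "t \<longlonglongrightarrow> 0" "ws \<longlonglongrightarrow> w"
      "\<And>k. a + t k *\<^sub>R ws k \<in> h -` D" unfolding tangent_cone_def by blast
    have "(\<lambda>k. (h (a + t k *\<^sub>R ws k) - h a) /\<^sub>R t k) \<longlonglongrightarrow> h' w"
      using t by (intro has_derivative_quotient[OF h]) (auto simp: less_imp_neq[symmetric])
    then have "(\<lambda>k. \<mu> \<bullet> ((h (a + t k *\<^sub>R ws k) - h a) /\<^sub>R t k)) \<longlonglongrightarrow> \<mu> \<bullet> h' w"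
      by (intro tendsto_intros)
    moreover have "\<mu> \<bullet> ((h (a + t k *\<^sub>R ws k) - h a) /\<^sub>R t k) \<le> 0" for k
      using cnormalD(2)[OF \<mu>, of "h (a + t k *\<^sub>R ws k)"] t(4)[of k] t(1)[of k]
      by (auto simp: mult_nonneg_nonpos less_imp_le)
    ultimately have "\<mu> \<bullet> h' w \<le> 0" by (intro tendsto_upperbound) auto
    then show ?thesis by (metis inner_adjoint_blinfun inner_commute)
  qed
  then show ?thesis using cnormalD(1)[OF \<mu>] by (auto simp: regular_normal_cone_def)
qed

text \<open>
  The limiting normal cone of a constraint set consists of the vectors generated by multipliers. The bound
  on the multipliers makes them cluster along sequences of regular normals.
\<close>

lemma normal_cone_preimage:
  fixes h :: "'n::euclidean_space \<Rightarrow> 's::euclidean_space" and h' :: "'n \<Rightarrow> 'n \<Rightarrow>\<^sub>L 's"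
  assumes D: "polyhedron D" and h: "\<And>z. (h has_derivative h' z) (at z)" and \<kappa>: "0 \<le> \<kappa>"
    and cont: "isCont h' x"
    and eb: "\<forall>\<^sub>F z in nhds x. dist_set z (h -` D) \<le> ennreal \<kappa> * dist_set (h z) D"
  shows "\<mu> \<in> cnormal D (h x) \<Longrightarrow> adjoint (h' x) \<mu> \<in> normal_cone (h -` D) x"
    and "b \<in> normal_cone (h -` D) x \<Longrightarrow>
           \<exists>\<mu>\<in>cnormal D (h x). adjoint (h' x) \<mu> = b \<and> norm \<mu> \<le> \<kappa> * norm b"
proof -
  assume "\<mu> \<in> cnormal D (h x)"
  from multiplier_regular_normal[OF h this]
  show "adjoint (h' x) \<mu> \<in> normal_cone (h -` D) x"
    unfolding normal_cone_def
    by (intro CollectI conjI exI[of _ "\<lambda>_. x"] exI[of _ "\<lambda>_. adjoint (h' x) \<mu>"])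
      (auto simp: regular_normal_cone_def)
next
  assume "b \<in> normal_cone (h -` D) x"
  then obtain z n where zn: "z \<longlonglongrightarrow> x" "n \<longlonglongrightarrow> b" "\<And>k::nat. n k \<in> regular_normal_cone (h -` D) (z k)"
    unfolding normal_cone_def by blast
  have "\<forall>\<^sub>F y in nhds x. \<forall>\<^sub>F z in nhds y. dist_set z (h -` D) \<le> ennreal \<kappa> * dist_set (h z) D"
    using eb by (subst eventually_eventually)
  from eventually_compose_filterlim[OF this zn(1)]
  have "\<forall>\<^sub>F k in sequentially. \<forall>\<^sub>F z in nhds (z k). dist_set z (h -` D) \<le> ennreal \<kappa> * dist_set (h z) D" .
  then have "\<forall>\<^sub>F k in sequentially. \<exists>\<mu>. \<mu> \<in> cnormal D (h (z k)) \<and> adjoint (h' (z k)) \<mu> = n k \<and> norm \<mu> \<le> \<kappa> * norm (n k)"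
  proof eventually_elim
    case (elim k)
    show ?case by (rule regular_normal_multiplier[OF D h \<kappa> elim zn(3)]) blast
  qed
  then have "\<exists>\<mu>. \<forall>\<^sub>F k in sequentially. \<mu> k \<in> cnormal D (h (z k)) \<and> adjoint (h' (z k)) (\<mu> k) = n k \<and>
      norm (\<mu> k) \<le> \<kappa> * norm (n k)"
    by (intro exI[of _ "\<lambda>k. SOME \<mu>. \<mu> \<in> cnormal D (h (z k)) \<and> adjoint (h' (z k)) \<mu> = n k \<and>
      norm \<mu> \<le> \<kappa> * norm (n k)"]) (erule eventually_mono, rule someI_ex)
  then obtain \<mu> where \<mu>: "\<forall>\<^sub>F k in sequentially. \<mu> k \<in> cnormal D (h (z k)) \<and> adjoint (h' (z k)) (\<mu> k) = n k \<and>
      norm (\<mu> k) \<le> \<kappa> * norm (n k)" by blast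
  have lim_bound: "(\<lambda>k. \<kappa> * norm (n k)) \<longlonglongrightarrow> \<kappa> * norm b" by (intro tendsto_intros zn)
  then have "\<forall>\<^sub>F k in sequentially. \<kappa> * norm (n k) < \<kappa> * norm b + 1" by (rule order_tendstoD) simp
  with \<mu> have "\<forall>\<^sub>F k in sequentially. norm (\<mu> k) \<le> \<kappa> * norm b + 1" by eventually_elim auto
  then obtain l r where r: "strict_mono (r :: nat \<Rightarrow> nat)" "(\<mu> \<circ> r) \<longlonglongrightarrow> l"
    by (rule eventually_bounded_subseq)
  note \<mu>r = eventually_subseq[OF r(1) \<mu>]
  have zr: "(\<lambda>k. z (r k)) \<longlonglongrightarrow> x" "(\<lambda>k. n (r k)) \<longlonglongrightarrow> b"
    using LIMSEQ_subseq_LIMSEQ[OF zn(1) r(1)] LIMSEQ_subseq_LIMSEQ[OF zn(2) r(1)] by (simp_all add: o_def)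
  have "l \<in> cnormal D (h x)"
  proof (rule cnormal_limit[OF polyhedron_imp_closed[OF D] _ r(2)])
    show "(\<lambda>k. h (z (r k))) \<longlonglongrightarrow> h x"
      using isCont_tendsto_compose[OF has_derivative_continuous[OF h] zr(1)] .
  qed (use \<mu>r in \<open>auto elim: eventually_mono\<close>)
  moreover have "adjoint (h' x) l = b"
  proof (rule LIMSEQ_unique)
    show "(\<lambda>k. adjoint (h' (z (r k))) ((\<mu> \<circ> r) k)) \<longlonglongrightarrow> adjoint (h' x) l"
      by (intro adj.tendsto r isCont_tendsto_compose[OF cont] zr)
    show "(\<lambda>k. adjoint (h' (z (r k))) ((\<mu> \<circ> r) k)) \<longlonglongrightarrow> b"
      using \<mu>r by (intro Lim_transform_eventually[OF zr(2)]) (auto elim: eventually_mono)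
  qed
  moreover have "norm l \<le> \<kappa> * norm b"
  proof (rule tendsto_le)
    show "(\<lambda>k. norm ((\<mu> \<circ> r) k)) \<longlonglongrightarrow> norm l" by (intro tendsto_intros r)
    show "(\<lambda>k. \<kappa> * norm (n (r k))) \<longlonglongrightarrow> \<kappa> * norm b" by (intro tendsto_intros zr)
    show "\<forall>\<^sub>F k in sequentially. norm ((\<mu> \<circ> r) k) \<le> \<kappa> * norm (n (r k))"
      using \<mu>r by (auto elim: eventually_mono)
  qed simp
  ultimately show "\<exists>\<mu>\<in>cnormal D (h x). adjoint (h' x) \<mu> = b \<and> norm \<mu> \<le> \<kappa> * norm b" by blast
qed

section \<open>Duality for linear maps modulo a subspace\<close>

lemma span_orthogonal_complement:
  fixes M :: "'a::euclidean_space set"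
  assumes "\<And>l. (\<forall>m\<in>M. m \<bullet> l = 0) \<Longrightarrow> s \<bullet> l = 0"
  shows "s \<in> span M"
proof -
  obtain s1 s2 where s: "s1 \<in> span M" "\<And>x. x \<in> span M \<Longrightarrow> orthogonal s2 x" "s = s1 + s2"
    using orthogonal_subspace_decomp_exists[of M s] by metis
  have "\<forall>m\<in>M. m \<bullet> s2 = 0" using s(2) span_base by (auto simp: orthogonal_def inner_commute)
  then have "s \<bullet> s2 = 0" using assms by blast
  moreover have "s1 \<bullet> s2 = 0" using s(1,2) by (auto simp: orthogonal_def inner_commute)
  ultimately have "s2 = 0" by (simp add: s(3) inner_add_left)
  then show ?thesis using s by simp
qed

lemma subspace_annihilator: "subspace {l. \<forall>m\<in>M. m \<bullet> l = (0::real)}"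
  by (auto simp: subspace_def inner_add_right)

text \<open>
  A vector orthogonal to the range of \<open>A\<close> and to everything that \<open>M\<close> annihilates lies in the kernel
  of \<open>A\<^sup>T\<close> and in the span of \<open>M\<close>.
\<close>

lemma surjective_modulo_annihilator:
  fixes A :: "'a::euclidean_space \<Rightarrow>\<^sub>L 'b::euclidean_space"
  assumes inj: "\<And>\<mu>. adjoint A \<mu> = 0 \<Longrightarrow> \<mu> \<in> span M \<Longrightarrow> \<mu> = 0"
  shows "\<exists>v l. (\<forall>m\<in>M. m \<bullet> l = 0) \<and> A v + l = q"
proof -
  define R where "R = {A v + l | v l. \<forall>m\<in>M. m \<bullet> l = 0}"
  have R: "A v + l \<in> R" if "\<forall>m\<in>M. m \<bullet> l = 0" for v l using that by (auto simp: R_def)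
  have "subspace R"
  proof (rule subspaceI)
    show "0 \<in> R" using R[of 0 0] by (simp add: blinfun.zero_right)
    show "x + y \<in> R" if xy: "x \<in> R" "y \<in> R" for x y
    proof -
      obtain v l v' l' where "x = A v + l" "\<forall>m\<in>M. m \<bullet> l = 0" "y = A v' + l'" "\<forall>m\<in>M. m \<bullet> l' = 0"
        using xy unfolding R_def by blast
      then show ?thesis using R[of "l + l'" "v + v'"] by (simp add: blinfun.add_right inner_add_right algebra_simps)
    qed
    show "c *\<^sub>R x \<in> R" if x: "x \<in> R" for c x
    proof -
      obtain v l where "x = A v + l" "\<forall>m\<in>M. m \<bullet> l = 0" using x unfolding R_def by blast
      then show ?thesis using R[of "c *\<^sub>R l" "c *\<^sub>R v"] by (simp add: blinfun.scaleR_right algebra_simps)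
    qed
  qed
  obtain r s where rs: "r \<in> span R" "\<And>x. x \<in> span R \<Longrightarrow> orthogonal s x" "q = r + s"
    using orthogonal_subspace_decomp_exists[of R q] by metis
  have sR: "x \<bullet> s = 0" if "x \<in> R" for x
    using rs(2)[OF span_base[OF that]] by (simp add: orthogonal_def inner_commute)
  have "adjoint A s = 0"
  proof -
    have "adjoint A s \<bullet> adjoint A s = 0"
      unfolding inner_adjoint_blinfun using sR R[of 0 "adjoint A s"] by simp
    then show ?thesis by simp
  qed
  moreover have "s \<in> span M"
    using sR R[of _ 0] by (intro span_orthogonal_complement) (simp add: blinfun.zero_right inner_commute)
  ultimately have "s = 0" using inj by blast
  then have "q \<in> R" using rs \<open>subspace R\<close> by (simp add: span_eq_iff[THEN iffD2])
  then show ?thesis unfolding R_def by blast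
qed

text \<open>
  The part of \<open>c\<close> orthogonal to the image of \<open>span M\<close> under \<open>A\<^sup>T\<close> is mapped by \<open>A\<close> into the
  annihilator of \<open>M\<close>, hence is orthogonal to \<open>c\<close> and zero.
\<close>

lemma adjoint_range_annihilator:
  fixes A :: "'a::euclidean_space \<Rightarrow>\<^sub>L 'b::euclidean_space"
  assumes "\<And>v. (\<forall>m\<in>M. m \<bullet> A v = 0) \<Longrightarrow> c \<bullet> v = 0"
  obtains \<zeta> where "\<zeta> \<in> span M" "adjoint A \<zeta> = c"
proof -
  let ?S = "adjoint A ` span M"
  have "subspace ?S"
    by (intro linear_subspace_image bounded_linear.linear adj.bounded_linear_right subspace_span)
  obtain c1 c2 where c: "c1 \<in> span ?S" "\<And>x. x \<in> span ?S \<Longrightarrow> orthogonal c2 x" "c = c1 + c2"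
    using orthogonal_subspace_decomp_exists[of ?S c] by metis
  have "m \<bullet> A c2 = 0" if "m \<in> M" for m
    using c(2)[of "adjoint A m"] that span_base[of m M] span_base[of "adjoint A m" ?S]
    by (simp add: orthogonal_def inner_adjoint_blinfun inner_commute)
  then have "c \<bullet> c2 = 0" using assms by blast
  moreover have "c1 \<bullet> c2 = 0" using c(1,2) by (auto simp: orthogonal_def inner_commute)
  ultimately have "c2 = 0" by (simp add: c(3) inner_add_left)
  then have "c \<in> ?S" using c \<open>subspace ?S\<close> by (simp add: span_eq_iff[THEN iffD2])
  then show ?thesis using that by auto
qed

section \<open>Critical cones\<close>

lemma critical_cone_polyhedral:
  fixes D :: "'s::euclidean_space set"
  assumes "polyhedron D" "z \<in> D"
  shows "polyhedron (critical_cone D z \<mu>)" "conic (critical_cone D z \<mu>)"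
  using polyhedron_tangent_cone_polyhedron[OF assms]
  by (auto simp: critical_cone_def conic_def polyhedron_hyperplane)

text \<open>
  Subtracting \<open>\<mu>\<close> changes nothing on the critical cone, where \<open>\<mu>\<close> vanishes. This places difference
  quotients of multipliers in a closed cone even when they are unbounded.
\<close>

lemma cnormal_diff_critical:
  fixes D :: "'s::euclidean_space set"
  assumes D: "polyhedron D" "z \<in> D" and n: "n \<in> cnormal (tangent_cone D z) w"
    and \<mu>: "\<mu> \<in> cnormal (tangent_cone D z) w" and t: "0 \<le> t"
  shows "t *\<^sub>R (n - \<mu>) \<in> cnormal (critical_cone D z \<mu>) w"
proof -
  note T = polyhedron_tangent_cone_polyhedron(2)[OF D]
  have w: "w \<in> tangent_cone D z" using cnormalD(1)[OF n] .
  have 0: "n \<bullet> w = 0" "\<mu> \<bullet> w = 0" "\<And>q. q \<in> tangent_cone D z \<Longrightarrow> n \<bullet> q \<le> 0"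
    using n \<mu> cnormal_cone_iff[OF T w] by auto
  then have wK: "w \<in> critical_cone D z \<mu>" using w by (simp add: critical_cone_def)
  show ?thesis
    using 0 t by (subst cnormal_cone_iff[OF critical_cone_polyhedral(2)[OF D] wK])
      (auto simp: inner_diff_left critical_cone_def intro!: mult_nonneg_nonpos)
qed

lemma closed_linear_image_cnormal:
  fixes K :: "'s::euclidean_space set" and f :: "'s \<Rightarrow> 'a::euclidean_space"
  assumes K: "polyhedron K" "conic K" and w: "w \<in> K" and f: "linear f"
  shows "closed (f ` cnormal K w)"
proof -
  obtain V where V: "finite V" "\<And>n. (\<forall>q\<in>K. n \<bullet> q \<le> 0) \<longleftrightarrow> (\<forall>v\<in>V. n \<bullet> v \<le> 0)"
    by (rule polyhedral_cone_dual[OF K]) (use that in blast)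
  have "cnormal K w = {n. \<forall>a\<in>insert w (insert (- w) V). a \<bullet> n \<le> 0}"
    using cnormal_cone_iff[OF K(2) w] V(2) by (auto simp: inner_commute)
  moreover have "closed (f ` {n. \<forall>a\<in>insert w (insert (- w) V). a \<bullet> n \<le> 0})"
    by (rule closed_linear_image_polyhedral_cone[OF _ f]) (simp add: V(1))
  ultimately show ?thesis by (simp only:)
qed

text \<open>
  On a vertex direction \<open>v\<close> of the tangent cone either \<open>\<mu>\<close> is negative, and then so is \<open>\<mu> + t \<eta>\<close> for
  small \<open>t\<close>, or \<open>\<mu>\<close> vanishes; in the latter case \<open>v\<close> is critical and \<open>\<eta>\<close> is nonpositive on it. Finitely many
  vertices allow a common \<open>t\<close>.
\<close>

lemma critical_normal_ray:
  fixes D :: "'s::euclidean_space set"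
  assumes D: "polyhedron D" and \<mu>: "\<mu> \<in> cnormal D z" and \<eta>: "\<eta> \<in> cnormal (critical_cone D z \<mu>) w"
  shows "\<forall>\<^sub>F t in at_right 0. \<mu> + t *\<^sub>R \<eta> \<in> cnormal D (z + t *\<^sub>R w)"
proof -
  have z: "z \<in> D" using cnormalD(1)[OF \<mu>] .
  note T = polyhedron_tangent_cone_polyhedron[OF D z]
  have wK: "w \<in> critical_cone D z \<mu>" using cnormalD(1)[OF \<eta>] .
  then have w: "w \<in> tangent_cone D z" "\<mu> \<bullet> w = 0" by (auto simp: critical_cone_def)
  have \<eta>': "\<eta> \<bullet> w = 0" "\<And>q. q \<in> critical_cone D z \<mu> \<Longrightarrow> \<eta> \<bullet> q \<le> 0"
    using \<eta> cnormal_cone_iff[OF critical_cone_polyhedral(2)[OF D z] wK] by auto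
  obtain e where e: "0 < e" "\<And>d. norm d < e \<Longrightarrow> z + d \<in> D \<longleftrightarrow> d \<in> tangent_cone D z"
    by (rule polyhedron_tangent_cone[OF D z]) (use that in blast)
  obtain V where V: "finite V" "V \<subseteq> tangent_cone D z"
    "\<And>n. (\<forall>q\<in>tangent_cone D z. n \<bullet> q \<le> 0) \<longleftrightarrow> (\<forall>v\<in>V. n \<bullet> v \<le> 0)"
    by (rule polyhedral_cone_dual[OF T]) (use that in blast)
  have "\<forall>\<^sub>F t in at_right 0. \<forall>v\<in>V. (\<mu> + t *\<^sub>R \<eta>) \<bullet> v \<le> 0"
  proof (intro eventually_ball_finite[OF V(1)] ballI)
    fix v assume v: "v \<in> V"
    then have \<mu>v: "\<mu> \<bullet> v \<le> 0" using \<mu> V(2) cnormal_iff_tangent[OF D z] by blast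
    show "\<forall>\<^sub>F t in at_right 0. (\<mu> + t *\<^sub>R \<eta>) \<bullet> v \<le> 0"
    proof (cases "\<mu> \<bullet> v = 0")
      case True
      then have "\<eta> \<bullet> v \<le> 0" using \<eta>'(2) v V(2) by (auto simp: critical_cone_def)
      then show ?thesis using True
        by (auto simp: eventually_at_filter inner_add_left intro!: always_eventually mult_nonneg_nonpos)
    next
      case False
      have "((\<lambda>t. (\<mu> + t *\<^sub>R \<eta>) \<bullet> v) \<longlongrightarrow> (\<mu> + 0 *\<^sub>R \<eta>) \<bullet> v) (at_right 0)" by (intro tendsto_intros)
      then have "\<forall>\<^sub>F t in at_right 0. (\<mu> + t *\<^sub>R \<eta>) \<bullet> v < 0"
        using False \<mu>v by (intro order_tendstoD(2)) auto
      then show ?thesis by eventually_elim simp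
    qed
  qed
  moreover have "\<forall>\<^sub>F t in at_right 0. norm (t *\<^sub>R w) < e"
  proof -
    have "((\<lambda>t. norm (t *\<^sub>R w)) \<longlongrightarrow> norm (0 *\<^sub>R w)) (at_right (0::real))" by (intro tendsto_intros)
    then show ?thesis using e(1) by (intro order_tendstoD(2)) auto
  qed
  moreover have "\<forall>\<^sub>F t in at_right (0::real). 0 < t" by (simp add: eventually_at_filter)
  ultimately show ?thesis
  proof eventually_elim
    case (elim t)
    have "t *\<^sub>R w \<in> tangent_cone D z" using conicD[OF T(2) w(1)] elim(3) by simp
    then have "z + t *\<^sub>R w \<in> D" using e(2) elim(2) by blast
    moreover have "(\<mu> + t *\<^sub>R \<eta>) \<bullet> (q - (z + t *\<^sub>R w)) \<le> 0" if "q \<in> D" for q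
    proof -
      have "(\<mu> + t *\<^sub>R \<eta>) \<bullet> (q - z) \<le> 0"
        using elim(1) V(3) diff_in_tangent_cone[OF D z that] by blast
      then show ?thesis using w(2) \<eta>'(1) by (simp add: inner_diff_right inner_add_right inner_add_left)
    qed
    ultimately show ?case by (auto simp: cnormal_def)
  qed
qed

lemma closed_gph_cnormal:
  assumes "closed S"
  shows "closed (gph (cnormal (S :: 'a::euclidean_space set)))"
  unfolding closed_sequential_limits
proof (intro allI impI, elim conjE)
  fix x :: "nat \<Rightarrow> 'a \<times> 'a" and l
  assume x: "\<forall>k. x k \<in> gph (cnormal S)" "x \<longlonglongrightarrow> l"
  have "snd l \<in> cnormal S (fst l)"
    using x(1) by (intro cnormal_limit[OF assms tendsto_fst[OF x(2)] tendsto_snd[OF x(2)]])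
      (auto simp: gph_def case_prod_beta intro!: always_eventually)
  then show "l \<in> gph (cnormal S)" by (auto simp: gph_def)
qed

section \<open>The graphical derivative\<close>

text \<open>
  The abstract situation: near \<open>y\<close> the set \<open>N z\<close> consists of the vectors \<open>(B z)\<^sup>T \<mu>\<close> with \<open>\<mu>\<close> normal to
  \<open>D\<close> at \<open>G z\<close>, and multipliers can be chosen with a linear bound. In the application \<open>G\<close> is \<open>gtilde g\<close>
  and \<open>B\<close> is \<open>beta g\<close>. The derivative of \<open>B\<close> is operator valued, so that the Jacobian of
  \<open>z \<mapsto> (B z)\<^sup>T \<mu>\<close> in direction \<open>v\<close> is \<open>(B' z v)\<^sup>T \<mu>\<close>.
\<close>

locale multiplier_system =
  fixes D :: "'s::euclidean_space set"
    and G :: "'y::euclidean_space \<Rightarrow> 's" and G' :: "'y \<Rightarrow> 'y \<Rightarrow>\<^sub>L 's"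
    and B :: "'y \<Rightarrow> ('n::euclidean_space \<Rightarrow>\<^sub>L 's)" and B' :: "'y \<Rightarrow> 'y \<Rightarrow>\<^sub>L ('n \<Rightarrow>\<^sub>L 's)"
    and N :: "'y \<Rightarrow> 'n set" and \<kappa> :: real and y :: 'y
  assumes D: "polyhedron D"
    and G_deriv: "\<And>z. (G has_derivative G' z) (at z)" and G'_cont: "isCont G' y"
    and B_deriv: "\<And>z. (B has_derivative B' z) (at z)" and B'_cont: "isCont B' y"
    and multiplier: "\<forall>\<^sub>F z in nhds y. \<forall>b\<in>N z. \<exists>\<mu>\<in>cnormal D (G z). adjoint (B z) \<mu> = b \<and> norm \<mu> \<le> \<kappa> * norm b"
    and normal: "\<forall>\<^sub>F z in nhds y. \<forall>\<mu>\<in>cnormal D (G z). adjoint (B z) \<mu> \<in> N z"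
begin

abbreviation "T \<equiv> tangent_cone D (G y)"

lemma normal_cone_D: "normal_cone D = cnormal D"
  by (intro ext normal_cone_convex polyhedron_imp_closed[OF D] polyhedron_imp_convex[OF D])

lemma G_tendsto: "x \<longlonglongrightarrow> z \<Longrightarrow> (\<lambda>k. G (x k)) \<longlonglongrightarrow> G z"
  using isCont_tendsto_compose[OF has_derivative_continuous[OF G_deriv]] .

lemma B_tendsto: "x \<longlonglongrightarrow> z \<Longrightarrow> (\<lambda>k. B (x k)) \<longlonglongrightarrow> B z"
  using isCont_tendsto_compose[OF has_derivative_continuous[OF B_deriv]] .

lemma adjoint_B_pair_derivative:
  "((\<lambda>p. adjoint (B (fst p)) (snd p)) has_derivative
     (\<lambda>h. adjoint (B z) (snd h) + adjoint (B' z (fst h)) \<mu>)) (at (z, \<mu>))"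
proof -
  have "((\<lambda>p. B (fst p)) has_derivative (\<lambda>h. B' z (fst h))) (at (z, \<mu>))"
    using has_derivative_compose[of fst fst "(z, \<mu>)" UNIV B "B' z"] B_deriv[of z]
    by (simp add: bounded_linear_imp_has_derivative bounded_linear_fst)
  from adj.FDERIV[OF this bounded_linear_imp_has_derivative[OF bounded_linear_snd]]
  show ?thesis by simp
qed

text \<open>
  Differentiating \<open>(z, \<mu>) \<mapsto> (z, (B z)\<^sup>T \<mu>)\<close> sends tangents of the set of pairs with \<open>\<mu>\<close> normal at \<open>G z\<close>
  to tangents of the graph of \<open>N\<close>. The base point \<open>z0\<close> varies, because the coderivative
  needs this at points near \<open>y\<close>.
\<close>

lemma gph_tangentI:
  assumes near: "\<forall>\<^sub>F z in nhds z0. \<forall>\<mu>\<in>cnormal D (G z). adjoint (B z) \<mu> \<in> N z"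
    and t: "\<And>k::nat. 0 < t k" "t \<longlonglongrightarrow> 0"
    and x: "(\<lambda>k. (x k - z0) /\<^sub>R t k) \<longlonglongrightarrow> v" and m: "(\<lambda>k. (m k - \<mu>) /\<^sub>R t k) \<longlonglongrightarrow> \<eta>"
    and mem: "\<forall>\<^sub>F k in sequentially. m k \<in> cnormal D (G (x k))" and \<mu>: "\<mu> \<in> cnormal D (G z0)"
  shows "(v, adjoint (B' z0 v) \<mu> + adjoint (B z0) \<eta>) \<in> tangent_cone (gph N) (z0, adjoint (B z0) \<mu>)"
proof (rule tangent_coneI[of _ _ t "\<lambda>k. (x k, adjoint (B (x k)) (m k))"])
  show "(z0, adjoint (B z0) \<mu>) \<in> gph N"
    using eventually_nhds_x_imp_x[OF near] \<mu> by (simp add: gph_def)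
  show "\<forall>\<^sub>F k in sequentially. (x k, adjoint (B (x k)) (m k)) \<in> gph N"
    using eventually_compose_filterlim[OF near quotient_imp_tendsto[OF t x]] mem
    by eventually_elim (simp add: gph_def)
  have "(\<lambda>k. ((x k, m k) - (z0, \<mu>)) /\<^sub>R t k) \<longlonglongrightarrow> (v, \<eta>)"
    using tendsto_Pair[OF x m] by simp
  from has_derivative_quotient[OF adjoint_B_pair_derivative t this]
  have "(\<lambda>k. (adjoint (B (x k)) (m k) - adjoint (B z0) \<mu>) /\<^sub>R t k) \<longlonglongrightarrow> adjoint (B' z0 v) \<mu> + adjoint (B z0) \<eta>"
    by (simp add: add.commute)
  from tendsto_Pair[OF x this]
  show "(\<lambda>k. ((x k, adjoint (B (x k)) (m k)) - (z0, adjoint (B z0) \<mu>)) /\<^sub>R t k)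
      \<longlonglongrightarrow> (v, adjoint (B' z0 v) \<mu> + adjoint (B z0) \<eta>)" by simp
qed (rule t)+

text \<open>
  Bounded multipliers have a cluster point \<open>\<mu>\<close>. By \<open>directional_stability\<close> they and \<open>\<mu>\<close> are all
  normal to \<open>T\<close> at \<open>G' y v\<close>. The last conclusion expands \<open>(B x\<^sub>k)\<^sup>T m\<^sub>k - (B y)\<^sup>T \<mu>\<close> to first order;
  it controls the quotients of the multipliers only after applying \<open>(B y)\<^sup>T\<close>.
\<close>

lemma multiplier_sequence:
  assumes t: "\<And>k::nat. 0 < t k" "t \<longlonglongrightarrow> 0" and v: "vs \<longlonglongrightarrow> v" and u: "us \<longlonglongrightarrow> u"
    and mem: "\<And>k. xs + t k *\<^sub>R us k \<in> N (y + t k *\<^sub>R vs k)"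
  obtains r m \<mu> where "strict_mono (r :: nat \<Rightarrow> nat)" "m \<longlonglongrightarrow> \<mu>"
    "\<And>k. m k \<in> cnormal D (G (y + t (r k) *\<^sub>R vs (r k)))"
    "\<And>k. adjoint (B (y + t (r k) *\<^sub>R vs (r k))) (m k) = xs + t (r k) *\<^sub>R us (r k)"
    "\<And>k. m k \<in> cnormal T (G' y v)" "\<mu> \<in> cnormal T (G' y v)"
    "\<mu> \<in> cnormal D (G y)" "adjoint (B y) \<mu> = xs"
    "(\<lambda>k. adjoint (B y) ((m k - \<mu>) /\<^sub>R t (r k))) \<longlonglongrightarrow> u - adjoint (B' y v) \<mu>"
proof -
  define x where "x = (\<lambda>k. y + t k *\<^sub>R vs k)"
  have xq: "(\<lambda>k. (x k - y) /\<^sub>R t k) \<longlonglongrightarrow> v" using v t(1) by (simp add: x_def less_imp_neq[symmetric])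
  have xy: "x \<longlonglongrightarrow> y" by (rule quotient_imp_tendsto[OF t xq])
  have bl: "(\<lambda>k. xs + t k *\<^sub>R us k) \<longlonglongrightarrow> xs + 0 *\<^sub>R u" by (intro tendsto_intros t u)
  have "\<forall>\<^sub>F k in sequentially. \<exists>n. n \<in> cnormal D (G (x k)) \<and> adjoint (B (x k)) n = xs + t k *\<^sub>R us k \<and>
      norm n \<le> \<kappa> * norm (xs + t k *\<^sub>R us k)"
    using eventually_compose_filterlim[OF multiplier xy]
    by eventually_elim (use mem in \<open>auto simp: x_def\<close>)
  then have "\<exists>n. \<forall>\<^sub>F k in sequentially. n k \<in> cnormal D (G (x k)) \<and> adjoint (B (x k)) (n k) = xs + t k *\<^sub>R us k \<and>
      norm (n k) \<le> \<kappa> * norm (xs + t k *\<^sub>R us k)"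
    by (intro exI[of _ "\<lambda>k. SOME n. n \<in> cnormal D (G (x k)) \<and> adjoint (B (x k)) n = xs + t k *\<^sub>R us k \<and>
      norm n \<le> \<kappa> * norm (xs + t k *\<^sub>R us k)"]) (erule eventually_mono, rule someI_ex)
  then obtain n where n: "\<forall>\<^sub>F k in sequentially. n k \<in> cnormal D (G (x k)) \<and>
      adjoint (B (x k)) (n k) = xs + t k *\<^sub>R us k \<and> norm (n k) \<le> \<kappa> * norm (xs + t k *\<^sub>R us k)" by blast
  have "(\<lambda>k. \<kappa> * norm (xs + t k *\<^sub>R us k)) \<longlonglongrightarrow> \<kappa> * norm (xs + 0 *\<^sub>R u)" by (intro tendsto_intros bl)
  then have "\<forall>\<^sub>F k in sequentially. \<kappa> * norm (xs + t k *\<^sub>R us k) < \<kappa> * norm xs + 1"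
    by (intro order_tendstoD(2)) auto
  with n have "\<forall>\<^sub>F k in sequentially. norm (n k) \<le> \<kappa> * norm xs + 1" by eventually_elim auto
  then obtain \<mu> s where s: "strict_mono (s :: nat \<Rightarrow> nat)" "(n \<circ> s) \<longlonglongrightarrow> \<mu>"
    by (rule eventually_bounded_subseq)
  note ns = eventually_subseq[OF s(1) n]
  have xs_lim: "(\<lambda>k. x (s k)) \<longlonglongrightarrow> y" using LIMSEQ_subseq_LIMSEQ[OF xy s(1)] by (simp add: o_def)
  have \<mu>D: "\<mu> \<in> cnormal D (G y)"
    by (rule cnormal_limit[OF polyhedron_imp_closed[OF D] G_tendsto[OF xs_lim] s(2)])
      (use ns in \<open>auto elim: eventually_mono\<close>)
  have z: "G y \<in> D" using cnormalD(1)[OF \<mu>D] .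
  define w' where "w' = (\<lambda>k. (G (x k) - G y) /\<^sub>R t k)"
  have w': "w' \<longlonglongrightarrow> G' y v" unfolding w'_def by (rule has_derivative_quotient[OF G_deriv t xq])
  have Gx: "G (x k) = G y + t k *\<^sub>R w' k" for k using t(1)[of k] by (simp add: w'_def)
  have wT: "G' y v \<in> T"
  proof (rule tangent_coneI[of _ _ "t \<circ> s" "\<lambda>k. G (x (s k))"])
    show "\<forall>\<^sub>F k in sequentially. G (x (s k)) \<in> D" using ns by (auto elim!: eventually_mono dest: cnormalD)
    show "(\<lambda>k. (G (x (s k)) - G y) /\<^sub>R (t \<circ> s) k) \<longlonglongrightarrow> G' y v"
      using LIMSEQ_subseq_LIMSEQ[OF w' s(1)] by (simp add: o_def w'_def)
  qed (use z t LIMSEQ_subseq_LIMSEQ[OF t(2) s(1)] in auto)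
  obtain e where e: "0 < e"
    "\<And>t w' n. 0 < t \<Longrightarrow> t < e \<Longrightarrow> norm (w' - G' y v) < e \<Longrightarrow> n \<in> cnormal D (G y + t *\<^sub>R w') \<Longrightarrow>
       n \<in> cnormal T (G' y v)"
    by (rule directional_stability[OF D z wT]) (use that in blast)
  have "\<forall>\<^sub>F k in sequentially. t k < e" by (rule order_tendstoD(2)[OF t(2) e(1)])
  moreover have "\<forall>\<^sub>F k in sequentially. norm (w' k - G' y v) < e"
    using tendstoD[OF w' e(1)] by (simp add: dist_norm)
  ultimately have "\<forall>\<^sub>F k in sequentially. t k < e \<and> norm (w' k - G' y v) < e" by eventually_elim simp
  from eventually_subseq[OF s(1) this] ns
  have "\<forall>\<^sub>F k in sequentially. n (s k) \<in> cnormal D (G (x (s k))) \<and>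
      adjoint (B (x (s k))) (n (s k)) = xs + t (s k) *\<^sub>R us (s k) \<and> n (s k) \<in> cnormal T (G' y v)"
    by eventually_elim (use e(2) t(1) Gx in auto)
  then obtain j where j: "\<And>k. k \<ge> j \<Longrightarrow> n (s k) \<in> cnormal D (G (x (s k))) \<and>
      adjoint (B (x (s k))) (n (s k)) = xs + t (s k) *\<^sub>R us (s k) \<and> n (s k) \<in> cnormal T (G' y v)"
    unfolding eventually_sequentially by blast
  \<comment> \<open>dropping finitely many terms makes the eventual properties hold for all indices\<close>
  define r where "r = (\<lambda>k. s (k + j))"
  define m where "m = (\<lambda>k. n (r k))"
  have r: "strict_mono r" using s(1) by (simp add: r_def strict_mono_def)
  have m: "m \<longlonglongrightarrow> \<mu>" using LIMSEQ_ignore_initial_segment[OF s(2), of j] by (simp add: m_def r_def o_def)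
  have mk: "m k \<in> cnormal D (G (x (r k)))" "adjoint (B (x (r k))) (m k) = xs + t (r k) *\<^sub>R us (r k)"
    "m k \<in> cnormal T (G' y v)" for k
    using j[of "k + j"] by (auto simp: m_def r_def)
  have "closed T" using polyhedron_imp_closed[OF polyhedron_tangent_cone_polyhedron(1)[OF D z]] .
  then have \<mu>T: "\<mu> \<in> cnormal T (G' y v)"
    by (rule cnormal_limit[OF _ tendsto_const m]) (use mk in auto)
  have xr: "(\<lambda>k. x (r k)) \<longlonglongrightarrow> y" using LIMSEQ_subseq_LIMSEQ[OF xy r] by (simp add: o_def)
  have \<mu>xs: "adjoint (B y) \<mu> = xs"
  proof (rule LIMSEQ_unique)
    show "(\<lambda>k. adjoint (B (x (r k))) (m k)) \<longlonglongrightarrow> adjoint (B y) \<mu>"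
      by (intro adj.tendsto B_tendsto xr m)
    show "(\<lambda>k. adjoint (B (x (r k))) (m k)) \<longlonglongrightarrow> xs"
      using LIMSEQ_subseq_LIMSEQ[OF bl r] by (simp add: mk o_def)
  qed
  have Bq: "(\<lambda>k. (B (x k) - B y) /\<^sub>R t k) \<longlonglongrightarrow> B' y v" by (rule has_derivative_quotient[OF B_deriv t xq])
  have "(\<lambda>k. us (r k) - adjoint ((B (x (r k)) - B y) /\<^sub>R t (r k)) (m k)) \<longlonglongrightarrow> u - adjoint (B' y v) \<mu>"
    using LIMSEQ_subseq_LIMSEQ[OF Bq r] LIMSEQ_subseq_LIMSEQ[OF u r]
    by (intro tendsto_diff adj.tendsto m) (simp_all add: o_def)
  moreover have "us (r k) - adjoint ((B (x (r k)) - B y) /\<^sub>R t (r k)) (m k) = adjoint (B y) ((m k - \<mu>) /\<^sub>R t (r k))" for k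
    using t(1)[of "r k"] mk(2)[of k]
    by (simp add: adj.scaleR_left adj.scaleR_right adj.diff_left adj.diff_right \<mu>xs algebra_simps)
  ultimately have "(\<lambda>k. adjoint (B y) ((m k - \<mu>) /\<^sub>R t (r k))) \<longlonglongrightarrow> u - adjoint (B' y v) \<mu>" by simp
  then show ?thesis using that[OF r m] mk \<mu>T \<mu>D \<mu>xs unfolding x_def by blast
qed

text \<open>
  The quotients \<open>(m k - \<mu>) / t\<close> need not converge, but their images do, inside the closed image of a
  polyhedral cone.
\<close>

proposition derivative_subset:
  assumes "us \<in> graphical_derivative N (y, xs) v"
  obtains \<mu> \<eta> where "\<mu> \<in> cnormal D (G y)" "adjoint (B y) \<mu> = xs"
    "\<eta> \<in> cnormal (critical_cone D (G y) \<mu>) (G' y v)"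
    "us = adjoint (B' y v) \<mu> + adjoint (B y) \<eta>"
proof -
  obtain t ws where t: "\<And>k::nat. 0 < t k" "t \<longlonglongrightarrow> 0" "ws \<longlonglongrightarrow> (v, us)" "\<And>k. (y, xs) + t k *\<^sub>R ws k \<in> gph N"
    using assms unfolding graphical_derivative_def tangent_cone_def by blast
  have mem: "xs + t k *\<^sub>R snd (ws k) \<in> N (y + t k *\<^sub>R fst (ws k))" for k
    using t(4)[of k] by (cases "ws k") (simp add: gph_def)
  obtain r m \<mu> where m: "\<And>k. m k \<in> cnormal T (G' y v)" "\<mu> \<in> cnormal T (G' y v)"
    "\<mu> \<in> cnormal D (G y)" "adjoint (B y) \<mu> = xs"
    "(\<lambda>k. adjoint (B y) ((m k - \<mu>) /\<^sub>R t (r k))) \<longlonglongrightarrow> us - adjoint (B' y v) \<mu>"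
    by (rule multiplier_sequence[OF t(1,2) tendsto_fst[OF t(3)] tendsto_snd[OF t(3)], simplified, OF mem])
      (use that in blast)
  have z: "G y \<in> D" using cnormalD(1)[OF m(3)] .
  let ?C = "cnormal (critical_cone D (G y) \<mu>) (G' y v)"
  have in_C: "(m k - \<mu>) /\<^sub>R t (r k) \<in> ?C" for k
    using cnormal_diff_critical[OF D z m(1,2)] t(1)[of "r k"] by simp
  have "closed (adjoint (B y) ` ?C)"
    using closed_linear_image_cnormal[OF critical_cone_polyhedral[OF D z] cnormalD(1)[OF in_C[of 0]]
        bounded_linear.linear[OF adj.bounded_linear_right]] .
  then have "us - adjoint (B' y v) \<mu> \<in> adjoint (B y) ` ?C"
    by (rule closed_sequentially[OF _ _ m(5)]) (use in_C in blast)
  then obtain \<eta> where "\<eta> \<in> ?C" "us - adjoint (B' y v) \<mu> = adjoint (B y) \<eta>" by blast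
  then show ?thesis using that[OF m(3,4)] by (simp add: algebra_simps)
qed

text \<open>
  Zero belongs to the value at \<open>(x, \<mu>)\<close> exactly when \<open>\<mu>\<close> is normal to \<open>D\<close> at \<open>G x\<close>.
\<close>

abbreviation graph_system :: "'y \<times> 's \<Rightarrow> ('s \<times> 's) set" where
  "graph_system \<equiv> (\<lambda>(x, \<mu>). {(G x, \<mu>) - q | q. q \<in> gph (cnormal D)})"

text \<open>
  The points \<open>(y + t v, \<mu> + t \<eta>)\<close> have residual \<open>o(t)\<close>, because by \<open>critical_normal_ray\<close> their first
  order models lie in the graph. Subregularity corrects them by \<open>o(t)\<close>, which does not affect the
  tangent direction.
\<close>

proposition derivative_member:
  assumes \<mu>: "\<mu> \<in> cnormal D (G y)" and \<eta>: "\<eta> \<in> cnormal (critical_cone D (G y) \<mu>) (G' y v)"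
    and sub: "metrically_subregular_in_direction graph_system ((y, \<mu>), (0, 0)) (v, \<eta>)"
  shows "adjoint (B' y v) \<mu> + adjoint (B y) \<eta> \<in> graphical_derivative N (y, adjoint (B y) \<mu>) v"
proof -
  define t where "t = (\<lambda>k. inverse (real (Suc k)))"
  have t: "\<And>k. 0 < t k" "t \<longlonglongrightarrow> 0" unfolding t_def using LIMSEQ_inverse_real_of_nat by auto
  define a where "a = (\<lambda>k. (y, \<mu>) + t k *\<^sub>R (v, \<eta>))"
  define \<rho> where "\<rho> = (\<lambda>k. norm (G (y + t k *\<^sub>R v) - (G y + t k *\<^sub>R G' y v)))"
  have sols: "{a. (0, 0) \<in> graph_system a} = {(x, n). n \<in> cnormal D (G x)}"
    by (auto simp: gph_def zero_prod_def)
  obtain c where c: "0 < c" "\<forall>\<^sub>F k in sequentially.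
      dist_set (a k) {(x, n). n \<in> cnormal D (G x)} \<le> ennreal c * dist_set (0, 0) (graph_system (a k))"
  proof -
    obtain c where "0 < c" "\<And>t us. (\<forall>k::nat. 0 < t k) \<and> t \<longlonglongrightarrow> 0 \<and> us \<longlonglongrightarrow> (v, \<eta>) \<Longrightarrow>
        \<forall>\<^sub>F k in sequentially. dist_set ((y, \<mu>) + t k *\<^sub>R us k) {a. (0, 0) \<in> graph_system a}
             \<le> ennreal c * dist_set (0, 0) (graph_system ((y, \<mu>) + t k *\<^sub>R us k))"
      using sub unfolding metrically_subregular_in_direction_def fst_conv snd_conv by blast
    from that[OF this(1)] this(2)[of t "\<lambda>_. (v, \<eta>)"] t show ?thesis unfolding sols a_def by auto
  qed
  have "\<forall>\<^sub>F k in sequentially. \<mu> + t k *\<^sub>R \<eta> \<in> cnormal D (G y + t k *\<^sub>R G' y v)"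
  proof (rule eventually_compose_filterlim[OF critical_normal_ray[OF D \<mu> \<eta>]])
    show "filterlim t (at_right 0) sequentially"
      unfolding filterlim_at using t less_imp_neq[OF t(1)] by (auto intro!: always_eventually)
  qed
  with c(2) have "\<forall>\<^sub>F k in sequentially. \<exists>p. snd p \<in> cnormal D (G (fst p)) \<and> dist (a k) p < c * \<rho> k + (t k)\<^sup>2"
  proof eventually_elim
    case (elim k)
    have q: "(G (y + t k *\<^sub>R v), \<mu> + t k *\<^sub>R \<eta>) - (G y + t k *\<^sub>R G' y v, \<mu> + t k *\<^sub>R \<eta>) \<in> graph_system (a k)"
      using elim(2) by (auto simp: a_def gph_def intro!: exI[of _ "G y + t k *\<^sub>R G' y v"])
    have d: "dist (0, 0) ((G (y + t k *\<^sub>R v), \<mu> + t k *\<^sub>R \<eta>) - (G y + t k *\<^sub>R G' y v, \<mu> + t k *\<^sub>R \<eta>)) \<le> \<rho> k"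
      by (simp add: \<rho>_def dist_Pair_Pair dist_norm norm_minus_commute)
    have tk: "0 < (t k)\<^sup>2" "0 \<le> c" using t(1)[of k] c(1) by simp_all
    obtain p where "p \<in> {(x, n). n \<in> cnormal D (G x)}" "dist (a k) p < c * \<rho> k + (t k)\<^sup>2"
      by (rule dist_set_error_bound[OF elim(1) q d tk(2,1)])
    then show ?case by (intro exI[of _ p]) auto
  qed
  then have "\<exists>p. \<forall>\<^sub>F k in sequentially. snd (p k) \<in> cnormal D (G (fst (p k))) \<and> dist (a k) (p k) < c * \<rho> k + (t k)\<^sup>2"
    by (intro exI[of _ "\<lambda>k. SOME p. snd p \<in> cnormal D (G (fst p)) \<and> dist (a k) p < c * \<rho> k + (t k)\<^sup>2"])
      (erule eventually_mono, rule someI_ex)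
  then obtain p where p: "\<forall>\<^sub>F k in sequentially. snd (p k) \<in> cnormal D (G (fst (p k))) \<and>
      dist (a k) (p k) < c * \<rho> k + (t k)\<^sup>2" by blast
  have \<rho>: "(\<lambda>k. \<rho> k / t k) \<longlonglongrightarrow> 0"
  proof -
    have "(\<lambda>k. ((y + t k *\<^sub>R v) - y) /\<^sub>R t k) \<longlonglongrightarrow> v" using t(1) by (simp add: less_imp_neq[symmetric])
    from has_derivative_quotient[OF G_deriv t this]
    have "(\<lambda>k. norm ((G (y + t k *\<^sub>R v) - G y) /\<^sub>R t k - G' y v)) \<longlonglongrightarrow> norm (G' y v - G' y v)"
      by (intro tendsto_intros)
    moreover have "norm ((G (y + t k *\<^sub>R v) - G y) /\<^sub>R t k - G' y v) = \<rho> k / t k" for k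
    proof -
      have "(G (y + t k *\<^sub>R v) - G y) /\<^sub>R t k - G' y v = (G (y + t k *\<^sub>R v) - (G y + t k *\<^sub>R G' y v)) /\<^sub>R t k"
        using t(1)[of k] by (simp add: algebra_simps)
      then show ?thesis using t(1)[of k] by (simp add: \<rho>_def divide_inverse mult.commute)
    qed
    ultimately show ?thesis by simp
  qed
  have "(\<lambda>k. (p k - a k) /\<^sub>R t k) \<longlonglongrightarrow> 0"
  proof (rule Lim_null_comparison)
    show "\<forall>\<^sub>F k in sequentially. norm ((p k - a k) /\<^sub>R t k) \<le> c * (\<rho> k / t k) + t k"
      using p
    proof eventually_elim
      case (elim k)
      have "norm ((p k - a k) /\<^sub>R t k) = dist (a k) (p k) / t k"
        using t(1)[of k] by (simp add: dist_norm norm_minus_commute divide_inverse mult.commute)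
      also have "\<dots> \<le> (c * \<rho> k + (t k)\<^sup>2) / t k" using elim t(1)[of k] by (intro divide_right_mono) auto
      also have "\<dots> = c * (\<rho> k / t k) + t k" using t(1)[of k] by (simp add: field_simps power2_eq_square)
      finally show ?case .
    qed
    have "(\<lambda>k. c * (\<rho> k / t k) + t k) \<longlonglongrightarrow> c * 0 + 0" by (intro tendsto_intros \<rho> t)
    then show "(\<lambda>k. c * (\<rho> k / t k) + t k) \<longlonglongrightarrow> 0" by simp
  qed
  then have "(\<lambda>k. (p k - a k) /\<^sub>R t k + (v, \<eta>)) \<longlonglongrightarrow> 0 + (v, \<eta>)" by (intro tendsto_intros)
  moreover have "(p k - a k) /\<^sub>R t k + (v, \<eta>) = (p k - (y, \<mu>)) /\<^sub>R t k" for k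
    using t(1)[of k] by (simp add: a_def algebra_simps)
  ultimately have pq: "(\<lambda>k. (p k - (y, \<mu>)) /\<^sub>R t k) \<longlonglongrightarrow> (v, \<eta>)" by simp
  have "(v, adjoint (B' y v) \<mu> + adjoint (B y) \<eta>) \<in> tangent_cone (gph N) (y, adjoint (B y) \<mu>)"
  proof (rule gph_tangentI[OF normal t])
    show "(\<lambda>k. (fst (p k) - y) /\<^sub>R t k) \<longlonglongrightarrow> v" using tendsto_fst[OF pq] by simp
    show "(\<lambda>k. (snd (p k) - \<mu>) /\<^sub>R t k) \<longlonglongrightarrow> \<eta>" using tendsto_snd[OF pq] by simp
  qed (use p \<mu> in \<open>auto elim: eventually_mono\<close>)
  then show ?thesis by (simp add: graphical_derivative_def)
qed

section \<open>Subregularity from the qualification condition\<close>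

text \<open>
  Membership in the orthogonal complement of the normals to \<open>T\<close> at \<open>G' y v\<close>. Condition (A) is
  equivalent to surjectivity of \<open>G' y\<close> modulo this subspace.
\<close>

abbreviation annihilates :: "'y \<Rightarrow> 's \<Rightarrow> bool" where
  "annihilates v l \<equiv> \<forall>m\<in>cnormal T (G' y v). m \<bullet> l = 0"

text \<open>
  A normal \<open>n\<close> to \<open>D\<close> at a target \<open>G y + t w'\<close> is kept while the point \<open>x\<close> is corrected: Graves' theorem
  reaches the target up to a shift in the annihilated subspace, and such shifts preserve \<open>n\<close> as long
  as they are small compared with \<open>t\<close>. The extra shift \<open>l0\<close> of the target is of use for tangents that match only
  modulo the subspace.
\<close>

lemma solvable_near:
  assumes w: "G' y v \<in> T"
    and A: "\<And>\<mu>. adjoint (G' y) \<mu> = 0 \<Longrightarrow> \<mu> \<in> span (cnormal T (G' y v)) \<Longrightarrow> \<mu> = 0"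
  obtains c e where "0 < c" "0 < e"
    "\<And>x t w' l0 n. norm (x - y) < e \<Longrightarrow> 0 < t \<Longrightarrow> t < e \<Longrightarrow> norm (w' - G' y v) < e \<Longrightarrow>
       n \<in> cnormal D (G y + t *\<^sub>R w') \<Longrightarrow> annihilates v l0 \<Longrightarrow> norm l0 \<le> e * t \<Longrightarrow>
       norm (G x - (G y + t *\<^sub>R w' + l0)) \<le> e * t \<Longrightarrow>
       \<exists>x'. norm (x' - x) \<le> c * norm (G x - (G y + t *\<^sub>R w' + l0)) \<and> n \<in> cnormal D (G x')"
proof -
  have z: "G y \<in> D" using w by (simp add: tangent_cone_def)
  have surj: "\<exists>u l. l \<in> {l. annihilates v l} \<and> G' y u + l = q" for q
    using surjective_modulo_annihilator[OF A, where q = q] by auto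
  obtain c e0 where c: "0 < c" and e0: "0 < e0"
    and graves: "\<And>x q. norm (x - y) < e0 \<Longrightarrow> norm (G x - q) < e0 \<Longrightarrow>
       \<exists>x' l. l \<in> {l. annihilates v l} \<and> G x' = q + l \<and> norm (x' - x) \<le> c * norm (G x - q) \<and>
         norm l \<le> c * norm (G x - q)"
    by (rule graves_modulo_subspace[OF G_deriv G'_cont subspace_annihilator surj]) (use that in blast)
  obtain e1 where e1: "0 < e1"
    and shift: "\<And>t w' n l. 0 < t \<Longrightarrow> t < e1 \<Longrightarrow> norm (w' - G' y v) < e1 \<Longrightarrow>
       n \<in> cnormal D (G y + t *\<^sub>R w') \<Longrightarrow> norm l < e1 \<Longrightarrow> annihilates v l \<Longrightarrow>
       n \<in> cnormal D (G y + t *\<^sub>R (w' + l))"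
    by (rule directional_stability[OF D z w]) (use that in blast)
  \<comment> \<open>the total shift is at most \<open>(e + c * e) * t\<close> and must stay below \<open>e1 * t\<close>\<close>
  define e where "e = min 1 (min e0 (e1 / (2 * (1 + c))))"
  have "e1 / (2 * (1 + c)) \<le> e1 / 1" using e1 c by (intro divide_left_mono) auto
  then have e: "0 < e" "e \<le> 1" "e \<le> e0" "e \<le> e1" using e0 e1 c by (auto simp: e_def)
  have "e \<le> e1 / (2 * (1 + c))" by (simp add: e_def)
  then have "e * (1 + c) \<le> e1 / 2" using c by (simp add: field_simps)
  then have ec: "e + c * e < e1" using e1 by (simp add: algebra_simps)
  show ?thesis
  proof (rule that[OF c e(1)])
    fix x t w' l0 n
    assume x: "norm (x - y) < e" and t: "0 < t" "t < e" and w': "norm (w' - G' y v) < e"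
      and n: "n \<in> cnormal D (G y + t *\<^sub>R w')" and l0: "annihilates v l0" "norm l0 \<le> e * t"
      and q: "norm (G x - (G y + t *\<^sub>R w' + l0)) \<le> e * t"
    have "e * t < e0"
    proof -
      have "e * t \<le> 1 * t" using e t by (intro mult_right_mono) auto
      then show ?thesis using t e by linarith
    qed
    then have "norm (x - y) < e0" "norm (G x - (G y + t *\<^sub>R w' + l0)) < e0" using x q e by linarith+
    from graves[OF this] obtain x' l where l: "annihilates v l" "G x' = G y + t *\<^sub>R w' + l0 + l"
        "norm (x' - x) \<le> c * norm (G x - (G y + t *\<^sub>R w' + l0))"
        "norm l \<le> c * norm (G x - (G y + t *\<^sub>R w' + l0))"
      by blast
    define l' where "l' = (l0 + l) /\<^sub>R t"
    have "norm l \<le> c * (e * t)" using l(4) mult_left_mono[OF q, of c] c by linarith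
    then have "norm (l0 + l) \<le> (e + c * e) * t"
      using norm_triangle_ineq[of l0 l] l0(2) by (simp add: algebra_simps)
    then have "norm (l0 + l) / t \<le> e + c * e" using t by (simp add: pos_divide_le_eq)
    then have "norm l' \<le> e + c * e" using t by (simp add: l'_def divide_inverse mult.commute)
    then have "norm l' < e1" using ec by linarith
    moreover have "annihilates v l'" using l0(1) l(1) by (auto simp: l'_def inner_add_right)
    ultimately have "n \<in> cnormal D (G y + t *\<^sub>R (w' + l'))"
      using shift[OF t(1) _ _ n] t w' e by auto
    moreover have "G y + t *\<^sub>R (w' + l') = G x'" using t by (simp add: l'_def l(2) algebra_simps)
    ultimately show "\<exists>x'. norm (x' - x) \<le> c * norm (G x - (G y + t *\<^sub>R w' + l0)) \<and> n \<in> cnormal D (G x')"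
      using l(3) by auto
  qed
qed

text \<open>
  Let \<open>(q, n)\<close> be the point of the graph closest to \<open>(G x, m)\<close>. Comparison with the segment of
  \<open>critical_normal_ray\<close> shows that the distance is \<open>o(t)\<close>, so \<open>q\<close> is still approached along \<open>G' y v\<close> and
  \<open>solvable_near\<close> moves \<open>x\<close> to a point at which \<open>n\<close> is normal. Moving \<open>x\<close> costs \<open>c\<close> times the distance and
  replacing \<open>m\<close> by \<open>n\<close> costs at most the distance, which explains the modulus \<open>c + 1\<close>.
\<close>

proposition subregular:
  assumes \<mu>: "\<mu> \<in> cnormal D (G y)" and \<eta>: "\<eta> \<in> cnormal (critical_cone D (G y) \<mu>) (G' y v)"
    and A: "\<And>\<mu>. adjoint (G' y) \<mu> = 0 \<Longrightarrow> \<mu> \<in> span (cnormal T (G' y v)) \<Longrightarrow> \<mu> = 0"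
  shows "metrically_subregular_in_direction graph_system ((y, \<mu>), (0, 0)) (v, \<eta>)"
proof -
  have z: "G y \<in> D" using cnormalD(1)[OF \<mu>] .
  have w: "G' y v \<in> T" using cnormalD(1)[OF \<eta>] by (simp add: critical_cone_def)
  obtain c e where c: "0 < c" and e: "0 < e" and
    solve: "\<And>x t w' l0 n. norm (x - y) < e \<Longrightarrow> 0 < t \<Longrightarrow> t < e \<Longrightarrow> norm (w' - G' y v) < e \<Longrightarrow>
       n \<in> cnormal D (G y + t *\<^sub>R w') \<Longrightarrow> annihilates v l0 \<Longrightarrow> norm l0 \<le> e * t \<Longrightarrow>
       norm (G x - (G y + t *\<^sub>R w' + l0)) \<le> e * t \<Longrightarrow>
       \<exists>x'. norm (x' - x) \<le> c * norm (G x - (G y + t *\<^sub>R w' + l0)) \<and> n \<in> cnormal D (G x')"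
    using solvable_near[OF w A] by metis
  have sols: "{a. (0, 0) \<in> graph_system a} = {(x, n). n \<in> cnormal D (G x)}"
    by (auto simp: gph_def zero_prod_def)
  have main: "\<forall>\<^sub>F k in sequentially. dist_set ((y, \<mu>) + t k *\<^sub>R us k) {(x, n). n \<in> cnormal D (G x)}
        \<le> ennreal (c + 1) * dist_set (0, 0) (graph_system ((y, \<mu>) + t k *\<^sub>R us k))"
    if t: "\<And>k::nat. 0 < t k" "t \<longlonglongrightarrow> 0" and us: "us \<longlonglongrightarrow> (v, \<eta>)" for t us
  proof -
    define x where "x = (\<lambda>k. y + t k *\<^sub>R fst (us k))"
    define m where "m = (\<lambda>k. \<mu> + t k *\<^sub>R snd (us k))"
    have a: "(y, \<mu>) + t k *\<^sub>R us k = (x k, m k)" for k by (simp add: x_def m_def prod_eq_iff)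
    have xq: "(\<lambda>k. (x k - y) /\<^sub>R t k) \<longlonglongrightarrow> v" and mq: "(\<lambda>k. (m k - \<mu>) /\<^sub>R t k) \<longlonglongrightarrow> \<eta>"
      using tendsto_fst[OF us] tendsto_snd[OF us] t(1) by (simp_all add: x_def m_def less_imp_neq[symmetric])
    have xy: "x \<longlonglongrightarrow> y" by (rule quotient_imp_tendsto[OF t xq])
    have cl: "closed (gph (cnormal D))" by (rule closed_gph_cnormal[OF polyhedron_imp_closed[OF D]])
    have "gph (cnormal D) \<noteq> {}" using \<mu> by (auto simp: gph_def)
    then have "\<exists>q. q \<in> gph (cnormal D) \<and> (\<forall>q'\<in>gph (cnormal D). norm ((G (x k), m k) - q) \<le> norm ((G (x k), m k) - q'))" for k
      using distance_attains_inf[OF cl, of "(G (x k), m k)"] unfolding dist_norm by metis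
    then obtain q where q: "\<And>k. q k \<in> gph (cnormal D)"
      "\<And>k q'. q' \<in> gph (cnormal D) \<Longrightarrow> norm ((G (x k), m k) - q k) \<le> norm ((G (x k), m k) - q')" by metis
    define \<delta> where "\<delta> = (\<lambda>k. norm ((G (x k), m k) - q k))"
    define w' where "w' = (\<lambda>k. (fst (q k) - G y) /\<^sub>R t k)"
    have fst_q: "G y + t k *\<^sub>R w' k = fst (q k)" for k using t(1)[of k] by (simp add: w'_def)
    have Gq: "(\<lambda>k. (G (x k) - G y) /\<^sub>R t k) \<longlonglongrightarrow> G' y v" by (rule has_derivative_quotient[OF G_deriv t xq])
    define \<tau> where "\<tau> = (\<lambda>k. norm ((G (x k) - G y) /\<^sub>R t k - G' y v, (m k - \<mu>) /\<^sub>R t k - \<eta>))"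
    have "\<tau> \<longlonglongrightarrow> norm (G' y v - G' y v, \<eta> - \<eta>)" unfolding \<tau>_def
      by (intro tendsto_norm tendsto_Pair tendsto_diff Gq mq tendsto_const)
    then have \<tau>: "\<tau> \<longlonglongrightarrow> 0" by simp
    have "\<forall>\<^sub>F k in sequentially. \<mu> + t k *\<^sub>R \<eta> \<in> cnormal D (G y + t k *\<^sub>R G' y v)"
    proof (rule eventually_compose_filterlim[OF critical_normal_ray[OF D \<mu> \<eta>]])
      show "filterlim t (at_right 0) sequentially"
        unfolding filterlim_at using t less_imp_neq[OF t(1)] by (auto intro!: always_eventually)
    qed
    then have \<delta>: "\<forall>\<^sub>F k in sequentially. \<delta> k \<le> \<tau> k * t k"
    proof eventually_elim
      case (elim k)
      have "\<delta> k \<le> norm ((G (x k), m k) - (G y + t k *\<^sub>R G' y v, \<mu> + t k *\<^sub>R \<eta>))"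
        using q(2) elim by (auto simp: \<delta>_def gph_def)
      also have "(G (x k), m k) - (G y + t k *\<^sub>R G' y v, \<mu> + t k *\<^sub>R \<eta>)
          = t k *\<^sub>R ((G (x k) - G y) /\<^sub>R t k - G' y v, (m k - \<mu>) /\<^sub>R t k - \<eta>)"
        using t(1)[of k] by (simp add: scaleR_diff_right)
      also have "norm \<dots> = \<tau> k * t k" unfolding norm_scaleR \<tau>_def using t(1)[of k] by simp
      finally show ?case .
    qed
    have "\<forall>\<^sub>F k in sequentially. norm (x k - y) < e"
      using tendstoD[OF xy e] by (simp add: dist_norm)
    moreover have "\<forall>\<^sub>F k in sequentially. t k < e" by (rule order_tendstoD(2)[OF t(2) e])
    moreover have "\<forall>\<^sub>F k in sequentially. \<tau> k < e / 2" using e by (intro order_tendstoD(2)[OF \<tau>]) auto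
    ultimately show ?thesis using \<delta>
    proof eventually_elim
      case (elim k)
      have tk: "0 < t k" using t(1) .
      have fd: "norm (G (x k) - fst (q k)) \<le> \<delta> k"
        using norm_fst_le[of "G (x k) - fst (q k)" "m k - snd (q k)"] by (simp add: \<delta>_def minus_prod_def)
      have "norm (w' k - G' y v) < e"
      proof -
        have "w' k - G' y v = ((G (x k) - G y) /\<^sub>R t k - G' y v) - (G (x k) - fst (q k)) /\<^sub>R t k"
          by (simp add: w'_def algebra_simps)
        then have "norm (w' k - G' y v) \<le> norm ((G (x k) - G y) /\<^sub>R t k - G' y v) + norm ((G (x k) - fst (q k)) /\<^sub>R t k)"
          by (simp only: norm_triangle_ineq4)
        moreover have "norm ((G (x k) - G y) /\<^sub>R t k - G' y v) \<le> \<tau> k" unfolding \<tau>_def by (rule norm_fst_le)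
        moreover have "norm ((G (x k) - fst (q k)) /\<^sub>R t k) \<le> \<tau> k"
        proof -
          have "norm (G (x k) - fst (q k)) / t k \<le> \<tau> k" using fd elim(4) tk by (simp add: pos_divide_le_eq)
          then show ?thesis using tk by (simp add: divide_inverse mult.commute)
        qed
        ultimately show ?thesis using elim(3) by simp
      qed
      moreover have "\<delta> k \<le> e * t k"
      proof -
        have "\<tau> k * t k \<le> e * t k" using elim(3) e tk by (intro mult_right_mono) auto
        then show ?thesis using elim(4) by simp
      qed
      moreover have nq: "snd (q k) \<in> cnormal D (G y + t k *\<^sub>R w' k)"
        using q(1)[of k] by (simp add: fst_q gph_def case_prod_beta)
      ultimately obtain x' where x': "norm (x' - x k) \<le> c * norm (G (x k) - fst (q k))" "snd (q k) \<in> cnormal D (G x')"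
        using solve[of "x k" "t k" "w' k" "snd (q k)" 0] elim tk fd e by (auto simp: fst_q)
      have "dist (x k, m k) (x', snd (q k)) \<le> norm (x k - x') + norm (m k - snd (q k))"
        unfolding dist_norm using norm_Pair_le[of "x k - x'" "m k - snd (q k)"] by simp
      also have "\<dots> \<le> c * \<delta> k + \<delta> k"
      proof -
        have "norm (m k - snd (q k)) \<le> \<delta> k"
          using norm_snd_le[of "m k - snd (q k)" "G (x k) - fst (q k)"] by (simp add: \<delta>_def minus_prod_def)
        moreover have "norm (x' - x k) \<le> c * \<delta> k"
          using x'(1) mult_left_mono[OF fd, of c] c by linarith
        ultimately show ?thesis by (simp add: norm_minus_commute)
      qed
      finally have d: "dist (x k, m k) (x', snd (q k)) \<le> (c + 1) * \<delta> k" by (simp add: algebra_simps)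
      have "dist_set (x k, m k) {(x, n). n \<in> cnormal D (G x)} \<le> ennreal (dist (x k, m k) (x', snd (q k)))"
        by (rule dist_set_le) (simp add: x')
      also have "\<dots> \<le> ennreal ((c + 1) * \<delta> k)" using d by (rule ennreal_leI)
      also have "\<dots> = ennreal (c + 1) * ennreal (\<delta> k)" using c by (simp add: \<delta>_def ennreal_mult)
      also have "\<dots> \<le> ennreal (c + 1) * dist_set 0 {(G (x k), m k) - q | q. q \<in> gph (cnormal D)}"
        by (intro mult_left_mono dist_set_differences) (use q(2) in \<open>auto simp: \<delta>_def\<close>)
      finally show ?case by (simp add: a zero_prod_def)
    qed
  qed
  have "((y, \<mu>), (0, 0)) \<in> gph graph_system"
    using \<mu> by (auto simp: gph_def zero_prod_def)
  moreover have "0 < c + 1" using c by simp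
  ultimately show ?thesis
    unfolding metrically_subregular_in_direction_def fst_conv snd_conv sols
    using main by blast
qed

section \<open>The directional coderivative\<close>

text \<open>
  Tangents \<open>(q, n')\<close> to the graph of the normals of \<open>D\<close> lift to tangents of the graph of \<open>N\<close>, and it
  suffices that \<open>G' z0 v'\<close> equals \<open>q\<close> modulo the annihilated subspace. This holds with one radius \<open>e\<close>
  for all base points \<open>z0\<close> whose images under \<open>G\<close> approach \<open>G y\<close> along \<open>G' y v\<close>.
\<close>

lemma tangent_preimage:
  assumes w: "G' y v \<in> T"
    and A: "\<And>\<mu>. adjoint (G' y) \<mu> = 0 \<Longrightarrow> \<mu> \<in> span (cnormal T (G' y v)) \<Longrightarrow> \<mu> = 0"
  obtains e where "0 < e"
    "\<And>z0 t w' n q n' v'. norm (z0 - y) < e \<Longrightarrow> 0 < t \<Longrightarrow> t < e \<Longrightarrow> norm (w' - G' y v) < e \<Longrightarrow>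
       G z0 = G y + t *\<^sub>R w' \<Longrightarrow> n \<in> cnormal D (G z0) \<Longrightarrow>
       (q, n') \<in> tangent_cone (gph (cnormal D)) (G z0, n) \<Longrightarrow> annihilates v (G' z0 v' - q) \<Longrightarrow>
       (v', adjoint (B' z0 v') n + adjoint (B z0) n') \<in> tangent_cone (gph N) (z0, adjoint (B z0) n)"
proof -
  obtain c e where c: "0 < c" and e: "0 < e" and
    solve: "\<And>x t w' l0 n. norm (x - y) < e \<Longrightarrow> 0 < t \<Longrightarrow> t < e \<Longrightarrow> norm (w' - G' y v) < e \<Longrightarrow>
       n \<in> cnormal D (G y + t *\<^sub>R w') \<Longrightarrow> annihilates v l0 \<Longrightarrow> norm l0 \<le> e * t \<Longrightarrow>
       norm (G x - (G y + t *\<^sub>R w' + l0)) \<le> e * t \<Longrightarrow>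
       \<exists>x'. norm (x' - x) \<le> c * norm (G x - (G y + t *\<^sub>R w' + l0)) \<and> n \<in> cnormal D (G x')"
    using solvable_near[OF w A] by metis
  have "\<forall>\<^sub>F z0 in nhds y. \<forall>\<^sub>F z in nhds z0. \<forall>\<mu>\<in>cnormal D (G z). adjoint (B z) \<mu> \<in> N z"
    using normal by (subst eventually_eventually)
  then obtain e' where e': "0 < e'" "\<And>z0. norm (z0 - y) < e' \<Longrightarrow>
      \<forall>\<^sub>F z in nhds z0. \<forall>\<mu>\<in>cnormal D (G z). adjoint (B z) \<mu> \<in> N z"
    unfolding eventually_nhds_metric dist_norm by blast
  show ?thesis
  proof (rule that[of "min e e'"])
    fix z0 t w' n q n' v'
    assume z0: "norm (z0 - y) < min e e'" and t: "0 < t" "t < min e e'" and w': "norm (w' - G' y v) < min e e'"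
      and G0: "G z0 = G y + t *\<^sub>R w'" and n: "n \<in> cnormal D (G z0)"
      and tan: "(q, n') \<in> tangent_cone (gph (cnormal D)) (G z0, n)" and ann: "annihilates v (G' z0 v' - q)"
    define l0 where "l0 = G' z0 v' - q"
    obtain s ws where s: "\<And>j::nat. 0 < s j" "s \<longlonglongrightarrow> 0" "ws \<longlonglongrightarrow> (q, n')"
      "\<And>j. (G z0, n) + s j *\<^sub>R ws j \<in> gph (cnormal D)"
      using tan unfolding tangent_cone_def by blast
    define qs where "qs = (\<lambda>j. fst (ws j))"
    define ns where "ns = (\<lambda>j. n + s j *\<^sub>R snd (ws j))"
    have qs: "qs \<longlonglongrightarrow> q" unfolding qs_def using tendsto_fst[OF s(3)] by simp
    have nq: "(\<lambda>j. (ns j - n) /\<^sub>R s j) \<longlonglongrightarrow> n'"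
      using tendsto_snd[OF s(3)] s(1) by (simp add: ns_def less_imp_neq[symmetric])
    define wj where "wj = (\<lambda>j. w' + (s j / t) *\<^sub>R qs j)"
    have G_eq: "G y + t *\<^sub>R wj j = G z0 + s j *\<^sub>R qs j" for j
      using t by (simp add: wj_def G0 algebra_simps)
    have ns: "ns j \<in> cnormal D (G y + t *\<^sub>R wj j)" for j
      using s(4)[of j] unfolding G_eq by (cases "ws j") (simp add: ns_def qs_def gph_def)
    define x where "x = (\<lambda>j. z0 + s j *\<^sub>R v')"
    have xq: "(\<lambda>j. (x j - z0) /\<^sub>R s j) \<longlonglongrightarrow> v'" using s(1) by (simp add: x_def less_imp_neq[symmetric])
    have xz: "x \<longlonglongrightarrow> z0" by (rule quotient_imp_tendsto[OF s(1,2) xq])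
    define \<rho> where "\<rho> = (\<lambda>j. norm (G (x j) - (G y + t *\<^sub>R wj j + s j *\<^sub>R l0)))"
    have "(\<lambda>j. norm ((G (x j) - G z0) /\<^sub>R s j - qs j - l0)) \<longlonglongrightarrow> norm (G' z0 v' - q - l0)"
      by (intro tendsto_intros has_derivative_quotient[OF G_deriv s(1,2) xq] qs)
    moreover have "norm ((G (x j) - G z0) /\<^sub>R s j - qs j - l0) = \<rho> j / s j" for j
    proof -
      have "(G (x j) - G z0) /\<^sub>R s j - qs j - l0 = (G (x j) - (G y + t *\<^sub>R wj j + s j *\<^sub>R l0)) /\<^sub>R s j"
        using s(1)[of j] unfolding G_eq by (simp add: algebra_simps)
      then show ?thesis using s(1)[of j] by (simp add: \<rho>_def divide_inverse mult.commute)
    qed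
    ultimately have \<rho>: "(\<lambda>j. \<rho> j / s j) \<longlonglongrightarrow> 0" by (simp add: l0_def)
    have "(\<lambda>j. \<rho> j / s j * s j) \<longlonglongrightarrow> 0 * 0" by (intro tendsto_intros \<rho> s)
    then have \<rho>0: "\<rho> \<longlonglongrightarrow> 0" using s(1) by (simp add: less_imp_neq[symmetric])
    have et: "0 < e * t" using e t by simp
    have "\<forall>\<^sub>F j in sequentially. norm (x j - y) < e"
    proof -
      have "(\<lambda>j. norm (x j - y)) \<longlonglongrightarrow> norm (z0 - y)" by (intro tendsto_intros xz)
      then show ?thesis using z0 by (intro order_tendstoD(2)) auto
    qed
    moreover have "\<forall>\<^sub>F j in sequentially. norm (wj j - G' y v) < e"
    proof -
      have "(\<lambda>j. norm (wj j - G' y v)) \<longlonglongrightarrow> norm (w' + (0 / t) *\<^sub>R q - G' y v)"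
        unfolding wj_def using t by (intro tendsto_intros s qs) auto
      then show ?thesis using w' by (intro order_tendstoD(2)) auto
    qed
    moreover have "\<forall>\<^sub>F j in sequentially. norm (s j *\<^sub>R l0) < e * t"
    proof -
      have "(\<lambda>j. norm (s j *\<^sub>R l0)) \<longlonglongrightarrow> norm (0 *\<^sub>R l0)" by (intro tendsto_intros s)
      then show ?thesis using et by (intro order_tendstoD(2)) auto
    qed
    moreover have "\<forall>\<^sub>F j in sequentially. \<rho> j < e * t" by (rule order_tendstoD(2)[OF \<rho>0 et])
    ultimately have "\<forall>\<^sub>F j in sequentially. \<exists>x'. norm (x' - x j) \<le> c * \<rho> j \<and> ns j \<in> cnormal D (G x')"
    proof eventually_elim
      case (elim j)
      have "annihilates v (s j *\<^sub>R l0)" using ann by (auto simp: l0_def)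
      then show ?case
        using solve[OF elim(1) t(1) _ elim(2) ns, of "s j *\<^sub>R l0"] elim t by (auto simp: \<rho>_def)
    qed
    then have "\<exists>x'. \<forall>\<^sub>F j in sequentially. norm (x' j - x j) \<le> c * \<rho> j \<and> ns j \<in> cnormal D (G (x' j))"
      by (intro exI[of _ "\<lambda>j. SOME x'. norm (x' - x j) \<le> c * \<rho> j \<and> ns j \<in> cnormal D (G x')"])
        (erule eventually_mono, rule someI_ex)
    then obtain x' where x': "\<forall>\<^sub>F j in sequentially. norm (x' j - x j) \<le> c * \<rho> j \<and> ns j \<in> cnormal D (G (x' j))"
      by blast
    have "(\<lambda>j. (x' j - x j) /\<^sub>R s j) \<longlonglongrightarrow> 0"
    proof (rule Lim_null_comparison)
      show "\<forall>\<^sub>F j in sequentially. norm ((x' j - x j) /\<^sub>R s j) \<le> c * (\<rho> j / s j)"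
        using x'
      proof eventually_elim
        case (elim j)
        then have "norm (x' j - x j) / s j \<le> c * \<rho> j / s j" using s(1)[of j] by (intro divide_right_mono) auto
        then show ?case using s(1)[of j] by (simp add: divide_inverse mult_ac)
      qed
      have "(\<lambda>j. c * (\<rho> j / s j)) \<longlonglongrightarrow> c * 0" by (intro tendsto_intros \<rho>)
      then show "(\<lambda>j. c * (\<rho> j / s j)) \<longlonglongrightarrow> 0" by simp
    qed
    from tendsto_add[OF this xq] have "(\<lambda>j. (x' j - z0) /\<^sub>R s j) \<longlonglongrightarrow> v'"
      by (simp flip: scaleR_add_right)
    moreover have "\<forall>\<^sub>F j in sequentially. ns j \<in> cnormal D (G (x' j))"
      using x' by (auto elim: eventually_mono)
    moreover have "norm (z0 - y) < e'" using z0 by simp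
    ultimately show "(v', adjoint (B' z0 v') n + adjoint (B z0) n') \<in> tangent_cone (gph N) (z0, adjoint (B z0) n)"
      using gph_tangentI[OF e'(2) s(1,2) _ nq _ n] by blast
  qed (use e e' in auto)
qed

text \<open>
  The transposed Jacobian of \<open>z \<mapsto> (B z)\<^sup>T \<mu>\<close>, applied to \<open>ws\<close>.
\<close>

definition transposed :: "'y \<Rightarrow> 's \<Rightarrow> 'n \<Rightarrow> 'y" where
  "transposed z \<mu> ws = adjoint (\<lambda>v. adjoint (blinfun_apply (blinfun_apply (B' z) v)) \<mu>) ws"

lemma inner_transposed: "v \<bullet> transposed z \<mu> ws = adjoint (B' z v) \<mu> \<bullet> ws"
  unfolding transposed_def
  by (rule adjoint_works)
    (auto intro!: linearI simp: blinfun.add_right blinfun.scaleR_right adj.add_left adj.scaleR_left)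

lemma transposed_tendsto:
  assumes x: "x \<longlonglongrightarrow> y" and m: "m \<longlonglongrightarrow> \<mu>" and ws: "wk \<longlonglongrightarrow> ws"
  shows "(\<lambda>k. transposed (x k) (m k) (wk k)) \<longlonglongrightarrow> transposed y \<mu> ws"
proof (subst tendsto_componentwise_iff, intro ballI)
  fix i :: 'y assume "i \<in> Basis"
  have "(\<lambda>k. adjoint (B' (x k) i) (m k) \<bullet> wk k) \<longlonglongrightarrow> adjoint (B' y i) \<mu> \<bullet> ws"
    by (intro tendsto_inner adj.tendsto blinfun.tendsto isCont_tendsto_compose[OF B'_cont] x m ws tendsto_const)
  then show "(\<lambda>k. transposed (x k) (m k) (wk k) \<bullet> i) \<longlonglongrightarrow> transposed y \<mu> ws \<bullet> i"
    by (simp add: inner_transposed inner_commute[of _ i])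
qed

text \<open>
  Injectivity on a subspace is quantitative and therefore stable under small changes of \<open>z\<close>. In
  particular condition (A) passes to nearby points with the same subspace.
\<close>

lemma multiplier_estimate:
  assumes A: "\<And>\<mu>. adjoint (G' y) \<mu> = 0 \<Longrightarrow> \<mu> \<in> span M \<Longrightarrow> \<mu> = 0"
  obtains e c where "0 < e" "0 < c"
    "\<And>z \<zeta>. norm (z - y) < e \<Longrightarrow> \<zeta> \<in> span M \<Longrightarrow> c * norm \<zeta> \<le> norm (adjoint (G' z) \<zeta>)"
proof -
  have "\<exists>c>0. \<forall>\<zeta>\<in>span M. norm (adjoint (G' y) \<zeta>) \<ge> c * norm \<zeta>"
    by (rule injective_imp_isometric[OF closed_subspace[OF subspace_span] subspace_span adj.bounded_linear_right])
      (use A in blast)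
  then obtain c where c: "0 < c" "\<And>\<zeta>. \<zeta> \<in> span M \<Longrightarrow> c * norm \<zeta> \<le> norm (adjoint (G' y) \<zeta>)" by blast
  obtain K where K: "0 < K" "\<And>(C :: 'y \<Rightarrow>\<^sub>L 's) \<zeta>. norm (adjoint (blinfun_apply C) \<zeta>) \<le> norm C * norm \<zeta> * K"
    using adj.pos_bounded by blast
  have "0 < c / (2 * K)" using c K by simp
  then have "\<forall>\<^sub>F z in at y. dist (G' z) (G' y) < c / (2 * K)" using tendstoD[OF isContD[OF G'_cont]] by blast
  then obtain e where e: "0 < e" "\<And>z. norm (z - y) < e \<Longrightarrow> norm (G' z - G' y) < c / (2 * K)"
    unfolding eventually_at dist_norm using \<open>0 < c / (2 * K)\<close> by (metis UNIV_I diff_self norm_zero)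
  show ?thesis
  proof (rule that[of e "c / 2"])
    fix z \<zeta> assume z: "norm (z - y) < e" and \<zeta>: "\<zeta> \<in> span M"
    have "norm (adjoint (G' z - G' y) \<zeta>) \<le> norm (G' z - G' y) * (norm \<zeta> * K)"
      using K(2)[of "G' z - G' y" \<zeta>] by (simp add: mult_ac)
    also have "\<dots> \<le> c / (2 * K) * (norm \<zeta> * K)" using e(2)[OF z] K(1) by (intro mult_right_mono) auto
    also have "\<dots> = c / 2 * norm \<zeta>" using K(1) by simp
    finally have "norm (adjoint (G' z - G' y) \<zeta>) \<le> c / 2 * norm \<zeta>" .
    moreover have "norm (adjoint (G' y) \<zeta>) \<le> norm (adjoint (G' z) \<zeta>) + norm (adjoint (G' z - G' y) \<zeta>)"
      using norm_triangle_ineq4[of "adjoint (G' z) \<zeta>" "adjoint (G' z - G' y) \<zeta>"] by (simp add: adj.diff_left)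
    ultimately show "c / 2 * norm \<zeta> \<le> norm (adjoint (G' z) \<zeta>)" using c(2)[OF \<zeta>] by linarith
  qed (use e c in auto)
qed

text \<open>
  At the points of the defining sequence a regular normal \<open>(zk, - wk)\<close> of the graph of \<open>N\<close> is
  tested against lifted tangents. Tangents \<open>(v', 0)\<close> with \<open>G' v'\<close> annihilated come with both signs and
  force the first component, after subtraction of the transposed Jacobian, to be \<open>G'\<^sup>T \<zeta>\<close> with \<open>\<zeta>\<close> in the
  span of the normals. All other lifted tangents say that \<open>(\<zeta>, - B wk)\<close> is a regular normal to the graph
  of the normals of \<open>D\<close>. By \<open>multiplier_estimate\<close> the \<open>\<zeta>\<close> are bounded.
\<close>

proposition directional_coderivative_subset:
  assumes A: "\<And>\<mu>. adjoint (G' y) \<mu> = 0 \<Longrightarrow> \<mu> \<in> span (cnormal T (G' y v)) \<Longrightarrow> \<mu> = 0"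
    and A': "\<And>\<mu>. adjoint (B y) \<mu> = 0 \<Longrightarrow> \<mu> \<in> span (cnormal T (G' y v)) \<Longrightarrow> \<mu> = 0"
    and zs: "zs \<in> directional_coderivative N (y, xs) (v, us) ws"
  obtains \<mu> \<eta> \<zeta> where "\<mu> \<in> cnormal D (G y)" "adjoint (B y) \<mu> = xs"
    "\<eta> \<in> graphical_derivative (\<lambda>(x, b). {\<mu> \<in> cnormal D (G x). adjoint (B x) \<mu> = b}) ((y, xs), \<mu>) (v, us)"
    "\<zeta> \<in> directional_coderivative (cnormal D) (G y, \<mu>) (G' y v, \<eta>) (B y ws)"
    "zs = transposed y \<mu> ws + adjoint (G' y) \<zeta>"
proof -
  let ?M = "cnormal T (G' y v)"
  obtain t0 d0 b0 where t0: "\<And>k::nat. 0 < t0 k" "t0 \<longlonglongrightarrow> 0" and d0: "d0 \<longlonglongrightarrow> (v, us)"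
    and b0: "b0 \<longlonglongrightarrow> (zs, - ws)" "\<And>k. b0 k \<in> regular_normal_cone (gph N) ((y, xs) + t0 k *\<^sub>R d0 k)"
    using zs unfolding directional_coderivative_def directional_normal_cone_def by blast
  have mem: "xs + t0 k *\<^sub>R snd (d0 k) \<in> N (y + t0 k *\<^sub>R fst (d0 k))" for k
    using b0(2)[of k] by (cases "d0 k") (simp add: regular_normal_cone_def gph_def)
  obtain r0 m0 \<mu> where r0: "strict_mono (r0 :: nat \<Rightarrow> nat)" and m0: "m0 \<longlonglongrightarrow> \<mu>"
    "\<And>k. m0 k \<in> cnormal D (G (y + t0 (r0 k) *\<^sub>R fst (d0 (r0 k))))"
    "\<And>k. adjoint (B (y + t0 (r0 k) *\<^sub>R fst (d0 (r0 k)))) (m0 k) = xs + t0 (r0 k) *\<^sub>R snd (d0 (r0 k))"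
    "\<And>k. m0 k \<in> ?M" and \<mu>: "\<mu> \<in> ?M" "\<mu> \<in> cnormal D (G y)" "adjoint (B y) \<mu> = xs"
    and quot: "(\<lambda>k. adjoint (B y) ((m0 k - \<mu>) /\<^sub>R t0 (r0 k))) \<longlonglongrightarrow> us - adjoint (B' y v) \<mu>"
    by (rule multiplier_sequence[OF t0 tendsto_fst[OF d0] tendsto_snd[OF d0], simplified, OF mem])
      (use that in blast)
  have w: "G' y v \<in> T" using cnormalD(1)[OF \<mu>(1)] .
  \<comment> \<open>injectivity of \<open>(B y)\<^sup>T\<close> on the span bounds the quotients of the multipliers\<close>
  have "\<exists>c>0. \<forall>\<zeta>\<in>span ?M. norm (adjoint (B y) \<zeta>) \<ge> c * norm \<zeta>"
    by (rule injective_imp_isometric[OF closed_subspace[OF subspace_span] subspace_span adj.bounded_linear_right])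
      (use A' in blast)
  then obtain c where c: "0 < c" "\<And>\<zeta>. \<zeta> \<in> span ?M \<Longrightarrow> c * norm \<zeta> \<le> norm (adjoint (B y) \<zeta>)" by blast
  have "\<forall>\<^sub>F k in sequentially. norm (adjoint (B y) ((m0 k - \<mu>) /\<^sub>R t0 (r0 k))) < norm (us - adjoint (B' y v) \<mu>) + 1"
    by (rule order_tendstoD(2)[OF tendsto_norm[OF quot]]) simp
  then have "\<forall>\<^sub>F k in sequentially. norm ((m0 k - \<mu>) /\<^sub>R t0 (r0 k)) \<le> (norm (us - adjoint (B' y v) \<mu>) + 1) / c"
  proof eventually_elim
    case (elim k)
    have "(m0 k - \<mu>) /\<^sub>R t0 (r0 k) \<in> span ?M"
      by (intro span_scale span_diff span_base m0 \<mu>)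
    then show ?case using elim c by (simp only: pos_le_divide_eq) (smt (verit) mult.commute)
  qed
  then obtain \<eta> r1 where r1: "strict_mono (r1 :: nat \<Rightarrow> nat)" and "((\<lambda>k. (m0 k - \<mu>) /\<^sub>R t0 (r0 k)) \<circ> r1) \<longlonglongrightarrow> \<eta>"
    by (rule eventually_bounded_subseq)
  then have \<eta>: "(\<lambda>k. (m0 (r1 k) - \<mu>) /\<^sub>R t0 (r0 (r1 k))) \<longlonglongrightarrow> \<eta>" by (simp add: o_def)
  define r where "r = r0 \<circ> r1"
  have r: "strict_mono r" unfolding r_def using r0 r1 by (rule strict_mono_o)
  define t where "t = (\<lambda>k. t0 (r k))"
  define x where "x = (\<lambda>k. y + t k *\<^sub>R fst (d0 (r k)))"
  define uk where "uk = (\<lambda>k. snd (d0 (r k)))"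
  define m where "m = (\<lambda>k. m0 (r1 k))"
  define zk where "zk = (\<lambda>k. fst (b0 (r k)))"
  define wk where "wk = (\<lambda>k. - snd (b0 (r k)))"
  have t: "\<And>k. 0 < t k" "t \<longlonglongrightarrow> 0"
    using t0 LIMSEQ_subseq_LIMSEQ[OF t0(2) r] by (auto simp: t_def o_def)
  have d0r: "(\<lambda>k. d0 (r k)) \<longlonglongrightarrow> (v, us)" using LIMSEQ_subseq_LIMSEQ[OF d0 r] by (simp add: o_def)
  have xq: "(\<lambda>k. (x k - y) /\<^sub>R t k) \<longlonglongrightarrow> v"
    using tendsto_fst[OF d0r] t(1) by (simp add: x_def less_imp_neq[symmetric])
  have xy: "x \<longlonglongrightarrow> y" by (rule quotient_imp_tendsto[OF t xq])
  have uk: "uk \<longlonglongrightarrow> us" using tendsto_snd[OF d0r] by (simp add: uk_def)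
  have b0r: "(\<lambda>k. b0 (r k)) \<longlonglongrightarrow> (zs, - ws)" using LIMSEQ_subseq_LIMSEQ[OF b0(1) r] by (simp add: o_def)
  have zk: "zk \<longlonglongrightarrow> zs" using tendsto_fst[OF b0r] by (simp add: zk_def)
  have wk: "wk \<longlonglongrightarrow> ws" using tendsto_minus[OF tendsto_snd[OF b0r]] by (simp add: wk_def)
  have mq: "(\<lambda>k. (m k - \<mu>) /\<^sub>R t k) \<longlonglongrightarrow> \<eta>" using \<eta> by (simp add: m_def t_def r_def)
  have m: "m \<longlonglongrightarrow> \<mu>" by (rule quotient_imp_tendsto[OF t mq])
  have mN: "m k \<in> cnormal D (G (x k))" and mB: "adjoint (B (x k)) (m k) = xs + t k *\<^sub>R uk k" for k
    using m0(2,3)[of "r1 k"] by (simp_all add: m_def x_def t_def r_def uk_def)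
  have reg: "(zk k, - wk k) \<in> regular_normal_cone (gph N) (x k, adjoint (B (x k)) (m k))" for k
  proof -
    have "(y, xs) + t k *\<^sub>R d0 (r k) = (x k, adjoint (B (x k)) (m k))"
      by (subst mB) (simp add: x_def uk_def prod_eq_iff)
    then show ?thesis using b0(2)[of "r k"] by (simp add: zk_def wk_def t_def)
  qed
  have "\<eta> \<in> graphical_derivative (\<lambda>(x, b). {\<mu> \<in> cnormal D (G x). adjoint (B x) \<mu> = b}) ((y, xs), \<mu>) (v, us)"
    unfolding graphical_derivative_def mem_Collect_eq
  proof (rule tangent_coneI[of _ _ t "\<lambda>k. ((x k, xs + t k *\<^sub>R uk k), m k)"])
    have "(\<lambda>k. (((x k - y) /\<^sub>R t k, uk k), (m k - \<mu>) /\<^sub>R t k)) \<longlonglongrightarrow> ((v, us), \<eta>)"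
      by (intro tendsto_Pair xq uk mq)
    then show "(\<lambda>k. (((x k, xs + t k *\<^sub>R uk k), m k) - ((y, xs), \<mu>)) /\<^sub>R t k) \<longlonglongrightarrow> ((v, us), \<eta>)"
      using t(1) by (simp add: less_imp_neq[symmetric])
  qed (use \<mu> mN mB t in \<open>auto simp: gph_def\<close>)
  define w' where "w' = (\<lambda>k. (G (x k) - G y) /\<^sub>R t k)"
  have w': "w' \<longlonglongrightarrow> G' y v" unfolding w'_def by (rule has_derivative_quotient[OF G_deriv t xq])
  have Gx: "G (x k) = G y + t k *\<^sub>R w' k" for k using t(1)[of k] by (simp add: w'_def)
  obtain e1 where e1: "0 < e1" and
    tang: "\<And>z0 t w' n q n' v'. norm (z0 - y) < e1 \<Longrightarrow> 0 < t \<Longrightarrow> t < e1 \<Longrightarrow> norm (w' - G' y v) < e1 \<Longrightarrow>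
       G z0 = G y + t *\<^sub>R w' \<Longrightarrow> n \<in> cnormal D (G z0) \<Longrightarrow>
       (q, n') \<in> tangent_cone (gph (cnormal D)) (G z0, n) \<Longrightarrow> annihilates v (G' z0 v' - q) \<Longrightarrow>
       (v', adjoint (B' z0 v') n + adjoint (B z0) n') \<in> tangent_cone (gph N) (z0, adjoint (B z0) n)"
    by (rule tangent_preimage[OF w], erule (1) A) (rule that, assumption, blast)
  obtain e2 c2 where e2: "0 < e2" and c2: "0 < c2" and
    est: "\<And>z \<zeta>. norm (z - y) < e2 \<Longrightarrow> \<zeta> \<in> span ?M \<Longrightarrow> c2 * norm \<zeta> \<le> norm (adjoint (G' z) \<zeta>)"
    by (rule multiplier_estimate[of ?M], erule (1) A) (metis that)
  define ck where "ck = (\<lambda>k. zk k - transposed (x k) (m k) (wk k))"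
  have ck: "ck \<longlonglongrightarrow> zs - transposed y \<mu> ws" unfolding ck_def
    by (intro tendsto_diff zk transposed_tendsto xy m wk)
  have "\<forall>\<^sub>F k in sequentially. norm (x k - y) < e1" using tendstoD[OF xy e1] by (simp add: dist_norm)
  moreover have "\<forall>\<^sub>F k in sequentially. norm (x k - y) < e2" using tendstoD[OF xy e2] by (simp add: dist_norm)
  moreover have "\<forall>\<^sub>F k in sequentially. norm (w' k - G' y v) < e1" using tendstoD[OF w' e1] by (simp add: dist_norm)
  moreover have "\<forall>\<^sub>F k in sequentially. t k < e1" by (rule order_tendstoD(2)[OF t(2) e1])
  moreover have "\<forall>\<^sub>F k in sequentially. norm (ck k) < norm (zs - transposed y \<mu> ws) + 1"
    by (rule order_tendstoD(2)[OF tendsto_norm[OF ck]]) simp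
  ultimately have "\<forall>\<^sub>F k in sequentially. \<exists>\<zeta>. adjoint (G' (x k)) \<zeta> = ck k \<and>
      (\<zeta>, - B (x k) (wk k)) \<in> regular_normal_cone (gph (cnormal D)) (G (x k), m k) \<and>
      norm \<zeta> \<le> (norm (zs - transposed y \<mu> ws) + 1) / c2"
  proof eventually_elim
    case (elim k)
    have gphD: "(G (x k), m k) \<in> gph (cnormal D)" using mN by (simp add: gph_def)
    have ineq: "ck k \<bullet> v' - B (x k) (wk k) \<bullet> n' \<le> 0"
      if "(q, n') \<in> tangent_cone (gph (cnormal D)) (G (x k), m k)" "annihilates v (G' (x k) v' - q)" for v' q n'
    proof -
      have "(zk k, - wk k) \<bullet> (v', adjoint (B' (x k) v') (m k) + adjoint (B (x k)) n') \<le> 0"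
        using reg[of k] tang[OF elim(1) t(1) elim(4,3) Gx mN that] unfolding regular_normal_cone_def by blast
      then have "zk k \<bullet> v' - (wk k \<bullet> adjoint (B' (x k) v') (m k) + wk k \<bullet> adjoint (B (x k)) n') \<le> 0"
        unfolding inner_Pair inner_minus_left inner_add_right by linarith
      moreover have "wk k \<bullet> adjoint (B' (x k) v') (m k) = transposed (x k) (m k) (wk k) \<bullet> v'"
        by (metis inner_transposed inner_commute)
      moreover have "wk k \<bullet> adjoint (B (x k)) n' = B (x k) (wk k) \<bullet> n'" by (rule inner_adjoint_blinfun)
      ultimately show ?thesis by (simp add: ck_def inner_diff_left)
    qed
    have 0: "(0, 0) \<in> tangent_cone (gph (cnormal D)) (G (x k), m k)"
      by (rule tangent_cone_ray[of 1]) (use gphD in \<open>auto simp: zero_prod_def[symmetric]\<close>)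
    have "ck k \<bullet> v' = 0" if "\<forall>n\<in>?M. n \<bullet> G' (x k) v' = 0" for v'
      using ineq[OF 0, of v'] ineq[OF 0, of "- v'"] that by (simp add: blinfun.minus_right)
    then obtain \<zeta> where \<zeta>: "\<zeta> \<in> span ?M" "adjoint (G' (x k)) \<zeta> = ck k"
      by (rule adjoint_range_annihilator)
    have inj: "\<nu> = 0" if "adjoint (G' (x k)) \<nu> = 0" "\<nu> \<in> span ?M" for \<nu>
      using est[OF elim(2) that(2)] that(1) c2 by (simp add: mult_le_0_iff)
    have "\<zeta> \<bullet> q - B (x k) (wk k) \<bullet> n' \<le> 0" if qn: "(q, n') \<in> tangent_cone (gph (cnormal D)) (G (x k), m k)" for q n'
    proof -
      obtain v' l where l: "annihilates v l" "G' (x k) v' + l = q"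
        using surjective_modulo_annihilator[of "G' (x k)" ?M q] inj by blast
      have "G' (x k) v' - q = - l" using l(2) by (simp add: algebra_simps)
      then have ann: "annihilates v (G' (x k) v' - q)" using l(1) by simp
      have "span ?M \<subseteq> {n. n \<bullet> l = 0}"
        by (rule span_minimal) (use l(1) in \<open>auto simp: subspace_def inner_add_left\<close>)
      then have "\<zeta> \<bullet> l = 0" using \<zeta>(1) by blast
      then have "\<zeta> \<bullet> q = ck k \<bullet> v'"
        using \<zeta>(2) by (simp add: l(2)[symmetric] inner_add_right) (metis inner_adjoint_blinfun inner_commute)
      then show ?thesis using ineq[OF qn ann] by simp
    qed
    then have "(\<zeta>, - B (x k) (wk k)) \<in> regular_normal_cone (gph (cnormal D)) (G (x k), m k)"
      using gphD by (auto simp: regular_normal_cone_def)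
    moreover have "norm \<zeta> \<le> (norm (zs - transposed y \<mu> ws) + 1) / c2"
      using est[OF elim(2) \<zeta>(1)] elim(5) c2 by (simp add: \<zeta>(2) pos_le_divide_eq mult.commute)
    ultimately show ?case using \<zeta>(2) by blast
  qed
  then obtain j where j: "\<And>k. k \<ge> j \<Longrightarrow> \<exists>\<zeta>. adjoint (G' (x k)) \<zeta> = ck k \<and>
      (\<zeta>, - B (x k) (wk k)) \<in> regular_normal_cone (gph (cnormal D)) (G (x k), m k) \<and>
      norm \<zeta> \<le> (norm (zs - transposed y \<mu> ws) + 1) / c2"
    unfolding eventually_sequentially by blast
  \<comment> \<open>indices are shifted by \<open>j\<close> so that the regular normals are available for every \<open>k\<close>\<close>
  define \<zeta> where "\<zeta> = (\<lambda>k. SOME \<zeta>. adjoint (G' (x (k + j))) \<zeta> = ck (k + j) \<and>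
      (\<zeta>, - B (x (k + j)) (wk (k + j))) \<in> regular_normal_cone (gph (cnormal D)) (G (x (k + j)), m (k + j)) \<and>
      norm \<zeta> \<le> (norm (zs - transposed y \<mu> ws) + 1) / c2)"
  have \<zeta>: "adjoint (G' (x (k + j))) (\<zeta> k) = ck (k + j)"
      "(\<zeta> k, - B (x (k + j)) (wk (k + j))) \<in> regular_normal_cone (gph (cnormal D)) (G (x (k + j)), m (k + j))"
      "norm (\<zeta> k) \<le> (norm (zs - transposed y \<mu> ws) + 1) / c2" for k
    using someI_ex[OF j[of "k + j"]] unfolding \<zeta>_def by auto
  have "\<forall>\<^sub>F k in sequentially. norm (\<zeta> k) \<le> (norm (zs - transposed y \<mu> ws) + 1) / c2"
    using \<zeta>(3) by (intro always_eventually) blast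
  then obtain \<zeta>\<^sub>0 s where s: "strict_mono (s :: nat \<Rightarrow> nat)" "(\<zeta> \<circ> s) \<longlonglongrightarrow> \<zeta>\<^sub>0"
    by (rule eventually_bounded_subseq)
  define i where "i = (\<lambda>k. s k + j)"
  have i: "strict_mono i" using s(1) by (simp add: i_def strict_mono_def)
  note sub = LIMSEQ_subseq_LIMSEQ[OF _ i, unfolded o_def]
  have \<zeta>s: "(\<lambda>k. \<zeta> (s k)) \<longlonglongrightarrow> \<zeta>\<^sub>0" using s(2) by (simp add: o_def)
  have "adjoint (G' y) \<zeta>\<^sub>0 = zs - transposed y \<mu> ws"
  proof (rule LIMSEQ_unique)
    show "(\<lambda>k. adjoint (G' (x (i k))) (\<zeta> (s k))) \<longlonglongrightarrow> adjoint (G' y) \<zeta>\<^sub>0"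
      by (intro adj.tendsto isCont_tendsto_compose[OF G'_cont] sub[OF xy] \<zeta>s)
    show "(\<lambda>k. adjoint (G' (x (i k))) (\<zeta> (s k))) \<longlonglongrightarrow> zs - transposed y \<mu> ws"
      using sub[OF ck] by (simp add: i_def \<zeta>)
  qed
  then have "zs = transposed y \<mu> ws + adjoint (G' y) \<zeta>\<^sub>0" by simp
  moreover have "\<zeta>\<^sub>0 \<in> directional_coderivative (cnormal D) (G y, \<mu>) (G' y v, \<eta>) (B y ws)"
    unfolding directional_coderivative_def directional_normal_cone_def mem_Collect_eq
  proof (intro conjI exI)
    show "(G y, \<mu>) \<in> gph (cnormal D)" using \<mu> by (simp add: gph_def)
    show "\<forall>k. 0 < t (i k)" using t by simp
    show "(\<lambda>k. t (i k)) \<longlonglongrightarrow> 0" by (rule sub[OF t(2)])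
    show "(\<lambda>k. (w' (i k), (m (i k) - \<mu>) /\<^sub>R t (i k))) \<longlonglongrightarrow> (G' y v, \<eta>)"
      by (intro tendsto_Pair sub[OF w'] sub[OF mq])
    show "(\<lambda>k. (\<zeta> (s k), - B (x (i k)) (wk (i k)))) \<longlonglongrightarrow> (\<zeta>\<^sub>0, - B y ws)"
      by (intro tendsto_Pair tendsto_minus blinfun.tendsto B_tendsto sub[OF xy] sub[OF wk] \<zeta>s)
    show "\<forall>k. (\<zeta> (s k), - B (x (i k)) (wk (i k))) \<in> regular_normal_cone (gph (cnormal D))
        ((G y, \<mu>) + t (i k) *\<^sub>R (w' (i k), (m (i k) - \<mu>) /\<^sub>R t (i k)))"
    proof
      fix k
      have "(G y, \<mu>) + t (i k) *\<^sub>R (w' (i k), (m (i k) - \<mu>) /\<^sub>R t (i k)) = (G (x (i k)), m (i k))"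
        using t(1)[of "i k"] by (simp add: Gx)
      then show "(\<zeta> (s k), - B (x (i k)) (wk (i k))) \<in> regular_normal_cone (gph (cnormal D))
        ((G y, \<mu>) + t (i k) *\<^sub>R (w' (i k), (m (i k) - \<mu>) /\<^sub>R t (i k)))"
        using \<zeta>(2)[of "s k"] by (simp add: i_def)
    qed
  qed
  ultimately show ?thesis
    using that[OF \<mu>(2,3) \<open>\<eta> \<in> _\<close>] by blast
qed

end

section \<open>Parametric constraint systems\<close>

text \<open>
  \<open>gtilde g\<close> is \<open>g\<close> after the linear map \<open>\<iota>\<close>, and the partial Jacobian in the third variable is the
  derivative of \<open>g\<close> after the linear embedding \<open>j\<close>; composing the first and second derivative of \<open>g\<close>
  with these maps gives everything.
\<close>

lemma partial_derivative_data:
  fixes g :: "'l::euclidean_space \<times> 'n::euclidean_space \<times> 'n \<Rightarrow> 's::euclidean_space"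
  assumes "twice_continuously_differentiable g"
  shows "\<exists>G' (B :: 'l \<times> 'n \<Rightarrow> 'n \<Rightarrow>\<^sub>L 's) B' (H :: 'l \<times> 'n \<times> 'n \<Rightarrow> 'n \<Rightarrow>\<^sub>L 's).
    (\<forall>y. (gtilde g has_derivative blinfun_apply (G' y)) (at y)) \<and> (\<forall>y. isCont G' y) \<and>
    (\<forall>y. (B has_derivative blinfun_apply (B' y)) (at y)) \<and> (\<forall>y. isCont B' y) \<and>
    (\<forall>p x z. ((\<lambda>z. g (p, x, z)) has_derivative blinfun_apply (H (p, x, z))) (at z)) \<and>
    (\<forall>p x z. isCont (\<lambda>z. H (p, x, z)) z) \<and> (\<forall>p x. B (p, x) = H (p, x, x))"
proof -
  obtain g' :: "'l \<times> 'n \<times> 'n \<Rightarrow> ('l \<times> 'n \<times> 'n) \<Rightarrow>\<^sub>L 's"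
    and g'' :: "'l \<times> 'n \<times> 'n \<Rightarrow> ('l \<times> 'n \<times> 'n) \<Rightarrow>\<^sub>L (('l \<times> 'n \<times> 'n) \<Rightarrow>\<^sub>L 's)"
    where g': "\<And>a. (g has_derivative blinfun_apply (g' a)) (at a)" and g'': "\<And>a. (g' has_derivative blinfun_apply (g'' a)) (at a)"
      and cont: "continuous_on UNIV g''"
    using assms unfolding twice_continuously_differentiable_def by blast
  define \<iota> :: "'l \<times> 'n \<Rightarrow> 'l \<times> 'n \<times> 'n" where "\<iota> = (\<lambda>y. (fst y, snd y, snd y))"
  define j :: "'n \<Rightarrow> 'l \<times> 'n \<times> 'n" where "j = (\<lambda>z. (0, 0, z))"
  have \<iota>: "bounded_linear \<iota>" unfolding \<iota>_def
    by (intro bounded_linear_Pair bounded_linear_fst bounded_linear_snd)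
  have j: "bounded_linear j" unfolding j_def
    by (intro bounded_linear_Pair bounded_linear_zero bounded_linear_ident)
  define I where "I = Blinfun \<iota>"
  define J where "J = Blinfun j"
  have IJ: "blinfun_apply I = \<iota>" "blinfun_apply J = j"
    by (simp_all add: I_def J_def bounded_linear_Blinfun_apply \<iota> j)
  define C where "C = Blinfun (\<lambda>A :: ('l \<times> 'n \<times> 'n) \<Rightarrow>\<^sub>L 's. A o\<^sub>L J)"
  have C: "blinfun_apply C = (\<lambda>A. A o\<^sub>L J)" unfolding C_def
    by (intro bounded_linear_Blinfun_apply bounded_bilinear.bounded_linear_left[OF bounded_bilinear_blinfun_compose])
  define H where "H = (\<lambda>a. g' a o\<^sub>L J)"
  define B where "B = (\<lambda>y. H (\<iota> y))"
  define G' where "G' = (\<lambda>y. g' (\<iota> y) o\<^sub>L I)"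
  define B' where "B' = (\<lambda>y. C o\<^sub>L (g'' (\<iota> y) o\<^sub>L I))"
  have d\<iota>: "(\<iota> has_derivative \<iota>) (at y)" for y by (rule bounded_linear_imp_has_derivative[OF \<iota>])
  have c\<iota>: "isCont \<iota> y" for y using has_derivative_continuous[OF d\<iota>] .
  have cg': "isCont g' a" for a using has_derivative_continuous[OF g''] .
  have cg'': "isCont g'' a" for a using cont continuous_on_eq_continuous_at[OF open_UNIV, of g''] by blast
  have gt: "gtilde g = (\<lambda>y. g (\<iota> y))" by (auto simp: gtilde_def \<iota>_def)
  show ?thesis
  proof (intro exI[of _ G'] exI[of _ B] exI[of _ B'] exI[of _ H] conjI allI)
    fix y
    show "(gtilde g has_derivative blinfun_apply (G' y)) (at y)"
      using has_derivative_compose[OF d\<iota> g'] by (simp add: gt G'_def blinfun_compose.rep_eq IJ o_def)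
    show "isCont G' y" unfolding G'_def
      by (intro continuous_intros isCont_o2[OF c\<iota> cg'])
    have dH: "(H has_derivative (\<lambda>h. blinfun_apply C (blinfun_apply (g'' a) h))) (at a)" for a
      using bounded_linear.has_derivative[OF blinfun.bounded_linear_right[of C] g''[of a]]
      by (simp add: C H_def)
    show "(B has_derivative blinfun_apply (B' y)) (at y)"
      using has_derivative_compose[OF d\<iota> dH] by (simp add: B_def B'_def blinfun_compose.rep_eq IJ o_def)
    show "isCont B' y" unfolding B'_def
      by (intro continuous_intros isCont_o2[OF c\<iota> cg''])
  next
    fix p x z
    have dz: "((\<lambda>z. (p, x, z)) has_derivative j) (at z)" unfolding j_def by (auto intro!: derivative_eq_intros)
    show "((\<lambda>z. g (p, x, z)) has_derivative blinfun_apply (H (p, x, z))) (at z)"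
      using has_derivative_compose[OF dz g'] by (simp add: H_def blinfun_compose.rep_eq IJ o_def)
    show "isCont (\<lambda>z. H (p, x, z)) z" unfolding H_def
      by (intro continuous_intros isCont_o2[OF has_derivative_continuous[OF dz] cg'])
    show "B (p, x) = H (p, x, x)" by (simp add: B_def \<iota>_def)
  qed
qed

text \<open>
  The error bound holds on a neighbourhood, hence at all points near \<open>(p, x, x)\<close> for every \<open>(p, x)\<close> near the
  reference point, and \<open>normal_cone_preimage\<close> applies there with the same \<open>\<kappa>\<close>.
\<close>

lemma multiplier_system_near:
  fixes g :: "'l::euclidean_space \<times> 'n::euclidean_space \<times> 'n \<Rightarrow> 's::euclidean_space"
  assumes D: "polyhedron D" and g: "twice_continuously_differentiable g"
    and \<kappa>: "0 < \<kappa>" and eb: "\<forall>\<^sub>F (p, x, z) in nhds (pbar, xbar, xbar).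
           dist_set z (Gam g D (p, x)) \<le> ennreal \<kappa> * dist_set (g (p, x, z)) D"
  obtains G' and B :: "'l \<times> 'n \<Rightarrow> 'n \<Rightarrow>\<^sub>L 's" and B' where
    "\<forall>\<^sub>F y in nhds (pbar, xbar). multiplier_system D (gtilde g) G' B B' (NGam g D) \<kappa> y"
    "\<And>y. beta g y = blinfun_apply (B y)" "\<And>y. jac (gtilde g) y = blinfun_apply (G' y)"
    "\<And>y \<mu>. jac (pair_beta g \<mu>) y = (\<lambda>v. adjoint (blinfun_apply (blinfun_apply (B' y) v)) \<mu>)"
proof -
  obtain G' and B :: "'l \<times> 'n \<Rightarrow> 'n \<Rightarrow>\<^sub>L 's" and B' and H :: "'l \<times> 'n \<times> 'n \<Rightarrow> 'n \<Rightarrow>\<^sub>L 's" where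
    G': "\<And>y. (gtilde g has_derivative blinfun_apply (G' y)) (at y)" "\<And>y. isCont G' y"
    and B': "\<And>y. (B has_derivative blinfun_apply (B' y)) (at y)" "\<And>y. isCont B' y"
    and H: "\<And>p x z. ((\<lambda>z. g (p, x, z)) has_derivative blinfun_apply (H (p, x, z))) (at z)"
    "\<And>p x z. isCont (\<lambda>z. H (p, x, z)) z" and BH: "\<And>p x. B (p, x) = H (p, x, x)"
    using partial_derivative_data[OF g] by blast
  let ?eb = "\<lambda>(p, x, z). dist_set z (Gam g D (p, x)) \<le> ennreal \<kappa> * dist_set (g (p, x, z)) D"
  have "\<forall>\<^sub>F a in nhds (pbar, xbar, xbar). \<forall>\<^sub>F a' in nhds a. ?eb a'"
    using eb by (subst eventually_eventually)
  moreover have "filterlim (\<lambda>y. (fst y, snd y, snd y)) (nhds (pbar, xbar, xbar)) (nhds (pbar, xbar))"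
    by (intro tendsto_Pair tendsto_fst[of "\<lambda>y. y" "(pbar, xbar)", simplified fst_conv]
        tendsto_snd[of "\<lambda>y. y" "(pbar, xbar)", simplified snd_conv] filterlim_ident)
  ultimately have near: "\<forall>\<^sub>F y in nhds (pbar, xbar). \<forall>\<^sub>F a in nhds (fst y, snd y, snd y). ?eb a"
    by (rule eventually_compose_filterlim)
  define P where "P = (\<lambda>y. (\<forall>b\<in>NGam g D y. \<exists>\<mu>\<in>cnormal D (gtilde g y). adjoint (B y) \<mu> = b \<and> norm \<mu> \<le> \<kappa> * norm b) \<and>
      (\<forall>\<mu>\<in>cnormal D (gtilde g y). adjoint (B y) \<mu> \<in> NGam g D y))"
  have "\<forall>\<^sub>F y in nhds (pbar, xbar). P y"
    using near
  proof eventually_elim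
    case (elim y)
    obtain p x where y: "y = (p, x)" by fastforce
    have "filterlim (\<lambda>z. (p, x, z)) (nhds (p, x, x)) (nhds x)"
      by (intro tendsto_Pair tendsto_const filterlim_ident)
    from eventually_compose_filterlim[OF elim[unfolded y fst_conv snd_conv] this]
    have eb: "\<forall>\<^sub>F z in nhds x. dist_set z ((\<lambda>z. g (p, x, z)) -` D) \<le> ennreal \<kappa> * dist_set (g (p, x, z)) D"
      by (simp add: Gam_def vimage_def)
    have N: "NGam g D y = normal_cone ((\<lambda>z. g (p, x, z)) -` D) x"
      by (simp add: y NGam_def Gam_def vimage_def)
    have "0 \<le> \<kappa>" using \<kappa> by simp
    note pre = normal_cone_preimage[OF D H(1) this H(2) eb]
    show ?case unfolding P_def N using pre by (simp add: y gtilde_def BH)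
  qed
  then have "\<forall>\<^sub>F y in nhds (pbar, xbar). \<forall>\<^sub>F z in nhds y. P z" by (subst eventually_eventually)
  then have sys: "\<forall>\<^sub>F y in nhds (pbar, xbar). multiplier_system D (gtilde g) G' B B' (NGam g D) \<kappa> y"
  proof eventually_elim
    case (elim y)
    show ?case
      by unfold_locales (use D G' B' elim in \<open>auto simp: P_def elim: eventually_mono\<close>)
  qed
  have beta: "beta g y = blinfun_apply (B y)" for y
    using frechet_derivative_at[OF H(1)] by (cases y) (simp add: beta_def BH)
  have "jac (pair_beta g \<mu>) y = (\<lambda>v. adjoint (B' y v) \<mu>)" for y \<mu>
  proof -
    have "pair_beta g \<mu> = (\<lambda>y. adjoint (B y) \<mu>)" by (auto simp: pair_beta_def beta)
    then have "(pair_beta g \<mu> has_derivative (\<lambda>v. adjoint (B' y v) \<mu>)) (at y)"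
      using bounded_linear.has_derivative[OF adj.bounded_linear_left B'(1)] by simp
    from frechet_derivative_at[OF this] show ?thesis by simp
  qed
  then show ?thesis using that[OF sys beta] frechet_derivative_at[OF G'(1)] by metis
qed

theorem theorem5p5:
  fixes D :: "(real ^ 's) set"
    and g :: "(real ^ 'l) \<times> (real ^ 'n) \<times> (real ^ 'n) \<Rightarrow> real ^ 's"
    and pbar :: "real ^ 'l" and xbar :: "real ^ 'n"
  assumes "polyhedron D"
    and "twice_continuously_differentiable g"
    and "g (pbar, xbar, xbar) \<in> D"
    and "\<exists>\<kappa>>0. \<forall>\<^sub>F (p, x, z) in nhds (pbar, xbar, xbar).
           dist_set z (Gam g D (p, x)) \<le> ennreal \<kappa> * dist_set (g (p, x, z)) D"
  shows "\<forall>\<^sub>F y in nhds (pbar, xbar). \<forall>xs \<in> NGam g D y.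
    (\<forall>v. graphical_derivative (NGam g D) (y, xs) v \<subseteq>
       (\<Union>lam \<in> Lam g D (y, xs).
          {jac (pair_beta g lam) y v + adjoint (beta g y) eta | eta.
             eta \<in> normal_cone (critical_cone D (gtilde g y) lam) (jac (gtilde g) y v)})) \<and>
    (\<forall>v. \<forall>lam \<in> Lam g D (y, xs).
       \<forall>eta \<in> normal_cone (critical_cone D (gtilde g y) lam) (jac (gtilde g) y v).
         (metrically_subregular_in_direction (subreg_map g D) ((y, lam), (0, 0)) (v, eta) \<longrightarrow>
            jac (pair_beta g lam) y v + adjoint (beta g y) eta
              \<in> graphical_derivative (NGam g D) (y, xs) v) \<and>
         ((\<forall>\<mu>. adjoint (jac (gtilde g) y) \<mu> = 0 \<and>
                \<mu> \<in> span (normal_cone (tangent_cone D (gtilde g y)) (jac (gtilde g) y v)) \<longrightarrow> \<mu> = 0) \<longrightarrow>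
            metrically_subregular_in_direction (subreg_map g D) ((y, lam), (0, 0)) (v, eta))) \<and>
    (\<forall>v. (\<forall>\<mu>. adjoint (jac (gtilde g) y) \<mu> = 0 \<and>
               \<mu> \<in> span (normal_cone (tangent_cone D (gtilde g y)) (jac (gtilde g) y v)) \<longrightarrow> \<mu> = 0) \<and>
         (\<forall>\<mu>. adjoint (beta g y) \<mu> = 0 \<and>
               \<mu> \<in> span (normal_cone (tangent_cone D (gtilde g y)) (jac (gtilde g) y v)) \<longrightarrow> \<mu> = 0) \<longrightarrow>
         (\<forall>us \<in> graphical_derivative (NGam g D) (y, xs) v. \<forall>ws.
            directional_coderivative (NGam g D) (y, xs) (v, us) ws \<subseteq>
              (\<Union>lam \<in> Lam g D (y, xs).
                 \<Union>eta \<in> graphical_derivative (Lam g D) ((y, xs), lam) (v, us).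
                   {adjoint (jac (pair_beta g lam) y) ws + adjoint (jac (gtilde g) y) zeta | zeta.
                      zeta \<in> directional_coderivative (normal_cone D) (gtilde g y, lam)
                               (jac (gtilde g) y v, eta) (beta g y ws)})))"
proof -
  obtain \<kappa> where \<kappa>: "0 < \<kappa>" "\<forall>\<^sub>F (p, x, z) in nhds (pbar, xbar, xbar).
           dist_set z (Gam g D (p, x)) \<le> ennreal \<kappa> * dist_set (g (p, x, z)) D"
    using assms(4) by blast
  obtain G' B B' where near: "\<forall>\<^sub>F y in nhds (pbar, xbar). multiplier_system D (gtilde g) G' B B' (NGam g D) \<kappa> y"
    and beta: "\<And>y. beta g y = blinfun_apply (B y)" and jacG: "\<And>y. jac (gtilde g) y = blinfun_apply (G' y)"
    and jacB: "\<And>y \<mu>. jac (pair_beta g \<mu>) y = (\<lambda>v. adjoint (blinfun_apply (blinfun_apply (B' y) v)) \<mu>)"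
    by (rule multiplier_system_near[OF assms(1,2) \<kappa>]) (rule that, simp_all)
  show ?thesis
    using near
  proof eventually_elim
    case (elim y)
    interpret multiplier_system D "gtilde g" G' B B' "NGam g D" \<kappa> y by (rule elim)
    have poly: "polyhedron (tangent_cone D (gtilde g y))" "polyhedron (critical_cone D (gtilde g y) lam)" for lam
    proof -
      show "polyhedron (tangent_cone D (gtilde g y))"
        using polyhedron_tangent_cone_polyhedron(1)[OF D]
        by (cases "gtilde g y \<in> D") (auto simp: tangent_cone_def)
      then show "polyhedron (critical_cone D (gtilde g y) lam)"
        by (simp add: critical_cone_def polyhedron_hyperplane)
    qed
    have nT: "normal_cone (tangent_cone D (gtilde g y)) u = cnormal T u" for u
      by (intro normal_cone_convex polyhedron_imp_closed polyhedron_imp_convex poly)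
    have nK: "normal_cone (critical_cone D (gtilde g y) lam) u = cnormal (critical_cone D (gtilde g y) lam) u" for lam u
      by (intro normal_cone_convex polyhedron_imp_closed polyhedron_imp_convex poly)
    have Lam: "Lam g D = (\<lambda>(x, b). {\<mu> \<in> cnormal D (gtilde g x). adjoint (B x) \<mu> = b})"
      by (simp add: Lam_def normal_cone_D beta)
    have sub: "subreg_map g D = graph_system" by (simp add: subreg_map_def normal_cone_D)
    show ?case
      unfolding nT nK sub beta jacG jacB normal_cone_D
    proof (intro ballI conjI allI impI subsetI)
      fix xs v u assume "u \<in> graphical_derivative (NGam g D) (y, xs) v"
      then obtain \<mu> \<eta> where "\<mu> \<in> cnormal D (gtilde g y)" "adjoint (B y) \<mu> = xs"
        "\<eta> \<in> cnormal (critical_cone D (gtilde g y) \<mu>) (G' y v)" "u = adjoint (B' y v) \<mu> + adjoint (B y) \<eta>"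
        by (rule derivative_subset)
      then show "u \<in> (\<Union>lam\<in>Lam g D (y, xs). {adjoint (B' y v) lam + adjoint (B y) eta | eta.
          eta \<in> cnormal (critical_cone D (gtilde g y) lam) (G' y v)})"
        unfolding Lam by blast
    next
      fix xs v lam eta
      assume lam: "lam \<in> Lam g D (y, xs)" and eta: "eta \<in> cnormal (critical_cone D (gtilde g y) lam) (G' y v)"
      have lam': "lam \<in> cnormal D (gtilde g y)" "adjoint (B y) lam = xs" using lam by (simp_all add: Lam)
      show "adjoint (B' y v) lam + adjoint (B y) eta \<in> graphical_derivative (NGam g D) (y, xs) v"
        if "metrically_subregular_in_direction graph_system ((y, lam), (0, 0)) (v, eta)"
        using derivative_member[OF lam'(1) eta that] lam'(2) by simp
      show "metrically_subregular_in_direction graph_system ((y, lam), (0, 0)) (v, eta)"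
        if "\<forall>\<mu>. adjoint (G' y) \<mu> = 0 \<and> \<mu> \<in> span (cnormal T (G' y v)) \<longrightarrow> \<mu> = 0"
        using subregular[OF lam'(1) eta] that by blast
    next
      fix xs v us ws zs
      assume A: "(\<forall>\<mu>. adjoint (G' y) \<mu> = 0 \<and> \<mu> \<in> span (cnormal T (G' y v)) \<longrightarrow> \<mu> = 0) \<and>
          (\<forall>\<mu>. adjoint (B y) \<mu> = 0 \<and> \<mu> \<in> span (cnormal T (G' y v)) \<longrightarrow> \<mu> = 0)"
        and zs: "zs \<in> directional_coderivative (NGam g D) (y, xs) (v, us) ws"
      obtain \<mu> \<eta> \<zeta> where "\<mu> \<in> cnormal D (gtilde g y)" "adjoint (B y) \<mu> = xs"
        "\<eta> \<in> graphical_derivative (Lam g D) ((y, xs), \<mu>) (v, us)"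
        "\<zeta> \<in> directional_coderivative (cnormal D) (gtilde g y, \<mu>) (G' y v, \<eta>) (B y ws)"
        "zs = adjoint (\<lambda>v. adjoint (B' y v) \<mu>) ws + adjoint (G' y) \<zeta>"
        unfolding Lam using directional_coderivative_subset[OF _ _ zs, unfolded transposed_def] A by blast
      moreover from this have "\<mu> \<in> Lam g D (y, xs)" by (simp add: Lam)
      ultimately show "zs \<in> (\<Union>lam\<in>Lam g D (y, xs). \<Union>eta\<in>graphical_derivative (Lam g D) ((y, xs), lam) (v, us).
          {adjoint (\<lambda>v. adjoint (B' y v) lam) ws + adjoint (G' y) zeta | zeta.
            zeta \<in> directional_coderivative (cnormal D) (gtilde g y, lam) (G' y v, eta) (B y ws)})"
        by blast
    qed
  qed
qed

end
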